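(* Let $M$ be a (smooth or holomorphic) supermanifold of dimension $p|q$ and $x\in|M|$. Let $A$ be a super Weil algebra and $A^*$ its dual. Let $x_A\colon\mathcal{O}_{M,x}\to A$ be an $A$-point near $x$. If $\omega\in A^*$, then $$\omega\circ x_A\in\mathcal{O}_{M,x}^{*}.$$ Moreover, each element of $\mathcal{O}_{M,x}^{k*}$ can be obtained in this way with $$A=\mathcal{O}_{M,x}/\mathcal{M}_x^{k+1}\cong\mathbb{K}[p|q]/\mathcal{M}_0^{k+1}.$$
   Context: Let $\mathbb{K}=\mathbb{R}$ in the smooth case and $\mathbb{K}=\mathbb{C}$ in the holomorphic case. Superalgebras are unital, $\mathbb{Z}_2$-graded and supercommutative over $\mathbb{K}$. $\mathbb{K}^{p|q}$ is $\mathbb{K}^p$ with the sheaf of smooth (resp. holomorphic) functions tensored with the Grassmann algebra $\Lambda_{\mathbb{K}}(\theta_1,\dots,\theta_q)$; a supermanifold $M=(|M|,\mathcal{O}_M)$ of dimension $p|q$ is a topological space with a sheaf of superalgebras with local stalks, locally isomorphic to $\mathbb{K}^{p|q}$, with underlying reduced space a classical manifold. $\mathcal{O}_{M,x}$ is the stalk at $x$ and $\mathcal{M}_x$ its maximal ideal, consisting of the germs of sections whose value at $x$ is zero. A super Weil algebra is a finite-dimensional commutative unital superalgebra $A=\mathbb{K}\oplus\mathring{A}$ with $\mathring{A}$ a graded nilpotent ideal. An $A$-point near $x$ is a superalgebra morphism $\mathcal{O}_{M,x}\to A$. Write $\mathcal{O}_{M,x}'$ for the algebraic dual of the stalk. For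 $k\in\mathbb{N}$, the distributions with support at $x$ of order $k$ are $$\mathcal{O}_{M,x}^{k*}=\{v\in\mathcal{O}_{M,x}' : v(\mathcal{M}_x^{k+1})=0\},$$ and the distributions with support at $x$ are $\mathcal{O}_{M,x}^{*}=\bigcup_{k\ge0}\mathcal{O}_{M,x}^{k*}$. $\mathbb{K}[p|q]=\mathbb{K}[t_1,\dots,t_p]\otimes\Lambda(\theta_1,\dots,\theta_q)$ is the polynomial superalgebra in $p$ even and $q$ odd variables, and $\mathcal{M}_0$ denotes its ideal of polynomials without constant term. *)

theory Defs
  imports
    "HOL-Complex_Analysis.Complex_Analysis"
    "HOL-Algebra.Algebra"
    "HOL-Algebra.Algebraic_Closure_Type"
    "HOL-Library.Poly_Mapping"
begin

section \<open>Superalgebras\<close>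

record ('k, 'a) superalg = "('k, 'a) module" +
  even_part :: "'a set"
  odd_part :: "'a set"

text \<open>
  Unital, \<open>\<int>\<^sub>2\<close>-graded, supercommutative algebras over the field given by the type \<open>'k\<close>.
  That odd times even is odd follows from supercommutativity.
  The zero algebra is admitted, since it occurs as the algebra of sections over the empty set.
\<close>

definition superalgebra :: "('k::field, 'a) superalg \<Rightarrow> bool" where
  "superalgebra A \<longleftrightarrow>
     ring A \<and> module (ring_of_type_algebra :: 'k ring) A \<and>
     (\<forall>c. \<forall>a\<in>carrier A. \<forall>b\<in>carrier A.
        (c \<odot>\<^bsub>A\<^esub> a) \<otimes>\<^bsub>A\<^esub> b = c \<odot>\<^bsub>A\<^esub> (a \<otimes>\<^bsub>A\<^esub> b) \<and> a \<otimes>\<^bsub>A\<^esub> (c \<odot>\<^bsub>A\<^esub> b) = c \<odot>\<^bsub>A\<^esub> (a \<otimes>\<^bsub>A\<^esub> b)) \<and>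
     submodule (even_part A) (ring_of_type_algebra :: 'k ring) A \<and>
     submodule (odd_part A) (ring_of_type_algebra :: 'k ring) A \<and>
     carrier A = even_part A <+>\<^bsub>A\<^esub> odd_part A \<and> even_part A \<inter> odd_part A = {\<zero>\<^bsub>A\<^esub>} \<and>
     \<one>\<^bsub>A\<^esub> \<in> even_part A \<and>
     (\<forall>a\<in>even_part A. \<forall>b\<in>even_part A. a \<otimes>\<^bsub>A\<^esub> b \<in> even_part A) \<and>
     (\<forall>a\<in>even_part A. \<forall>b\<in>odd_part A. a \<otimes>\<^bsub>A\<^esub> b \<in> odd_part A) \<and>
     (\<forall>a\<in>odd_part A. \<forall>b\<in>odd_part A. a \<otimes>\<^bsub>A\<^esub> b \<in> even_part A) \<and>
     (\<forall>a\<in>even_part A. \<forall>b\<in>carrier A. a \<otimes>\<^bsub>A\<^esub> b = b \<otimes>\<^bsub>A\<^esub> a) \<and>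
     (\<forall>a\<in>odd_part A. \<forall>b\<in>odd_part A. a \<otimes>\<^bsub>A\<^esub> b = \<ominus>\<^bsub>A\<^esub> (b \<otimes>\<^bsub>A\<^esub> a))"

definition superalg_hom :: "('k, 'a) superalg \<Rightarrow> ('k, 'b) superalg \<Rightarrow> ('a \<Rightarrow> 'b) set" where
  "superalg_hom A B =
     {h \<in> ring_hom A B. (\<forall>c. \<forall>a\<in>carrier A. h (c \<odot>\<^bsub>A\<^esub> a) = c \<odot>\<^bsub>B\<^esub> h a) \<and>
        h ` even_part A \<subseteq> even_part B \<and> h ` odd_part A \<subseteq> odd_part B}"

definition superalg_iso :: "('k, 'a) superalg \<Rightarrow> ('k, 'b) superalg \<Rightarrow> ('a \<Rightarrow> 'b) set" where
  "superalg_iso A B = {h \<in> superalg_hom A B. bij_betw h (carrier A) (carrier B)}"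

definition superalg_isomorphic :: "('k, 'a) superalg \<Rightarrow> ('k, 'b) superalg \<Rightarrow> bool" where
  "superalg_isomorphic A B \<longleftrightarrow> superalg_iso A B \<noteq> {}"

text \<open>The powers of a two-sided ideal, in the library's monoid of ideals.\<close>

abbreviation ideal_power :: "('k, 'a) superalg \<Rightarrow> 'a set \<Rightarrow> nat \<Rightarrow> 'a set" where
  "ideal_power A I n \<equiv> I [^]\<^bsub>ideals_set A\<^esub> n"

definition graded_ideal :: "'a set \<Rightarrow> ('k, 'a) superalg \<Rightarrow> bool" where
  "graded_ideal I A \<longleftrightarrow> ideal I A \<and> I = (I \<inter> even_part A) <+>\<^bsub>A\<^esub> (I \<inter> odd_part A)"

text \<open>
  The quotient by a graded ideal: the library's factor ring, with scalar multiplication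
  defined on cosets in the same style as its multiplication.
\<close>

definition quotient_superalg :: "('k, 'a) superalg \<Rightarrow> 'a set \<Rightarrow> ('k, 'a set) superalg" where
  "quotient_superalg A I =
     \<lparr>carrier = carrier (A Quot I), mult = mult (A Quot I), one = \<one>\<^bsub>A Quot I\<^esub>,
      ring.zero = \<zero>\<^bsub>A Quot I\<^esub>, add = add (A Quot I),
      smult = (\<lambda>c S. \<Union>a\<in>S. I +>\<^bsub>A\<^esub> (c \<odot>\<^bsub>A\<^esub> a)),
      even_part = (\<lambda>a. I +>\<^bsub>A\<^esub> a) ` even_part A,
      odd_part = (\<lambda>a. I +>\<^bsub>A\<^esub> a) ` odd_part A\<rparr>"

definition finite_dimensional :: "('k, 'a) superalg \<Rightarrow> bool" where
  "finite_dimensional A \<longleftrightarrow>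
     (\<exists>B. finite B \<and> B \<subseteq> carrier A \<and>
        (\<forall>a\<in>carrier A. \<exists>c. a = (\<Oplus>\<^bsub>A\<^esub>b\<in>B. c b \<odot>\<^bsub>A\<^esub> b)))"

text \<open>
  Existence and uniqueness of the pair \<open>(c, n)\<close> say that \<open>A = \<KK> \<oplus> N\<close>; uniqueness includes
  the injectivity of \<open>c \<mapsto> c \<odot> \<one>\<close>.
\<close>

definition super_weil_algebra :: "('k::field, 'a) superalg \<Rightarrow> bool" where
  "super_weil_algebra A \<longleftrightarrow>
     superalgebra A \<and> finite_dimensional A \<and>
     (\<exists>N. graded_ideal N A \<and> (\<exists>r. ideal_power A N r = {\<zero>\<^bsub>A\<^esub>}) \<and>
        (\<forall>a\<in>carrier A. \<exists>!(c, n). n \<in> N \<and> a = (c \<odot>\<^bsub>A\<^esub> \<one>\<^bsub>A\<^esub>) \<oplus>\<^bsub>A\<^esub> n))"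

text \<open>The algebraic dual; functionals are extensional, so that they are equal iff they agree on \<open>A\<close>.\<close>

definition dual :: "('k::field, 'a) superalg \<Rightarrow> ('a \<Rightarrow> 'k) set" where
  "dual A =
     {w \<in> carrier A \<rightarrow>\<^sub>E UNIV.
        (\<forall>a\<in>carrier A. \<forall>b\<in>carrier A. w (a \<oplus>\<^bsub>A\<^esub> b) = w a + w b) \<and>
        (\<forall>c. \<forall>a\<in>carrier A. w (c \<odot>\<^bsub>A\<^esub> a) = c * w a)}"


section \<open>Grassmann algebras over a commutative algebra\<close>

text \<open>
  \<open>grassmann R q\<close> is \<open>R \<otimes> \<Lambda>(\<theta>\<^sub>0, \<dots>, \<theta>\<^sub>q\<^sub>-\<^sub>1)\<close>: a family \<open>f\<close> of coefficients in \<open>R\<close>, indexed by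
  the subsets of \<open>{..<q}\<close>, stands for the sum of all \<open>f I \<theta>\<^sub>I\<close>, where \<open>\<theta>\<^sub>I\<close> is the product of
  the \<open>\<theta>\<^sub>i\<close>, \<open>i \<in> I\<close>, in increasing order. For disjoint \<open>J\<close>, \<open>K\<close> the product
  \<open>\<theta>\<^sub>J \<theta>\<^sub>K\<close> is \<open>\<theta>\<^sub>J\<^sub>\<union>\<^sub>K\<close> up to the sign of the permutation that sorts the concatenation.
\<close>

definition inversions :: "nat set \<Rightarrow> nat set \<Rightarrow> nat" where
  "inversions J K = card {(j, k). j \<in> J \<and> k \<in> K \<and> k < j}"

definition grassmann :: "('k, 'a) module \<Rightarrow> nat \<Rightarrow> ('k, nat set \<Rightarrow> 'a) superalg" where
  "grassmann R q =
     \<lparr>carrier = Pow {..<q} \<rightarrow>\<^sub>E carrier R,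
      mult = (\<lambda>f g. \<lambda>I\<in>Pow {..<q}. \<Oplus>\<^bsub>R\<^esub>J\<in>Pow I.
                if even (inversions J (I - J)) then f J \<otimes>\<^bsub>R\<^esub> g (I - J)
                else \<ominus>\<^bsub>R\<^esub> (f J \<otimes>\<^bsub>R\<^esub> g (I - J))),
      one = (\<lambda>I\<in>Pow {..<q}. if I = {} then \<one>\<^bsub>R\<^esub> else \<zero>\<^bsub>R\<^esub>),
      ring.zero = (\<lambda>I\<in>Pow {..<q}. \<zero>\<^bsub>R\<^esub>),
      add = (\<lambda>f g. \<lambda>I\<in>Pow {..<q}. f I \<oplus>\<^bsub>R\<^esub> g I),
      smult = (\<lambda>c f. \<lambda>I\<in>Pow {..<q}. c \<odot>\<^bsub>R\<^esub> f I),
      even_part = {f \<in> Pow {..<q} \<rightarrow>\<^sub>E carrier R. \<forall>I\<in>Pow {..<q}. odd (card I) \<longrightarrow> f I = \<zero>\<^bsub>R\<^esub>},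
      odd_part = {f \<in> Pow {..<q} \<rightarrow>\<^sub>E carrier R. \<forall>I\<in>Pow {..<q}. even (card I) \<longrightarrow> f I = \<zero>\<^bsub>R\<^esub>}\<rparr>"

definition poly_algebra :: "nat \<Rightarrow> ('k::field, (nat \<Rightarrow>\<^sub>0 nat) \<Rightarrow>\<^sub>0 'k) module" where
  "poly_algebra p =
     \<lparr>carrier = {P. \<forall>m\<in>Poly_Mapping.keys P. Poly_Mapping.keys m \<subseteq> {..<p}},
      mult = (*), one = 1, ring.zero = 0, add = (+),
      smult = (\<lambda>c P. Poly_Mapping.single 0 c * P)\<rparr>"

text \<open>\<open>\<KK>[p|q]\<close> and its ideal of polynomials without constant term.\<close>

definition poly_superalg ::
    "nat \<Rightarrow> nat \<Rightarrow> ('k::field, nat set \<Rightarrow> (nat \<Rightarrow>\<^sub>0 nat) \<Rightarrow>\<^sub>0 'k) superalg" where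
  "poly_superalg p q = grassmann (poly_algebra p) q"

definition poly_no_const ::
    "nat \<Rightarrow> nat \<Rightarrow> (nat set \<Rightarrow> (nat \<Rightarrow>\<^sub>0 nat) \<Rightarrow>\<^sub>0 'k::field) set" where
  "poly_no_const p q = {P \<in> carrier (poly_superalg p q). Poly_Mapping.lookup (P {}) 0 = 0}"


section \<open>Smooth and holomorphic functions on \<open>\<KK>\<^sup>p\<close>\<close>

text \<open>
  Points of \<open>\<KK>\<^sup>p\<close> are extensional functions on \<open>{..<p}\<close>, so that \<open>p = 0\<close> is allowed; the
  product topology is the usual topology.
\<close>

definition coord_space :: "nat \<Rightarrow> (nat \<Rightarrow> 'k::topological_space) topology" where
  "coord_space p = product_topology (\<lambda>_. euclidean) {..<p}"

text \<open>\<open>C\<^sup>r\<close>-functions: all iterated partial derivatives up to order \<open>r\<close> exist and are continuous.\<close>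

primrec Cr_on :: "nat \<Rightarrow> nat \<Rightarrow> (nat \<Rightarrow> real) set \<Rightarrow> ((nat \<Rightarrow> real) \<Rightarrow> real) \<Rightarrow> bool" where
  "Cr_on p 0 U f \<longleftrightarrow> continuous_map (subtopology (coord_space p) U) euclidean f"
| "Cr_on p (Suc r) U f \<longleftrightarrow>
     continuous_map (subtopology (coord_space p) U) euclidean f \<and>
     (\<forall>i<p. (\<forall>x\<in>U. (\<lambda>t. f (x(i := t))) field_differentiable at (x i)) \<and>
        Cr_on p r U (\<lambda>x. deriv (\<lambda>t. f (x(i := t))) (x i)))"

definition smooth_functions :: "nat \<Rightarrow> (nat \<Rightarrow> real) set \<Rightarrow> ((nat \<Rightarrow> real) \<Rightarrow> real) set" where
  "smooth_functions p U = {f \<in> extensional U. \<forall>r. Cr_on p r U f}"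

text \<open>Holomorphic functions of several variables: continuous, and holomorphic in each variable.\<close>

definition holomorphic_functions ::
    "nat \<Rightarrow> (nat \<Rightarrow> complex) set \<Rightarrow> ((nat \<Rightarrow> complex) \<Rightarrow> complex) set" where
  "holomorphic_functions p U =
     {f \<in> extensional U. continuous_map (subtopology (coord_space p) U) euclidean f \<and>
        (\<forall>i<p. \<forall>x\<in>U. (\<lambda>t. f (x(i := t))) holomorphic_on {t. x(i := t) \<in> U})}"

definition function_algebra ::
    "'x set \<Rightarrow> ('x \<Rightarrow> 'k) set \<Rightarrow> ('k::field, 'x \<Rightarrow> 'k) module" where
  "function_algebra U F =
     \<lparr>carrier = F, mult = (\<lambda>f g. \<lambda>x\<in>U. f x * g x), one = (\<lambda>x\<in>U. 1), ring.zero = (\<lambda>x\<in>U. 0),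
      add = (\<lambda>f g. \<lambda>x\<in>U. f x + g x), smult = (\<lambda>c f. \<lambda>x\<in>U. c * f x)\<rparr>"


section \<open>Supermanifolds\<close>

text \<open>A topological space with a presheaf of superalgebras on its open sets.\<close>

record ('m, 'k, 's) superspace =
  body :: "'m topology"
  sections :: "'m set \<Rightarrow> ('k, 's) superalg"
  restr :: "'m set \<Rightarrow> 'm set \<Rightarrow> 's \<Rightarrow> 's"  \<comment> \<open>\<open>restr M U V\<close> restricts from \<open>U\<close> to \<open>V \<subseteq> U\<close>\<close>

definition presheaf_of_superalgebras :: "('m, 'k::field, 's) superspace \<Rightarrow> bool" where
  "presheaf_of_superalgebras M \<longleftrightarrow>
     (\<forall>U. openin (body M) U \<longrightarrow> superalgebra (sections M U)) \<and>
     (\<forall>U V. openin (body M) U \<and> openin (body M) V \<and> V \<subseteq> U \<longrightarrow>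
        restr M U V \<in> superalg_hom (sections M U) (sections M V)) \<and>
     (\<forall>U. openin (body M) U \<longrightarrow> (\<forall>f\<in>carrier (sections M U). restr M U U f = f)) \<and>
     (\<forall>U V W. openin (body M) U \<and> openin (body M) V \<and> openin (body M) W \<and> W \<subseteq> V \<and> V \<subseteq> U \<longrightarrow>
        (\<forall>f\<in>carrier (sections M U). restr M V W (restr M U V f) = restr M U W f))"

definition sheaf_of_superalgebras :: "('m, 'k::field, 's) superspace \<Rightarrow> bool" where
  "sheaf_of_superalgebras M \<longleftrightarrow>
     presheaf_of_superalgebras M \<and>
     (\<forall>\<U> s. (\<forall>U\<in>\<U>. openin (body M) U \<and> s U \<in> carrier (sections M U)) \<and>
        (\<forall>U\<in>\<U>. \<forall>V\<in>\<U>. restr M U (U \<inter> V) (s U) = restr M V (U \<inter> V) (s V)) \<longrightarrow>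
        (\<exists>!f. f \<in> carrier (sections M (\<Union>\<U>)) \<and> (\<forall>U\<in>\<U>. restr M (\<Union>\<U>) U f = s U)))"

text \<open>The germ at \<open>x\<close> of a section \<open>f\<close> over \<open>U\<close>, as an equivalence class of pairs.\<close>

definition germ :: "('m, 'k, 's) superspace \<Rightarrow> 'm \<Rightarrow> 'm set \<Rightarrow> 's \<Rightarrow> ('m set \<times> 's) set" where
  "germ M x U f =
     {(V, g). openin (body M) V \<and> x \<in> V \<and> g \<in> carrier (sections M V) \<and>
        (\<exists>W. openin (body M) W \<and> x \<in> W \<and> W \<subseteq> U \<inter> V \<and> restr M U W f = restr M V W g)}"

definition germ_op ::
    "(('k, 's) superalg \<Rightarrow> 's \<Rightarrow> 's \<Rightarrow> 's) \<Rightarrow> ('m, 'k, 's) superspace \<Rightarrow> 'm \<Rightarrow>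
      ('m set \<times> 's) set \<Rightarrow> ('m set \<times> 's) set \<Rightarrow> ('m set \<times> 's) set" where
  "germ_op opn M x S T =
     (\<Union>(U, f)\<in>S. \<Union>(V, g)\<in>T.
        germ M x (U \<inter> V) (opn (sections M (U \<inter> V)) (restr M U (U \<inter> V) f) (restr M V (U \<inter> V) g)))"

definition stalk :: "('m, 'k, 's) superspace \<Rightarrow> 'm \<Rightarrow> ('k, ('m set \<times> 's) set) superalg" where
  "stalk M x =
     \<lparr>carrier = {germ M x U f | U f. openin (body M) U \<and> x \<in> U \<and> f \<in> carrier (sections M U)},
      mult = germ_op mult M x,
      one = germ M x (topspace (body M)) \<one>\<^bsub>sections M (topspace (body M))\<^esub>,
      ring.zero = germ M x (topspace (body M)) \<zero>\<^bsub>sections M (topspace (body M))\<^esub>,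
      add = germ_op add M x,
      smult = (\<lambda>c S. \<Union>(U, f)\<in>S. germ M x U (c \<odot>\<^bsub>sections M U\<^esub> f)),
      even_part = {germ M x U f | U f. openin (body M) U \<and> x \<in> U \<and> f \<in> even_part (sections M U)},
      odd_part = {germ M x U f | U f. openin (body M) U \<and> x \<in> U \<and> f \<in> odd_part (sections M U)}\<rparr>"

text \<open>
  The maximal ideal of a local stalk. The value at \<open>x\<close> of a section \<open>f\<close> is the scalar \<open>c\<close> for
  which the germ of \<open>f - c\<close> lies in this ideal, so that it consists of the germs with value zero.
\<close>

definition stalk_ideal :: "('m, 'k, 's) superspace \<Rightarrow> 'm \<Rightarrow> ('m set \<times> 's) set set" where
  "stalk_ideal M x = (THE I. maximalideal I (stalk M x))"

text \<open>
  \<open>\<KK>\<^sup>p\<^sup>|\<^sup>q\<close>, where \<open>F p U\<close> is the set of structure functions on an open \<open>U \<subseteq> \<KK>\<^sup>p\<close>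
  (\<open>smooth_functions\<close> or \<open>holomorphic_functions\<close>).
\<close>

definition model_superspace ::
    "(nat \<Rightarrow> (nat \<Rightarrow> 'k) set \<Rightarrow> ((nat \<Rightarrow> 'k) \<Rightarrow> 'k) set) \<Rightarrow> nat \<Rightarrow> nat \<Rightarrow>
      (nat \<Rightarrow> 'k, 'k::real_normed_field, nat set \<Rightarrow> (nat \<Rightarrow> 'k) \<Rightarrow> 'k) superspace" where
  "model_superspace F p q =
     \<lparr>body = coord_space p,
      sections = (\<lambda>U. grassmann (function_algebra U (F p U)) q),
      restr = (\<lambda>U V f. \<lambda>I\<in>Pow {..<q}. restrict (f I) V)\<rparr>"

text \<open>
  An isomorphism from the open part of \<open>M\<close> over \<open>U\<close> to the open part of \<open>N\<close> over \<open>V\<close>: a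
  homeomorphism \<open>\<phi>\<close> with an isomorphism of sheaves, going in the opposite direction as a pullback.
\<close>

definition superspace_iso ::
    "('m, 'k, 's) superspace \<Rightarrow> 'm set \<Rightarrow> ('n, 'k, 't) superspace \<Rightarrow> 'n set \<Rightarrow>
      ('m \<Rightarrow> 'n) \<Rightarrow> ('m set \<Rightarrow> 't \<Rightarrow> 's) \<Rightarrow> bool" where
  "superspace_iso M U N V \<phi> \<Psi> \<longleftrightarrow>
     homeomorphic_map (subtopology (body M) U) (subtopology (body N) V) \<phi> \<and>
     (\<forall>W. openin (body M) W \<and> W \<subseteq> U \<longrightarrow>
        \<Psi> W \<in> superalg_iso (sections N (\<phi> ` W)) (sections M W)) \<and>
     (\<forall>W W'. openin (body M) W \<and> openin (body M) W' \<and> W' \<subseteq> W \<and> W \<subseteq> U \<longrightarrow>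
        (\<forall>f\<in>carrier (sections N (\<phi> ` W)).
           \<Psi> W' (restr N (\<phi> ` W) (\<phi> ` W') f) = restr M W W' (\<Psi> W f)))"

text \<open>
  Charts of \<open>M\<close> induce charts of the reduced space, so that the latter is a classical manifold as
  soon as the underlying topological space is Hausdorff and second countable.
\<close>

definition supermanifold ::
    "(nat \<Rightarrow> (nat \<Rightarrow> 'k) set \<Rightarrow> ((nat \<Rightarrow> 'k) \<Rightarrow> 'k) set) \<Rightarrow> nat \<Rightarrow> nat \<Rightarrow>
      ('m, 'k::real_normed_field, 's) superspace \<Rightarrow> bool" where
  "supermanifold F p q M \<longleftrightarrow>
     Hausdorff_space (body M) \<and> second_countable (body M) \<and>
     sheaf_of_superalgebras M \<and>
     (\<forall>x\<in>topspace (body M). \<exists>!I. maximalideal I (stalk M x)) \<and>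
     (\<forall>x\<in>topspace (body M). \<exists>U V \<phi> \<Psi>. openin (body M) U \<and> x \<in> U \<and> openin (coord_space p) V \<and>
        superspace_iso M U (model_superspace F p q) V \<phi> \<Psi>)"

abbreviation smooth_supermanifold :: "nat \<Rightarrow> nat \<Rightarrow> ('m, real, 's) superspace \<Rightarrow> bool" where
  "smooth_supermanifold \<equiv> supermanifold smooth_functions"

abbreviation holomorphic_supermanifold :: "nat \<Rightarrow> nat \<Rightarrow> ('m, complex, 's) superspace \<Rightarrow> bool" where
  "holomorphic_supermanifold \<equiv> supermanifold holomorphic_functions"


section \<open>Points near \<open>x\<close> and distributions supported at \<open>x\<close>\<close>

definition points_near ::
    "('k, 'a) superalg \<Rightarrow> ('m, 'k, 's) superspace \<Rightarrow> 'm \<Rightarrow> (('m set \<times> 's) set \<Rightarrow> 'a) set" where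
  "points_near A M x = superalg_hom (stalk M x) A"

definition distributions_order ::
    "nat \<Rightarrow> ('m, 'k::field, 's) superspace \<Rightarrow> 'm \<Rightarrow> (('m set \<times> 's) set \<Rightarrow> 'k) set" where
  "distributions_order k M x =
     {v \<in> dual (stalk M x). \<forall>f\<in>ideal_power (stalk M x) (stalk_ideal M x) (k + 1). v f = 0}"

definition distributions :: "('m, 'k::field, 's) superspace \<Rightarrow> 'm \<Rightarrow> (('m set \<times> 's) set \<Rightarrow> 'k) set" where
  "distributions M x = (\<Union>k. distributions_order k M x)"

text \<open>\<open>\<O>\<^sub>M\<^sub>,\<^sub>x / \<M>\<^sub>x\<^sup>k\<^sup>+\<^sup>1\<close> and \<open>\<KK>[p|q] / \<M>\<^sub>0\<^sup>k\<^sup>+\<^sup>1\<close>.\<close>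

definition jet_algebra ::
    "nat \<Rightarrow> ('m, 'k, 's) superspace \<Rightarrow> 'm \<Rightarrow> ('k, ('m set \<times> 's) set set) superalg" where
  "jet_algebra k M x =
     quotient_superalg (stalk M x) (ideal_power (stalk M x) (stalk_ideal M x) (k + 1))"

definition truncated_poly_superalg ::
    "nat \<Rightarrow> nat \<Rightarrow> nat \<Rightarrow> ('k::field, (nat set \<Rightarrow> (nat \<Rightarrow>\<^sub>0 nat) \<Rightarrow>\<^sub>0 'k) set) superalg" where
  "truncated_poly_superalg k p q =
     quotient_superalg (poly_superalg p q)
       (ideal_power (poly_superalg p q) (poly_no_const p q) (k + 1))"

end

theory Submission
  imports Defs
begin

text \<open>
  Part one is a statement about local rings. The nilpotent ideal \<open>N\<close> of \<open>A\<close> has codimension one, so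
  its inverse image under an \<open>A\<close>-point is a proper ideal of codimension one, hence maximal, hence
  equal to \<open>\<M>\<^sub>x\<close> by locality. The \<open>A\<close>-point therefore maps \<open>\<M>\<^sub>x\<^sup>r\<close> into \<open>N\<^sup>r\<close>, which is zero for some
  \<open>r\<close>, and so every functional composed with it kills a power of \<open>\<M>\<^sub>x\<close>
  (\<open>weil_point_kills_ideal_power\<close>).

  Part two rests on one homomorphism: a chart around \<open>x\<close> turns a polynomial in \<open>p\<close> even and \<open>q\<close> odd
  variables, with the origin moved to the image \<open>y\<close> of \<open>x\<close>, into a germ at \<open>x\<close> (\<open>poly_germ\<close>). It maps
  \<open>\<M>\<^sub>0\<close> into \<open>\<M>\<^sub>x\<close>. It induces isomorphisms \<open>\<KK>[p|q]/\<M>\<^sub>0\<^sup>n \<cong> \<O>/\<M>\<^sub>x\<^sup>n\<close> because it is surjective modulo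
  every power of \<open>\<M>\<^sub>x\<close> and because a polynomial whose germ lies in \<open>\<M>\<^sub>x\<^sup>n\<close> lies in \<open>\<M>\<^sub>0\<^sup>n\<close>.

  Surjectivity modulo all powers follows from surjectivity on the cotangent space,
  \<open>\<M>\<^sub>x \<subseteq> poly_germ \<M>\<^sub>0 + \<M>\<^sub>x\<^sup>2\<close> (\<open>surj_modulo_ideal_power\<close>). That inclusion is Hadamard's lemma: a
  function that vanishes at \<open>y\<close> is a combination of the \<open>z\<^sub>i - y\<^sub>i\<close> with coefficients of the same class.
  Changing one coordinate at a time, this reduces to dividing \<open>f z - f (z(i := y\<^sub>i))\<close> by \<open>z\<^sub>i - y\<^sub>i\<close>.
  The quotient is an integral of a partial derivative over a segment in the smooth case and a
  Cauchy integral over a circle in the holomorphic case; everything else treats both cases at once,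
  in the locale \<open>function_class\<close>.

  For the second property, a germ in \<open>\<M>\<^sub>x\<^sup>n\<close> vanishes to a high order along curves
  \<open>t \<mapsto> (y\<^sub>i + t ^ w\<^sub>i)\<close> (\<open>germ_order_ideal_power\<close>). For suitable weights \<open>w\<close> the monomials of a given
  polynomial restrict to pairwise different powers of \<open>t\<close>, and so each coefficient of low degree
  has to vanish (\<open>poly_germ_reflects_power\<close>).

  Finally, a functional that vanishes on \<open>\<M>\<^sub>x\<^sup>k\<^sup>+\<^sup>1\<close> factors through the projection of the stalk onto
  \<open>\<O>/\<M>\<^sub>x\<^sup>k\<^sup>+\<^sup>1\<close>, and this projection is the required point; the quotient is a super Weil algebra, being
  spanned by the finitely many monomials of degree at most \<open>k\<close>.
\<close>

section \<open>Superalgebras\<close>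

locale superalg = ring A for A :: "('k::field, 'a) superalg" (structure) +
  assumes superalgebra: "superalgebra A"

lemma superalgI: "superalgebra A \<Longrightarrow> superalg A"
  unfolding superalg_def superalg_axioms_def superalgebra_def by (intro conjI) blast+

context superalg
begin

lemma scalar_module: "module (ring_of_type_algebra :: 'k ring) A"
  using superalgebra unfolding superalgebra_def by blast

lemma smult_closed [simp]: "a \<in> carrier A \<Longrightarrow> c \<odot> a \<in> carrier A"
  using module.smult_closed[OF scalar_module, of c a] by (simp add: ring_of_type_algebra_def)

lemma smult_add_left: "a \<in> carrier A \<Longrightarrow> (c + d) \<odot> a = c \<odot> a \<oplus> d \<odot> a"
  using module.smult_l_distr[OF scalar_module, of c d a] by (simp add: ring_of_type_algebra_def)

lemma smult_add_right:
  "a \<in> carrier A \<Longrightarrow> b \<in> carrier A \<Longrightarrow> c \<odot> (a \<oplus> b) = c \<odot> a \<oplus> c \<odot> b"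
  using module.smult_r_distr[OF scalar_module, of c a b] by (simp add: ring_of_type_algebra_def)

lemma smult_smult: "a \<in> carrier A \<Longrightarrow> (c * d) \<odot> a = c \<odot> (d \<odot> a)"
  using module.smult_assoc1[OF scalar_module, of c d a] by (simp add: ring_of_type_algebra_def)

lemma smult_one [simp]: "a \<in> carrier A \<Longrightarrow> 1 \<odot> a = a"
  using module.smult_one[OF scalar_module, of a] by (simp add: ring_of_type_algebra_def)

lemma smult_zero_left [simp]: "a \<in> carrier A \<Longrightarrow> 0 \<odot> a = \<zero>"
  using module.smult_l_null[OF scalar_module, of a] by (simp add: ring_of_type_algebra_def)

lemma smult_zero_right [simp]: "c \<odot> \<zero> = \<zero>"
  using module.smult_r_null[OF scalar_module, of c] by (simp add: ring_of_type_algebra_def)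

lemma smult_minus_left: "a \<in> carrier A \<Longrightarrow> (- c) \<odot> a = \<ominus> (c \<odot> a)"
  using smult_add_left[of a "- c" c] by (simp add: minus_equality)

lemma smult_mult_left:
  "a \<in> carrier A \<Longrightarrow> b \<in> carrier A \<Longrightarrow> (c \<odot> a) \<otimes> b = c \<odot> (a \<otimes> b)"
  using superalgebra unfolding superalgebra_def by blast

lemma smult_mult_right:
  "a \<in> carrier A \<Longrightarrow> b \<in> carrier A \<Longrightarrow> a \<otimes> (c \<odot> b) = c \<odot> (a \<otimes> b)"
  using superalgebra unfolding superalgebra_def by blast

lemma even_submodule: "submodule (even_part A) (ring_of_type_algebra :: 'k ring) A"
  and odd_submodule: "submodule (odd_part A) (ring_of_type_algebra :: 'k ring) A"
  using superalgebra unfolding superalgebra_def by blast+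

lemma even_carrier: "a \<in> even_part A \<Longrightarrow> a \<in> carrier A"
  and odd_carrier: "a \<in> odd_part A \<Longrightarrow> a \<in> carrier A"
  using module.submoduleE(1)[OF scalar_module even_submodule]
    module.submoduleE(1)[OF scalar_module odd_submodule] by auto

lemma even_add: "a \<in> even_part A \<Longrightarrow> b \<in> even_part A \<Longrightarrow> a \<oplus> b \<in> even_part A"
  and odd_add: "a \<in> odd_part A \<Longrightarrow> b \<in> odd_part A \<Longrightarrow> a \<oplus> b \<in> odd_part A"
  and even_minus: "a \<in> even_part A \<Longrightarrow> \<ominus> a \<in> even_part A"
  and odd_minus: "a \<in> odd_part A \<Longrightarrow> \<ominus> a \<in> odd_part A"
  using module.submoduleE(3,5)[OF scalar_module even_submodule]
    module.submoduleE(3,5)[OF scalar_module odd_submodule] by auto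

lemma even_smult: "a \<in> even_part A \<Longrightarrow> c \<odot> a \<in> even_part A"
  and odd_smult: "a \<in> odd_part A \<Longrightarrow> c \<odot> a \<in> odd_part A"
  using module.submoduleE(4)[OF scalar_module even_submodule, of c a]
    module.submoduleE(4)[OF scalar_module odd_submodule, of c a]
  by (simp_all add: ring_of_type_algebra_def)

lemma even_odd_Int: "a \<in> even_part A \<Longrightarrow> a \<in> odd_part A \<Longrightarrow> a = \<zero>"
  using superalgebra unfolding superalgebra_def by blast

lemma zero_even [simp]: "\<zero> \<in> even_part A" and zero_odd [simp]: "\<zero> \<in> odd_part A"
  using superalgebra unfolding superalgebra_def by blast+

lemma one_even: "\<one> \<in> even_part A"
  using superalgebra unfolding superalgebra_def by blast

lemma carrier_eq_even_odd: "carrier A = even_part A <+> odd_part A"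
  using superalgebra unfolding superalgebra_def by blast

lemma even_odd_decomp:
  assumes "a \<in> carrier A"
  obtains a0 a1 where "a0 \<in> even_part A" "a1 \<in> odd_part A" "a = a0 \<oplus> a1"
  using assms unfolding carrier_eq_even_odd set_add_def' by blast

lemma even_even_mult: "a \<in> even_part A \<Longrightarrow> b \<in> even_part A \<Longrightarrow> a \<otimes> b \<in> even_part A"
  and even_odd_mult: "a \<in> even_part A \<Longrightarrow> b \<in> odd_part A \<Longrightarrow> a \<otimes> b \<in> odd_part A"
  and odd_odd_mult: "a \<in> odd_part A \<Longrightarrow> b \<in> odd_part A \<Longrightarrow> a \<otimes> b \<in> even_part A"
  and even_commute: "a \<in> even_part A \<Longrightarrow> b \<in> carrier A \<Longrightarrow> a \<otimes> b = b \<otimes> a"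
  and odd_anticommute: "a \<in> odd_part A \<Longrightarrow> b \<in> odd_part A \<Longrightarrow> a \<otimes> b = \<ominus> (b \<otimes> a)"
  using superalgebra unfolding superalgebra_def by blast+

lemma odd_even_mult: "a \<in> odd_part A \<Longrightarrow> b \<in> even_part A \<Longrightarrow> a \<otimes> b \<in> odd_part A"
  using even_commute[of b a] even_odd_mult[of b a] by (simp add: odd_carrier)

end

section \<open>Powers of ideals\<close>

lemma ideals_set_one [simp]: "\<one>\<^bsub>ideals_set A\<^esub> = carrier A"
  and ideals_set_mult [simp]: "I \<otimes>\<^bsub>ideals_set A\<^esub> J = I \<cdot>\<^bsub>A\<^esub> J"
  by (simp_all add: ideals_set_def)

lemma ideal_power_Suc: "ideal_power A I (Suc n) = ideal_power A I n \<cdot>\<^bsub>A\<^esub> I"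
  by simp

lemma (in ideal) mem_diff_iff:
  assumes "a \<in> carrier R" "b \<in> carrier R"
  shows "I +> a = I +> b \<longleftrightarrow> a \<ominus> b \<in> I"
proof -
  have "I +> a = I +> b \<longleftrightarrow> a \<in> I +> b"
    using assms a_repr_independence'[of a b] a_rcos_self[of a] by auto
  then show ?thesis
    using assms a_rcos_module_minus[OF ring_axioms, of b a] by simp
qed

context superalg
begin

lemma ideal_ideal_power: "ideal I A \<Longrightarrow> ideal (ideal_power A I n) A"
  by (induction n) (simp_all add: ideal_power_Suc ideal_prod_is_ideal oneideal)

lemma ideal_power_1: assumes "ideal I A" shows "ideal_power A I (Suc 0) = I"
proof
  interpret I: ideal I A by fact
  show "ideal_power A I (Suc 0) \<subseteq> I"
    using ideal_prod_inter[OF oneideal assms] by (auto simp: ideal_power_Suc)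
  show "I \<subseteq> ideal_power A I (Suc 0)"
    using ideal_prod.prod[of \<one> "carrier A" _ I A] I.a_subset by (force simp: ideal_power_Suc)
qed

lemma ideal_power_mult:
  assumes "ideal I A" "a \<in> ideal_power A I m" "b \<in> ideal_power A I n"
  shows "a \<otimes> b \<in> ideal_power A I (m + n)"
  using assms(3)
proof (induction n arbitrary: b)
  case 0
  then show ?case using ideal.I_r_closed[OF ideal_ideal_power[OF assms(1)] assms(2)] by simp
next
  case (Suc n)
  have a: "a \<in> carrier A" using ideal.Icarr[OF ideal_ideal_power[OF assms(1)] assms(2)] .
  have carr: "u \<in> carrier A" if "u \<in> ideal_power A I n" for u
    using ideal.Icarr[OF ideal_ideal_power[OF assms(1)] that] .
  have carr': "u \<in> carrier A" if "u \<in> ideal_power A I n \<cdot> I" for u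
    using ideal_prod_in_carrier[OF ideal_ideal_power[OF assms(1)] assms(1)] that by blast
  from Suc.prems have "b \<in> ideal_power A I n \<cdot> I" by (simp add: ideal_power_Suc)
  then have "a \<otimes> b \<in> ideal_power A I (m + n) \<cdot> I"
  proof induction
    case (prod i j)
    then have "(a \<otimes> i) \<otimes> j \<in> ideal_power A I (m + n) \<cdot> I"
      using Suc.IH by (intro ideal_prod.prod)
    then show ?case using a carr ideal.Icarr[OF assms(1)] prod by (simp add: m_assoc)
  next
    case (sum s1 s2)
    then show ?case using a carr' by (simp add: r_distr ideal_prod.sum)
  qed
  then show ?case by (simp add: ideal_power_Suc)
qed

lemma ideal_power_antimono:
  assumes "ideal I A" "m \<le> n"
  shows "ideal_power A I n \<subseteq> ideal_power A I m"
  using assms(2)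
proof (induction rule: dec_induct)
  case (step n)
  then show ?case
    using ideal_prod_inter[OF ideal_ideal_power[OF assms(1), of n] assms(1)] by simp blast
qed simp

text \<open>
  A product of homogeneous elements is homogeneous, so splitting both factors splits each
  generator of the next power into an even and an odd element of that power.
\<close>

lemma graded_ideal_power:
  assumes "graded_ideal I A"
  shows "graded_ideal (ideal_power A I n) A"
proof -
  have I: "ideal I A" and dec: "I = (I \<inter> even_part A) <+> (I \<inter> odd_part A)"
    using assms by (auto simp: graded_ideal_def)
  have "ideal_power A I n \<subseteq> (ideal_power A I n \<inter> even_part A) <+> (ideal_power A I n \<inter> odd_part A)"
  proof (induction n)
    case 0
    have "carrier A \<inter> even_part A = even_part A" "carrier A \<inter> odd_part A = odd_part A"
      using even_carrier odd_carrier by auto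
    then show ?case using carrier_eq_even_odd by simp
  next
    case (Suc n)
    let ?P = "ideal_power A I n"
    interpret P: ideal ?P A by (rule ideal_ideal_power[OF I])
    interpret PI: ideal "?P \<cdot> I" A by (rule ideal_prod_is_ideal[OF ideal_ideal_power[OF I] I])
    show ?case
    proof
      fix b assume "b \<in> ideal_power A I (Suc n)"
      then have "b \<in> ?P \<cdot> I" by (simp add: ideal_power_Suc)
      then have "\<exists>b0\<in>(?P \<cdot> I) \<inter> even_part A. \<exists>b1\<in>(?P \<cdot> I) \<inter> odd_part A. b = b0 \<oplus> b1"
      proof induction
        case (prod i j)
        obtain i0 i1 where i: "i0 \<in> ?P" "i0 \<in> even_part A" "i1 \<in> ?P" "i1 \<in> odd_part A" "i = i0 \<oplus> i1"
          using Suc.IH prod(1) unfolding set_add_def' by blast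
        obtain j0 j1 where j: "j0 \<in> I" "j0 \<in> even_part A" "j1 \<in> I" "j1 \<in> odd_part A" "j = j0 \<oplus> j1"
          using dec prod(2) unfolding set_add_def' by blast
        have c: "i0 \<in> carrier A" "i1 \<in> carrier A" "j0 \<in> carrier A" "j1 \<in> carrier A"
          using i j even_carrier odd_carrier by auto
        have "i \<otimes> j = (i0 \<otimes> j0 \<oplus> i1 \<otimes> j1) \<oplus> (i0 \<otimes> j1 \<oplus> i1 \<otimes> j0)"
          unfolding i j using c by algebra
        moreover have "i0 \<otimes> j0 \<oplus> i1 \<otimes> j1 \<in> (?P \<cdot> I) \<inter> even_part A"
          using ideal_prod.sum[OF ideal_prod.prod[OF i(1) j(1)] ideal_prod.prod[OF i(3) j(3)]]
            even_add[OF even_even_mult[OF i(2) j(2)] odd_odd_mult[OF i(4) j(4)]] by blast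
        moreover have "i0 \<otimes> j1 \<oplus> i1 \<otimes> j0 \<in> (?P \<cdot> I) \<inter> odd_part A"
          using ideal_prod.sum[OF ideal_prod.prod[OF i(1) j(3)] ideal_prod.prod[OF i(3) j(1)]]
            odd_add[OF even_odd_mult[OF i(2) j(4)] odd_even_mult[OF i(4) j(2)]] by blast
        ultimately show ?case by blast
      next
        case (sum s1 s2)
        then obtain a0 a1 b0 b1 where ab: "a0 \<in> (?P \<cdot> I) \<inter> even_part A" "a1 \<in> (?P \<cdot> I) \<inter> odd_part A"
          "b0 \<in> (?P \<cdot> I) \<inter> even_part A" "b1 \<in> (?P \<cdot> I) \<inter> odd_part A" "s1 = a0 \<oplus> a1" "s2 = b0 \<oplus> b1"
          by blast
        have c: "a0 \<in> carrier A" "a1 \<in> carrier A" "b0 \<in> carrier A" "b1 \<in> carrier A"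
          using ab even_carrier odd_carrier by auto
        have "s1 \<oplus> s2 = (a0 \<oplus> b0) \<oplus> (a1 \<oplus> b1)" unfolding ab using c by algebra
        then show ?case using ab even_add odd_add PI.a_closed by blast
      qed
      then show "b \<in> (ideal_power A I (Suc n) \<inter> even_part A) <+> (ideal_power A I (Suc n) \<inter> odd_part A)"
        unfolding set_add_def' ideal_power_Suc by blast
    qed
  qed
  moreover have "(ideal_power A I n \<inter> even_part A) <+> (ideal_power A I n \<inter> odd_part A) \<subseteq> ideal_power A I n"
    using additive_subgroup.a_closed[OF ideal.axioms(1)[OF ideal_ideal_power[OF I]]]
    unfolding set_add_def' by blast
  ultimately show ?thesis using ideal_ideal_power[OF I] unfolding graded_ideal_def by blast
qed

end

section \<open>Homomorphisms of superalgebras\<close>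

lemma superalg_homD:
  assumes "h \<in> superalg_hom A B"
  shows "a \<in> carrier A \<Longrightarrow> h a \<in> carrier B"
    and "a \<in> carrier A \<Longrightarrow> b \<in> carrier A \<Longrightarrow> h (a \<otimes>\<^bsub>A\<^esub> b) = h a \<otimes>\<^bsub>B\<^esub> h b"
    and "a \<in> carrier A \<Longrightarrow> b \<in> carrier A \<Longrightarrow> h (a \<oplus>\<^bsub>A\<^esub> b) = h a \<oplus>\<^bsub>B\<^esub> h b"
    and "h \<one>\<^bsub>A\<^esub> = \<one>\<^bsub>B\<^esub>"
    and "a \<in> carrier A \<Longrightarrow> h (c \<odot>\<^bsub>A\<^esub> a) = c \<odot>\<^bsub>B\<^esub> h a"
    and "a \<in> even_part A \<Longrightarrow> h a \<in> even_part B"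
    and "a \<in> odd_part A \<Longrightarrow> h a \<in> odd_part B"
  using assms unfolding superalg_hom_def ring_hom_def by blast+

lemma superalg_hom_zero:
  assumes "h \<in> superalg_hom A B" "superalgebra A" "superalgebra B"
  shows "h \<zero>\<^bsub>A\<^esub> = \<zero>\<^bsub>B\<^esub>"
  using ring_hom_zero[of h A B] assms unfolding superalg_hom_def superalgebra_def by blast

lemma superalg_hom_minus:
  assumes "h \<in> superalg_hom A B" "superalgebra A" "superalgebra B" "a \<in> carrier A"
  shows "h (\<ominus>\<^bsub>A\<^esub> a) = \<ominus>\<^bsub>B\<^esub> h a"
proof -
  interpret A: superalg A by (rule superalgI) fact
  interpret B: superalg B by (rule superalgI) fact
  show ?thesis
    using A.smult_minus_left[of a 1] B.smult_minus_left[of "h a" 1] superalg_homD[OF assms(1)] assms(4)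
    by (metis A.smult_one B.smult_one)
qed

lemma superalg_hom_diff:
  assumes "h \<in> superalg_hom A B" "superalgebra A" "superalgebra B" "a \<in> carrier A" "b \<in> carrier A"
  shows "h (a \<ominus>\<^bsub>A\<^esub> b) = h a \<ominus>\<^bsub>B\<^esub> h b"
proof -
  interpret A: superalg A by (rule superalgI) fact
  show ?thesis
    unfolding a_minus_def using superalg_homD(3)[OF assms(1,4), of "\<ominus>\<^bsub>A\<^esub> b"] assms(4,5)
    by (simp add: superalg_hom_minus[OF assms(1-3,5)])
qed

lemma superalg_hom_ideal_power:
  assumes "h \<in> superalg_hom A B" "superalgebra A" "ideal I A" "h ` I \<subseteq> J"
    and "a \<in> ideal_power A I n"
  shows "h a \<in> ideal_power B J n"
  using assms(5)
proof (induction n arbitrary: a)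
  case 0
  then show ?case using superalg_homD(1)[OF assms(1)] by simp
next
  case (Suc n)
  interpret A: superalg A by (rule superalgI) fact
  have carr: "u \<in> carrier A" if "u \<in> ideal_power A I n" for u
    using ideal.Icarr[OF A.ideal_ideal_power[OF assms(3)] that] .
  have carr': "u \<in> carrier A" if "u \<in> ideal_power A I n \<cdot>\<^bsub>A\<^esub> I" for u
    using A.ideal_prod_in_carrier[OF A.ideal_ideal_power[OF assms(3)] assms(3)] that by blast
  from Suc.prems have "a \<in> ideal_power A I n \<cdot>\<^bsub>A\<^esub> I" by (simp add: ideal_power_Suc)
  then have "h a \<in> ideal_power B J n \<cdot>\<^bsub>B\<^esub> J"
  proof induction
    case (prod i j)
    have "h i \<otimes>\<^bsub>B\<^esub> h j \<in> ideal_power B J n \<cdot>\<^bsub>B\<^esub> J"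
      using prod assms(4) by (intro ideal_prod.prod Suc.IH) auto
    then show ?case using superalg_homD(2)[OF assms(1), of i j] carr[OF prod(1)] ideal.Icarr[OF assms(3) prod(2)]
      by simp
  next
    case (sum s1 s2)
    then show ?case using superalg_homD(3)[OF assms(1), of s1 s2] carr'[of s1] carr'[of s2]
        ideal_prod.sum[of "h s1" B _ _ "h s2"] by simp
  qed
  then show ?case by (simp add: ideal_power_Suc)
qed

section \<open>Superalgebras as local images\<close>

text \<open>
  Negatives are scalar multiples by \<open>-1\<close>, so that the two parts have to be closed
  only under addition and scalars.
\<close>

lemma superalgebraI:
  fixes A :: "('k::field, 'a) superalg" (structure)
  assumes "ring A" "module (ring_of_type_algebra :: 'k ring) A"
    and "\<And>c a b. a \<in> carrier A \<Longrightarrow> b \<in> carrier A \<Longrightarrow> (c \<odot> a) \<otimes> b = c \<odot> (a \<otimes> b)"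
    and "\<And>c a b. a \<in> carrier A \<Longrightarrow> b \<in> carrier A \<Longrightarrow> a \<otimes> (c \<odot> b) = c \<odot> (a \<otimes> b)"
    and "even_part A \<subseteq> carrier A" "odd_part A \<subseteq> carrier A"
    and "\<zero> \<in> even_part A" "\<zero> \<in> odd_part A"
    and "\<And>a b. a \<in> even_part A \<Longrightarrow> b \<in> even_part A \<Longrightarrow> a \<oplus> b \<in> even_part A"
    and "\<And>a b. a \<in> odd_part A \<Longrightarrow> b \<in> odd_part A \<Longrightarrow> a \<oplus> b \<in> odd_part A"
    and "\<And>c a. a \<in> even_part A \<Longrightarrow> c \<odot> a \<in> even_part A"
    and "\<And>c a. a \<in> odd_part A \<Longrightarrow> c \<odot> a \<in> odd_part A"
    and "\<And>a. a \<in> carrier A \<Longrightarrow> \<exists>a0\<in>even_part A. \<exists>a1\<in>odd_part A. a = a0 \<oplus> a1"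
    and "\<And>a. a \<in> even_part A \<Longrightarrow> a \<in> odd_part A \<Longrightarrow> a = \<zero>"
    and "\<one> \<in> even_part A"
    and "\<And>a b. a \<in> even_part A \<Longrightarrow> b \<in> even_part A \<Longrightarrow> a \<otimes> b \<in> even_part A"
    and "\<And>a b. a \<in> even_part A \<Longrightarrow> b \<in> odd_part A \<Longrightarrow> a \<otimes> b \<in> odd_part A"
    and "\<And>a b. a \<in> odd_part A \<Longrightarrow> b \<in> odd_part A \<Longrightarrow> a \<otimes> b \<in> even_part A"
    and "\<And>a b. a \<in> even_part A \<Longrightarrow> b \<in> carrier A \<Longrightarrow> a \<otimes> b = b \<otimes> a"
    and "\<And>a b. a \<in> odd_part A \<Longrightarrow> b \<in> odd_part A \<Longrightarrow> a \<otimes> b = \<ominus> (b \<otimes> a)"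
  shows "superalgebra A"
proof -
  interpret ring A by fact
  interpret M: module "ring_of_type_algebra :: 'k ring" A by fact
  have m1: "\<ominus> a = (- 1) \<odot> a" if "a \<in> carrier A" for a
  proof -
    have "(- 1) \<odot> a \<oplus> a = (- 1) \<odot> a \<oplus> 1 \<odot> a"
      using M.smult_one[OF that] by (simp add: ring_of_type_algebra_def)
    also have "\<dots> = (- 1 + 1) \<odot> a"
      using M.smult_l_distr[of "- 1" 1 a] that by (simp add: ring_of_type_algebra_def)
    also have "\<dots> = \<zero>" using M.smult_l_null[OF that] by (simp add: ring_of_type_algebra_def)
    finally show ?thesis
      using that M.smult_closed[of "- 1" a] by (intro minus_equality) (auto simp: ring_of_type_algebra_def)
  qed
  have even: "submodule (even_part A) (ring_of_type_algebra :: 'k ring) A"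
    using assms(5,7,9,11) m1 by (intro M.submoduleI) auto
  have odd: "submodule (odd_part A) (ring_of_type_algebra :: 'k ring) A"
    using assms(6,8,10,12) m1 by (intro M.submoduleI) auto
  have sum: "carrier A = even_part A <+> odd_part A"
    unfolding set_add_def' using assms(5,6,13) by (auto intro!: add.m_closed)
  have int: "even_part A \<inter> odd_part A = {\<zero>}" using assms(7,8,14) by blast
  show ?thesis
    unfolding superalgebra_def
    by (intro conjI ballI allI; (rule even odd sum int | (rule assms; assumption)))
qed

text \<open>
  The carrier and the two homogeneous parts under one index, so that a statement
  about elements of any of them need not be repeated.
\<close>

definition part :: "bool option \<Rightarrow> ('k, 'a) superalg \<Rightarrow> 'a set" where
  "part u A = (case u of None \<Rightarrow> carrier A | Some e \<Rightarrow> if e then even_part A else odd_part A)"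

lemma part_simps [simp]:
  "part None A = carrier A" "part (Some True) A = even_part A" "part (Some False) A = odd_part A"
  by (simp_all add: part_def)

lemma superalg_hom_part: "h \<in> superalg_hom A B \<Longrightarrow> a \<in> part u A \<Longrightarrow> h a \<in> part u B"
  using superalg_homD(1,6,7)[of h A B a] by (auto simp: part_def split: option.splits if_splits)

text \<open>
  Each axiom of a superalgebra is an identity or a closure property that involves at most three
  elements. It therefore holds in \<open>Q\<close> as soon as any three elements of \<open>Q\<close>, of given parities,
  come from elements of the same parities in one superalgebra that maps homomorphically to \<open>Q\<close>.
  The directness of the sum of the parts is not inherited, and is therefore a hypothesis. For a quotient
  the superalgebra is always the original one; for a stalk it is the algebra of sections
  over a common neighbourhood.
\<close>

lemma superalgebra_local_image:
  fixes Q :: "('k::field, 'q) superalg" (structure)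
  assumes cover: "\<And>u v w x y z. x \<in> part u Q \<Longrightarrow> y \<in> part v Q \<Longrightarrow> z \<in> part w Q \<Longrightarrow>
      \<exists>(A :: ('k, 'a) superalg) h. superalgebra A \<and> h \<in> superalg_hom A Q \<and> h \<zero>\<^bsub>A\<^esub> = \<zero> \<and>
        (\<exists>a\<in>part u A. \<exists>b\<in>part v A. \<exists>c\<in>part w A. x = h a \<and> y = h b \<and> z = h c)"
    and nonempty: "carrier Q \<noteq> {}"
    and sub: "even_part Q \<subseteq> carrier Q" "odd_part Q \<subseteq> carrier Q"
    and int: "even_part Q \<inter> odd_part Q \<subseteq> {\<zero>}"
  shows "superalgebra Q"
proof -
  have cov: thesis if "x \<in> part u Q" "y \<in> part v Q" "z \<in> part w Q"
    and *: "\<And>(A :: ('k, 'a) superalg) h a b c. superalg A \<Longrightarrow> h \<in> superalg_hom A Q \<Longrightarrow> h \<zero>\<^bsub>A\<^esub> = \<zero> \<Longrightarrow>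
       a \<in> part u A \<Longrightarrow> b \<in> part v A \<Longrightarrow> c \<in> part w A \<Longrightarrow> x = h a \<Longrightarrow> y = h b \<Longrightarrow> z = h c \<Longrightarrow> thesis"
    for u v w x y z thesis
    using cover[OF that(1-3)] * superalgI by metis
  note cc = cov[of _ None _ None _ None, unfolded part_simps]
  obtain x0 where x0: "x0 \<in> carrier Q" using nonempty by blast
  have zero: "\<zero> \<in> carrier Q" "\<zero> \<in> even_part Q" "\<zero> \<in> odd_part Q"
    and one: "\<one> \<in> carrier Q" "\<one> \<in> even_part Q"
  proof -
    obtain A :: "('k, 'a) superalg" and h a where A: "superalg A" and h: "h \<in> superalg_hom A Q" "h \<zero>\<^bsub>A\<^esub> = \<zero>"
      by (rule cc[OF x0 x0 x0])
    interpret A: superalg A by fact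
    show "\<zero> \<in> carrier Q" "\<zero> \<in> even_part Q" "\<zero> \<in> odd_part Q"
      using superalg_homD(1,6,7)[OF h(1), of "\<zero>\<^bsub>A\<^esub>"] h(2) by auto
    show "\<one> \<in> carrier Q" "\<one> \<in> even_part Q"
      using superalg_homD(1,6)[OF h(1), of "\<one>\<^bsub>A\<^esub>"] superalg_homD(4)[OF h(1)] A.one_even by auto
  qed
  have add: "x \<oplus> y \<in> part u Q" if "x \<in> part u Q" "y \<in> part u Q" for x y u
  proof (rule cov[OF that that(1)])
    fix A :: "('k, 'a) superalg" and h a b
    assume A: "superalg A" and h: "h \<in> superalg_hom A Q" and ab: "a \<in> part u A" "b \<in> part u A" "x = h a" "y = h b"
    interpret A: superalg A by fact
    have "a \<in> carrier A" "b \<in> carrier A" "a \<oplus>\<^bsub>A\<^esub> b \<in> part u A"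
      using ab A.even_carrier A.odd_carrier A.even_add A.odd_add by (auto simp: part_def split: option.splits if_splits)
    then show ?thesis using ab superalg_hom_part[OF h, of "a \<oplus>\<^bsub>A\<^esub> b" u] superalg_homD(3)[OF h, of a b] by simp
  qed
  have smult: "c \<odot> x \<in> part u Q" if "x \<in> part u Q" for x u c
  proof (rule cov[OF that that that])
    fix A :: "('k, 'a) superalg" and h a
    assume A: "superalg A" and h: "h \<in> superalg_hom A Q" and ab: "a \<in> part u A" "x = h a"
    interpret A: superalg A by fact
    have "a \<in> carrier A" "c \<odot>\<^bsub>A\<^esub> a \<in> part u A"
      using ab A.even_carrier A.odd_carrier A.even_smult A.odd_smult by (auto simp: part_def split: option.splits if_splits)
    then show ?thesis using ab superalg_hom_part[OF h, of "c \<odot>\<^bsub>A\<^esub> a" u] superalg_homD(5)[OF h, of a c] by simp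
  qed
  have ag: "abelian_group Q"
  proof (rule abelian_groupI)
    show "x \<oplus> y \<in> carrier Q" if "x \<in> carrier Q" "y \<in> carrier Q" for x y using add[of x None y] that by simp
    show "(x \<oplus> y) \<oplus> z = x \<oplus> (y \<oplus> z)" if xyz: "x \<in> carrier Q" "y \<in> carrier Q" "z \<in> carrier Q" for x y z
    proof (rule cc[OF xyz])
      fix A :: "('k, 'a) superalg" and h a b c
      assume A: "superalg A" and h: "h \<in> superalg_hom A Q" "a \<in> carrier A" "b \<in> carrier A" "c \<in> carrier A"
        "x = h a" "y = h b" "z = h c"
      interpret A: superalg A by fact
      show ?thesis using h superalg_homD(3)[OF h(1), symmetric] by (simp add: A.a_assoc)
    qed
    show "x \<oplus> y = y \<oplus> x" if xyz: "x \<in> carrier Q" "y \<in> carrier Q" for x y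
    proof (rule cc[OF xyz xyz(1)])
      fix A :: "('k, 'a) superalg" and h a b c
      assume A: "superalg A" and h: "h \<in> superalg_hom A Q" "a \<in> carrier A" "b \<in> carrier A" "x = h a" "y = h b"
      interpret A: superalg A by fact
      show ?thesis using h superalg_homD(3)[OF h(1), symmetric] by (simp add: A.a_comm)
    qed
    show "\<zero> \<oplus> x = x" if xyz: "x \<in> carrier Q" for x
    proof (rule cc[OF xyz xyz xyz])
      fix A :: "('k, 'a) superalg" and h a b c
      assume A: "superalg A" and h: "h \<in> superalg_hom A Q" "h \<zero>\<^bsub>A\<^esub> = \<zero>" "a \<in> carrier A" "x = h a"
      interpret A: superalg A by fact
      show ?thesis using h superalg_homD(3)[OF h(1), of "\<zero>\<^bsub>A\<^esub>" a] by simp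
    qed
    show "\<exists>y\<in>carrier Q. y \<oplus> x = \<zero>" if xyz: "x \<in> carrier Q" for x
    proof (rule cc[OF xyz xyz xyz])
      fix A :: "('k, 'a) superalg" and h a b c
      assume A: "superalg A" and h: "h \<in> superalg_hom A Q" "h \<zero>\<^bsub>A\<^esub> = \<zero>" "a \<in> carrier A" "x = h a"
      interpret A: superalg A by fact
      show ?thesis using h superalg_homD(3)[OF h(1), of "\<ominus>\<^bsub>A\<^esub> a" a] superalg_homD(1)[OF h(1), of "\<ominus>\<^bsub>A\<^esub> a"]
        by (intro bexI[of _ "h (\<ominus>\<^bsub>A\<^esub> a)"]) (simp_all add: A.l_neg)
    qed
  qed (use zero in auto)
  interpret Q: abelian_group Q by fact
  have r: "ring Q"
  proof (rule ringI)
    show "abelian_group Q" by fact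
    show "Group.monoid Q"
    proof (rule monoidI)
      show "x \<otimes> y \<in> carrier Q" if xyz: "x \<in> carrier Q" "y \<in> carrier Q" for x y
      proof (rule cc[OF xyz xyz(1)])
        fix A :: "('k, 'a) superalg" and h a b c
        assume A: "superalg A" and h: "h \<in> superalg_hom A Q" "a \<in> carrier A" "b \<in> carrier A" "x = h a" "y = h b"
        interpret A: superalg A by fact
        show ?thesis using h superalg_homD(2)[OF h(1), symmetric] superalg_homD(1)[OF h(1), of "a \<otimes>\<^bsub>A\<^esub> b"] by simp
      qed
      show "(x \<otimes> y) \<otimes> z = x \<otimes> (y \<otimes> z)" if xyz: "x \<in> carrier Q" "y \<in> carrier Q" "z \<in> carrier Q" for x y z
      proof (rule cc[OF xyz])
        fix A :: "('k, 'a) superalg" and h a b c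
        assume A: "superalg A" and h: "h \<in> superalg_hom A Q" "a \<in> carrier A" "b \<in> carrier A" "c \<in> carrier A"
          "x = h a" "y = h b" "z = h c"
        interpret A: superalg A by fact
        show ?thesis using h superalg_homD(2)[OF h(1), symmetric] by (simp add: A.m_assoc)
      qed
      show "\<one> \<otimes> x = x" "x \<otimes> \<one> = x" if xyz: "x \<in> carrier Q" for x
      proof -
        obtain A :: "('k, 'a) superalg" and h a where A: "superalg A"
          and h: "h \<in> superalg_hom A Q" "a \<in> carrier A" "x = h a" by (rule cc[OF xyz xyz xyz])
        interpret A: superalg A by fact
        show "\<one> \<otimes> x = x" "x \<otimes> \<one> = x" using h superalg_homD(2)[OF h(1), of "\<one>\<^bsub>A\<^esub>" a]
            superalg_homD(2)[OF h(1), of a "\<one>\<^bsub>A\<^esub>"] superalg_homD(4)[OF h(1)] by simp_all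
      qed
    qed (use one in auto)
    show "(x \<oplus> y) \<otimes> z = x \<otimes> z \<oplus> y \<otimes> z" "z \<otimes> (x \<oplus> y) = z \<otimes> x \<oplus> z \<otimes> y"
      if xyz: "x \<in> carrier Q" "y \<in> carrier Q" "z \<in> carrier Q" for x y z
    proof -
      obtain A :: "('k, 'a) superalg" and h a b c where A: "superalg A"
        and h: "h \<in> superalg_hom A Q" "a \<in> carrier A" "b \<in> carrier A" "c \<in> carrier A"
        "x = h a" "y = h b" "z = h c" by (rule cc[OF xyz])
      interpret A: superalg A by fact
      show "(x \<oplus> y) \<otimes> z = x \<otimes> z \<oplus> y \<otimes> z" "z \<otimes> (x \<oplus> y) = z \<otimes> x \<oplus> z \<otimes> y"
        using h superalg_homD(2,3)[OF h(1), symmetric] by (simp_all add: A.l_distr A.r_distr)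
    qed
  qed
  interpret Q: ring Q by fact
  have mo: "module (ring_of_type_algebra :: 'k ring) Q"
  proof (rule moduleI)
    show "cring (ring_of_type_algebra :: 'k ring)" by (rule cring_from_type_algebra)
    show "abelian_group Q" by fact
    show "c \<odot> x \<in> carrier Q" if "x \<in> carrier Q" for c x using smult[of x None c] that by simp
    fix c d :: 'k and x y assume xy: "x \<in> carrier Q" "y \<in> carrier Q"
    obtain A :: "('k, 'a) superalg" and h a b where A: "superalg A"
      and h: "h \<in> superalg_hom A Q" "a \<in> carrier A" "b \<in> carrier A" "x = h a" "y = h b" by (rule cc[OF xy xy(1)])
    interpret A: superalg A by fact
    show "c \<odot> (x \<oplus> y) = c \<odot> x \<oplus> c \<odot> y"
      using h superalg_homD(3,5)[OF h(1), symmetric] by (simp add: A.smult_add_right)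
  next
    fix c d :: 'k and x assume x: "x \<in> carrier Q"
    obtain A :: "('k, 'a) superalg" and h a where A: "superalg A"
      and h: "h \<in> superalg_hom A Q" "a \<in> carrier A" "x = h a" by (rule cc[OF x x x])
    interpret A: superalg A by fact
    show "(c \<oplus>\<^bsub>ring_of_type_algebra\<^esub> d) \<odot> x = c \<odot> x \<oplus> d \<odot> x"
      using h superalg_homD(3,5)[OF h(1), symmetric] by (simp add: A.smult_add_left ring_of_type_algebra_def)
    show "(c \<otimes>\<^bsub>ring_of_type_algebra\<^esub> d) \<odot> x = c \<odot> (d \<odot> x)"
      using h superalg_homD(5)[OF h(1), symmetric] by (simp add: A.smult_smult ring_of_type_algebra_def)
    show "\<one>\<^bsub>ring_of_type_algebra\<^esub> \<odot> x = x"
      using h superalg_homD(5)[OF h(1), symmetric] by (simp add: ring_of_type_algebra_def)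
  qed
  show ?thesis
  proof (rule superalgebraI[OF r mo])
    fix c :: 'k and x y assume xy: "x \<in> carrier Q" "y \<in> carrier Q"
    obtain A :: "('k, 'a) superalg" and h a b where A: "superalg A"
      and h: "h \<in> superalg_hom A Q" "a \<in> carrier A" "b \<in> carrier A" "x = h a" "y = h b" by (rule cc[OF xy xy(1)])
    interpret A: superalg A by fact
    show "(c \<odot> x) \<otimes> y = c \<odot> (x \<otimes> y)" "x \<otimes> (c \<odot> y) = c \<odot> (x \<otimes> y)"
      using h superalg_homD(2,5)[OF h(1), symmetric] by (simp_all add: A.smult_mult_left A.smult_mult_right)
  next
    fix x assume x: "x \<in> carrier Q"
    obtain A :: "('k, 'a) superalg" and h a where A: "superalg A"
      and h: "h \<in> superalg_hom A Q" "a \<in> carrier A" "x = h a" by (rule cc[OF x x x])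
    interpret A: superalg A by fact
    show "\<exists>a0\<in>even_part Q. \<exists>a1\<in>odd_part Q. x = a0 \<oplus> a1"
      using A.even_odd_decomp[OF h(2)] superalg_homD(3,6,7)[OF h(1)] h(3) A.even_carrier A.odd_carrier by metis
  next
    fix x y assume xy: "x \<in> even_part Q" "y \<in> even_part Q"
    obtain A :: "('k, 'a) superalg" and h a b where A: "superalg A"
      and h: "h \<in> superalg_hom A Q" "a \<in> even_part A" "b \<in> even_part A" "x = h a" "y = h b"
      by (rule cov[of x "Some True" y "Some True" x "Some True", unfolded part_simps, OF xy xy(1)])
    interpret A: superalg A by fact
    show "x \<otimes> y \<in> even_part Q"
      using h superalg_homD(2,6)[OF h(1)] A.even_carrier A.even_even_mult by metis
  next
    fix x y assume xy: "x \<in> even_part Q" "y \<in> odd_part Q"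
    obtain A :: "('k, 'a) superalg" and h a b where A: "superalg A"
      and h: "h \<in> superalg_hom A Q" "a \<in> even_part A" "b \<in> odd_part A" "x = h a" "y = h b"
      by (rule cov[of x "Some True" y "Some False" x "Some True", unfolded part_simps, OF xy xy(1)])
    interpret A: superalg A by fact
    show "x \<otimes> y \<in> odd_part Q"
      using h superalg_homD(2,7)[OF h(1)] A.even_carrier A.odd_carrier A.even_odd_mult by metis
  next
    fix x y assume xy: "x \<in> even_part Q" "y \<in> carrier Q"
    obtain A :: "('k, 'a) superalg" and h a b where A: "superalg A"
      and h: "h \<in> superalg_hom A Q" "a \<in> even_part A" "b \<in> carrier A" "x = h a" "y = h b"
      by (rule cov[of x "Some True" y None x "Some True", unfolded part_simps, OF xy xy(1)])
    interpret A: superalg A by fact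
    show "x \<otimes> y = y \<otimes> x"
      using h superalg_homD(2)[OF h(1)] A.even_carrier A.even_commute by metis
  next
    fix x y assume xy: "x \<in> odd_part Q" "y \<in> odd_part Q"
    obtain A :: "('k, 'a) superalg" and h a b where A: "superalg A"
      and h: "h \<in> superalg_hom A Q" "h \<zero>\<^bsub>A\<^esub> = \<zero>" "a \<in> odd_part A" "b \<in> odd_part A" "x = h a" "y = h b"
      by (rule cov[of x "Some False" y "Some False" x "Some False", unfolded part_simps, OF xy xy(1)])
    interpret A: superalg A by fact
    have c: "a \<in> carrier A" "b \<in> carrier A" using h A.odd_carrier by auto
    show "x \<otimes> y \<in> even_part Q"
      using h superalg_homD(2,6)[OF h(1)] c A.odd_odd_mult by metis
    have "x \<otimes> y \<oplus> y \<otimes> x = h (a \<otimes>\<^bsub>A\<^esub> b \<oplus>\<^bsub>A\<^esub> b \<otimes>\<^bsub>A\<^esub> a)"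
      using c h superalg_homD(2,3)[OF h(1), symmetric] by simp
    also have "\<dots> = \<zero>" using A.odd_anticommute[OF h(3,4)] c h(2) by (simp add: A.l_neg)
    finally have "x \<otimes> y \<oplus> y \<otimes> x = \<zero>" .
    moreover have "x \<in> carrier Q" "y \<in> carrier Q" using xy sub by auto
    ultimately show "x \<otimes> y = \<ominus> (y \<otimes> x)"
      using Q.minus_equality[of "x \<otimes> y" "y \<otimes> x"] by simp
  next
    show "x \<oplus> y \<in> even_part Q" if "x \<in> even_part Q" "y \<in> even_part Q" for x y
      using add[of x "Some True" y] that by simp
    show "x \<oplus> y \<in> odd_part Q" if "x \<in> odd_part Q" "y \<in> odd_part Q" for x y
      using add[of x "Some False" y] that by simp
    show "c \<odot> x \<in> even_part Q" if "x \<in> even_part Q" for c x using smult[of x "Some True" c] that by simp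
    show "c \<odot> x \<in> odd_part Q" if "x \<in> odd_part Q" for c x using smult[of x "Some False" c] that by simp
  qed (use zero one sub int in blast)+
qed

section \<open>Ideals of codimension one\<close>

context superalg
begin

lemma idealI_superalg:
  assumes "N \<subseteq> carrier A" "\<zero> \<in> N" "\<And>a b. a \<in> N \<Longrightarrow> b \<in> N \<Longrightarrow> a \<oplus> b \<in> N"
    and "\<And>a x. a \<in> N \<Longrightarrow> x \<in> carrier A \<Longrightarrow> x \<otimes> a \<in> N"
    and "\<And>a x. a \<in> N \<Longrightarrow> x \<in> carrier A \<Longrightarrow> a \<otimes> x \<in> N"
  shows "ideal N A"
proof (rule idealI[OF ring_axioms])
  show "subgroup N (add_monoid A)"
  proof (rule add.subgroupI)
    fix a assume a: "a \<in> N"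
    have "\<ominus> a = (\<ominus> \<one>) \<otimes> a" using a assms(1) by (auto simp: l_minus)
    then show "\<ominus> a \<in> N" using assms(4)[OF a, of "\<ominus> \<one>"] by simp
  qed (use assms in auto)
qed (use assms in auto)

lemma ideal_smult: "ideal N A \<Longrightarrow> a \<in> N \<Longrightarrow> c \<odot> a \<in> N"
  using ideal.I_l_closed[of N A a "c \<odot> \<one>"] ideal.Icarr[of N A a] by (simp add: smult_mult_left)

text \<open>
  A strictly larger ideal contains a nonzero multiple of the unit, since every element differs
  from such a multiple by an element of \<open>N\<close>.
\<close>

lemma maximalideal_codim_one:
  assumes N: "ideal N A" and one: "\<one> \<notin> N"
    and codim: "\<And>a. a \<in> carrier A \<Longrightarrow> \<exists>c. a \<ominus> c \<odot> \<one> \<in> N"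
  shows "maximalideal N A"
proof (rule maximalidealI[OF N])
  show "carrier A \<noteq> N" using one by auto
  fix J assume J: "ideal J A" "N \<subseteq> J" "J \<subseteq> carrier A"
  interpret J: ideal J A by fact
  show "J = N \<or> J = carrier A"
  proof (rule disjCI)
    assume "J \<noteq> carrier A"
    then have oneJ: "\<one> \<notin> J" using J.one_imp_carrier by blast
    have "a \<in> N" if a: "a \<in> J" for a
    proof -
      obtain c where c: "a \<ominus> c \<odot> \<one> \<in> N" using codim J(3) a by blast
      have ac: "a \<in> carrier A" using J(3) a by blast
      have "a \<ominus> (a \<ominus> c \<odot> \<one>) \<in> J" using J.a_closed[OF a J.a_inv_closed[OF subsetD[OF J(2) c]]]
        by (simp only: a_minus_def)
      also have "a \<ominus> (a \<ominus> c \<odot> \<one>) = c \<odot> \<one>" using ac smult_closed[OF one_closed, of c] by algebra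
      finally have cJ: "c \<odot> \<one> \<in> J" .
      have "c = 0"
      proof (rule ccontr)
        assume "c \<noteq> 0"
        then have "\<one> = inverse c \<odot> (c \<odot> \<one>)" using smult_smult[of \<one> "inverse c" c] by simp
        then show False using ideal_smult[OF J(1) cJ] oneJ by metis
      qed
      then show ?thesis using c ac by (simp add: a_minus_def)
    qed
    then show "J = N" using J(2) by blast
  qed
qed

end

section \<open>Quotients\<close>

locale superalg_quotient = superalg A for A :: "('k::field, 'a) superalg" (structure) +
  fixes J Q
  assumes graded: "graded_ideal J A"
  defines "Q \<equiv> quotient_superalg A J"
begin

sublocale J: ideal J A
  using graded by (simp add: graded_ideal_def)

lemma quotient_carrier: "carrier Q = (\<lambda>a. J +> a) ` carrier A"
  by (auto simp: Q_def quotient_superalg_def FactRing_def A_RCOSETS_def' )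

lemma proj_closed: "a \<in> carrier A \<Longrightarrow> J +> a \<in> carrier Q"
  by (simp add: quotient_carrier)

lemma quotient_add: "a \<in> carrier A \<Longrightarrow> b \<in> carrier A \<Longrightarrow> (J +> a) \<oplus>\<^bsub>Q\<^esub> (J +> b) = J +> (a \<oplus> b)"
  by (simp add: Q_def quotient_superalg_def FactRing_def J.a_rcos_sum)

lemma quotient_mult: "a \<in> carrier A \<Longrightarrow> b \<in> carrier A \<Longrightarrow> (J +> a) \<otimes>\<^bsub>Q\<^esub> (J +> b) = J +> (a \<otimes> b)"
  by (simp add: Q_def quotient_superalg_def FactRing_def J.rcoset_mult_add)

lemma quotient_one: "\<one>\<^bsub>Q\<^esub> = J +> \<one>"
  by (simp add: Q_def quotient_superalg_def FactRing_def)

lemma quotient_zero: "\<zero>\<^bsub>Q\<^esub> = J +> \<zero>"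
  by (simp add: Q_def quotient_superalg_def FactRing_def J.a_subset)

lemma proj_eq_iff: "a \<in> carrier A \<Longrightarrow> b \<in> carrier A \<Longrightarrow> J +> a = J +> b \<longleftrightarrow> a \<ominus> b \<in> J"
  by (rule J.mem_diff_iff)

lemma proj_zero_iff: "a \<in> carrier A \<Longrightarrow> J +> a = \<zero>\<^bsub>Q\<^esub> \<longleftrightarrow> a \<in> J"
  unfolding quotient_zero by (simp add: proj_eq_iff a_minus_def)

lemma quotient_smult: assumes a: "a \<in> carrier A" shows "c \<odot>\<^bsub>Q\<^esub> (J +> a) = J +> (c \<odot> a)"
proof -
  have "J +> (c \<odot> b) = J +> (c \<odot> a)" if b: "b \<in> J +> a" for b
  proof -
    have bc: "b \<in> carrier A" using b a J.a_elemrcos_carrier by blast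
    have "b \<ominus> a \<in> J" using J.a_rcos_module_minus[OF ring_axioms a bc] b by blast
    then have "c \<odot> (b \<ominus> a) \<in> J" by (rule ideal_smult[OF J.is_ideal])
    moreover have "c \<odot> (b \<ominus> a) = c \<odot> b \<ominus> c \<odot> a"
      using a bc smult_minus_left[of a 1] smult_minus_left[of a c] smult_smult[of a c "-1"]
      by (simp add: a_minus_def smult_add_right)
    ultimately show ?thesis using a bc by (simp add: proj_eq_iff)
  qed
  moreover have "a \<in> J +> a" using a J.a_rcos_self by blast
  ultimately have "(\<Union>b\<in>J +> a. J +> (c \<odot> b)) = J +> (c \<odot> a)" by blast
  then show ?thesis by (simp add: Q_def quotient_superalg_def)
qed

lemma quotient_even: "even_part Q = (\<lambda>a. J +> a) ` even_part A"
  and quotient_odd: "odd_part Q = (\<lambda>a. J +> a) ` odd_part A"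
  by (simp_all add: Q_def quotient_superalg_def)

lemma proj_hom: "(\<lambda>a. J +> a) \<in> superalg_hom A Q"
  unfolding superalg_hom_def ring_hom_def
  by (auto simp: proj_closed quotient_mult quotient_add quotient_one quotient_smult quotient_even quotient_odd)

text \<open>
  The homogeneous components of an element of a graded ideal lie in the ideal. This makes the
  even and the odd part of the quotient meet only in zero.
\<close>

lemma graded_decomp:
  assumes "a0 \<in> even_part A" "a1 \<in> odd_part A" "a0 \<oplus> a1 \<in> J"
  shows "a0 \<in> J" "a1 \<in> J"
proof -
  obtain b0 b1 where b: "b0 \<in> J" "b1 \<in> J" "b0 \<in> even_part A" "b1 \<in> odd_part A" "a0 \<oplus> a1 = b0 \<oplus> b1"
    using graded assms(3) unfolding graded_ideal_def set_add_def' by blast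
  have c: "a0 \<in> carrier A" "a1 \<in> carrier A" "b0 \<in> carrier A" "b1 \<in> carrier A"
    using assms b even_carrier odd_carrier by auto
  have "a0 \<ominus> b0 = (a0 \<oplus> a1) \<ominus> a1 \<ominus> b0" using c by algebra
  also have "\<dots> = b1 \<ominus> a1" unfolding b(5) using c by algebra
  finally have eq: "a0 \<ominus> b0 = b1 \<ominus> a1" .
  have "a0 \<ominus> b0 \<in> even_part A" "b1 \<ominus> a1 \<in> odd_part A"
    using assms b by (simp_all add: a_minus_def even_add even_minus odd_add odd_minus)
  then have "a0 \<ominus> b0 = \<zero>" "b1 \<ominus> a1 = \<zero>" using even_odd_Int eq by auto
  then have "a0 = b0" "a1 = b1" using c by (metis r_right_minus_eq)+
  then show "a0 \<in> J" "a1 \<in> J" using b by auto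
qed

lemma superalgebra_quotient: "superalgebra Q"
proof (rule superalgebra_local_image)
  fix u v w x y z
  assume xyz: "x \<in> part u Q" "y \<in> part v Q" "z \<in> part w Q"
  have "part u Q = (\<lambda>a. J +> a) ` part u A" for u
    by (auto simp: part_def quotient_carrier quotient_even quotient_odd split: option.splits)
  then show "\<exists>(B :: ('k, 'a) superalg) h. superalgebra B \<and> h \<in> superalg_hom B Q \<and> h \<zero>\<^bsub>B\<^esub> = \<zero>\<^bsub>Q\<^esub> \<and>
        (\<exists>a\<in>part u B. \<exists>b\<in>part v B. \<exists>c\<in>part w B. x = h a \<and> y = h b \<and> z = h c)"
    using xyz superalgebra proj_hom quotient_zero
    by (intro exI[of _ A] exI[of _ "\<lambda>a. J +> a"]) auto
next
  show "carrier Q \<noteq> {}" using proj_closed[OF zero_closed] by blast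
  show "even_part Q \<subseteq> carrier Q" "odd_part Q \<subseteq> carrier Q"
    using even_carrier odd_carrier by (auto simp: quotient_even quotient_odd quotient_carrier)
  show "even_part Q \<inter> odd_part Q \<subseteq> {\<zero>\<^bsub>Q\<^esub>}"
  proof
    fix x assume "x \<in> even_part Q \<inter> odd_part Q"
    then obtain a b where ab: "a \<in> even_part A" "b \<in> odd_part A" "x = J +> a" "x = J +> b"
      by (auto simp: quotient_even quotient_odd)
    then have "a \<oplus> \<ominus> b \<in> J"
      using proj_eq_iff even_carrier odd_carrier by (metis a_minus_def)
    then have "a \<in> J" using graded_decomp(1)[OF ab(1) odd_minus[OF ab(2)]] by blast
    then show "x \<in> {\<zero>\<^bsub>Q\<^esub>}" using ab proj_zero_iff even_carrier by auto
  qed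
qed

end

section \<open>Weil algebras\<close>

text \<open>
  The inverse image \<open>K\<close> of the nilpotent ideal \<open>N\<close> is proper and of codimension one, since \<open>N\<close> is.
  So \<open>K\<close> is maximal, which by locality makes it the maximal ideal, and \<open>h\<close> maps its powers
  into the powers of \<open>N\<close>.
\<close>

lemma weil_point_kills_ideal_power:
  fixes S :: "('k::field, 's) superalg" and A :: "('k, 'a) superalg"
  assumes S: "superalgebra S" and local: "\<exists>!I. maximalideal I S"
    and A: "super_weil_algebra A" and h: "h \<in> superalg_hom S A"
  shows "\<exists>k. \<forall>f\<in>ideal_power S (THE I. maximalideal I S) (k + 1). h f = \<zero>\<^bsub>A\<^esub>"
proof -
  have A': "superalgebra A" and "\<exists>N. graded_ideal N A \<and> (\<exists>r. ideal_power A N r = {\<zero>\<^bsub>A\<^esub>}) \<and>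
      (\<forall>a\<in>carrier A. \<exists>!(c, n). n \<in> N \<and> a = (c \<odot>\<^bsub>A\<^esub> \<one>\<^bsub>A\<^esub>) \<oplus>\<^bsub>A\<^esub> n)"
    using A by (simp_all only: super_weil_algebra_def)
  then obtain N r where N: "graded_ideal N A" and r: "ideal_power A N r = {\<zero>\<^bsub>A\<^esub>}"
    and uni: "\<forall>a\<in>carrier A. \<exists>!(c, n). n \<in> N \<and> a = (c \<odot>\<^bsub>A\<^esub> \<one>\<^bsub>A\<^esub>) \<oplus>\<^bsub>A\<^esub> n"
    by (elim exE conjE)
  interpret S: superalg S by (rule superalgI) fact
  interpret A: superalg A by (rule superalgI) fact
  have NI: "ideal N A" using N by (simp add: graded_ideal_def)
  interpret N: ideal N A by fact
  define K where "K = {s \<in> carrier S. h s \<in> N}"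
  have hr: "ring_hom_ring S A h"
    using h by (intro ring_hom_ringI2 S.ring_axioms A.ring_axioms) (simp add: superalg_hom_def)
  have K: "ideal K S" unfolding K_def by (rule ring_hom_ring.ideal_vimage[OF hr NI])
  have one: "\<one>\<^bsub>S\<^esub> \<notin> K"
  proof
    assume "\<one>\<^bsub>S\<^esub> \<in> K"
    have ex1_eq: "\<And>P (x :: 'k \<times> 'a) y. \<exists>!x. P x \<Longrightarrow> P x \<Longrightarrow> P y \<Longrightarrow> x = y" by blast
    from \<open>\<one>\<^bsub>S\<^esub> \<in> K\<close> have "\<one>\<^bsub>A\<^esub> \<in> N" using superalg_homD(4)[OF h] by (simp add: K_def)
    \<comment> \<open>The unit of \<open>A\<close> would have the two decompositions \<open>0 + 1\<close> and \<open>1 + 0\<close>.\<close>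
    then have "(\<lambda>(c, n). n \<in> N \<and> \<one>\<^bsub>A\<^esub> = (c \<odot>\<^bsub>A\<^esub> \<one>\<^bsub>A\<^esub>) \<oplus>\<^bsub>A\<^esub> n) (0, \<one>\<^bsub>A\<^esub>)"
      "(\<lambda>(c, n). n \<in> N \<and> \<one>\<^bsub>A\<^esub> = (c \<odot>\<^bsub>A\<^esub> \<one>\<^bsub>A\<^esub>) \<oplus>\<^bsub>A\<^esub> n) (1, \<zero>\<^bsub>A\<^esub>)"
      by simp_all
    then have "(0 :: 'k, \<one>\<^bsub>A\<^esub>) = (1, \<zero>\<^bsub>A\<^esub>)"
      by (rule ex1_eq[OF bspec[OF uni A.one_closed]])
    then show False by simp
  qed
  have "maximalideal K S"
  proof (rule S.maximalideal_codim_one[OF K one])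
    fix s assume s: "s \<in> carrier S"
    obtain c n where cn: "n \<in> N" "h s = (c \<odot>\<^bsub>A\<^esub> \<one>\<^bsub>A\<^esub>) \<oplus>\<^bsub>A\<^esub> n"
      using bspec[OF uni superalg_homD(1)[OF h s]] by (elim ex1E) auto
    have "h (s \<ominus>\<^bsub>S\<^esub> c \<odot>\<^bsub>S\<^esub> \<one>\<^bsub>S\<^esub>) = h s \<ominus>\<^bsub>A\<^esub> c \<odot>\<^bsub>A\<^esub> \<one>\<^bsub>A\<^esub>"
      using superalg_hom_diff[OF h S A' s, of "c \<odot>\<^bsub>S\<^esub> \<one>\<^bsub>S\<^esub>"] superalg_homD(4)[OF h]
        superalg_homD(5)[OF h S.one_closed, of c] by simp
    also have "\<dots> = n"
      unfolding cn(2) using N.Icarr[OF cn(1)] A.smult_closed[OF A.one_closed, of c] by algebra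
    finally show "\<exists>c. s \<ominus>\<^bsub>S\<^esub> c \<odot>\<^bsub>S\<^esub> \<one>\<^bsub>S\<^esub> \<in> K"
      using s cn(1) unfolding K_def by (intro exI[of _ c]) simp
  qed
  then have eq: "(THE I. maximalideal I S) = K" using local by (rule the1_equality[rotated])
  have "h f = \<zero>\<^bsub>A\<^esub>" if f: "f \<in> ideal_power S K (r + 1)" for f
  proof -
    have "f \<in> ideal_power S K r" using f S.ideal_power_antimono[OF K, of r "r + 1"] by auto
    moreover have "h ` K \<subseteq> N" by (auto simp: K_def)
    ultimately have "h f \<in> ideal_power A N r" using superalg_hom_ideal_power[OF h S K] by blast
    then show ?thesis using r by simp
  qed
  then show ?thesis unfolding eq by (intro exI[of _ r]) blast
qed

text \<open>
  A finite set spans as soon as every set that contains its multiples and is closed under addition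
  is everything. In this form no coefficients have to be handled when a spanning set is exhibited.
\<close>

lemma (in superalg) finite_dimensionalI:
  assumes S: "finite S" "S \<subseteq> carrier A"
    and span: "\<And>H. \<zero> \<in> H \<Longrightarrow> (\<And>a b. a \<in> H \<Longrightarrow> b \<in> H \<Longrightarrow> a \<oplus> b \<in> H) \<Longrightarrow>
      (\<And>c s. s \<in> S \<Longrightarrow> c \<odot> s \<in> H) \<Longrightarrow> carrier A \<subseteq> H"
  shows "finite_dimensional A"
proof -
  define H where "H = {a. \<exists>c. a = (\<Oplus>b\<in>S. c b \<odot> b)}"
  have "carrier A \<subseteq> H"
  proof (rule span)
    have "\<zero> = (\<Oplus>b\<in>S. (0 :: 'k) \<odot> b)"
      using S(2) by (subst add.finprod_one_eqI) auto
    then show "\<zero> \<in> H" unfolding H_def by (intro CollectI exI[of _ "\<lambda>_. 0"])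
  next
    fix a b assume "a \<in> H" "b \<in> H"
    then obtain c d where cd: "a = (\<Oplus>b\<in>S. c b \<odot> b)" "b = (\<Oplus>b\<in>S. d b \<odot> b)" by (auto simp: H_def)
    have "a \<oplus> b = (\<Oplus>b\<in>S. c b \<odot> b \<oplus> d b \<odot> b)"
      unfolding cd using S(2) by (intro finsum_addf[symmetric]) auto
    also have "\<dots> = (\<Oplus>b\<in>S. (c b + d b) \<odot> b)"
      using S(2) by (intro finsum_cong') (auto simp: smult_add_left)
    finally show "a \<oplus> b \<in> H" unfolding H_def by (intro CollectI exI[of _ "\<lambda>b. c b + d b"])
  next
    fix c s assume s: "s \<in> S"
    have "(\<Oplus>b\<in>S. (if s = b then c else 0) \<odot> b) = (\<Oplus>b\<in>S. if s = b then c \<odot> b else \<zero>)"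
      using S(2) s by (intro finsum_cong') auto
    also have "\<dots> = c \<odot> s"
      using S s by (intro finsum_singleton) auto
    finally show "c \<odot> s \<in> H" unfolding H_def by (intro CollectI exI[of _ "\<lambda>b. if s = b then c else 0"]) simp
  qed
  then show ?thesis unfolding finite_dimensional_def H_def using S by blast
qed

text \<open>
  The nilpotent ideal is the image of \<open>M\<close>. It is a complement of the scalars because \<open>M\<close>
  contains \<open>J = M\<^sup>k\<^sup>+\<^sup>1\<close>, has codimension one and contains no nonzero scalar.
\<close>

lemma super_weil_algebra_quotient_power:
  fixes A :: "('k::field, 'a) superalg" (structure)
  assumes A: "superalgebra A" and M: "graded_ideal M A" and one: "\<one> \<notin> M"
    and codim: "\<And>a. a \<in> carrier A \<Longrightarrow> \<exists>c. a \<ominus> c \<odot> \<one> \<in> M"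
    and fin: "finite_dimensional (quotient_superalg A (ideal_power A M (k + 1)))"
  shows "super_weil_algebra (quotient_superalg A (ideal_power A M (k + 1)))"
proof -
  interpret superalg A by (rule superalgI) fact
  define J where "J = ideal_power A M (k + 1)"
  interpret superalg_quotient A J "quotient_superalg A J"
    by unfold_locales (simp only: J_def graded_ideal_power[OF M])
  define Q where "Q = quotient_superalg A J"
  note q = quotient_carrier quotient_add quotient_mult quotient_one quotient_zero quotient_smult
    quotient_even quotient_odd
  note q' = q[folded Q_def]
  interpret Q: superalg Q unfolding Q_def by (rule superalgI superalgebra_quotient)+
  have MI: "ideal M A" and Mdec: "M = (M \<inter> even_part A) <+> (M \<inter> odd_part A)"
    using M by (auto simp: graded_ideal_def)
  interpret M: ideal M A by fact
  have JM: "J \<subseteq> M" using ideal_power_antimono[OF MI, of "Suc 0" "k + 1"] ideal_power_1[OF MI] by (simp add: J_def)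
  define N where "N = (\<lambda>a. J +> a) ` M"
  have N: "ideal N Q"
    using M.Icarr M.I_l_closed M.I_r_closed M.a_closed
    by (intro Q.idealI_superalg) (auto simp: N_def q' intro!: imageI)
  have gN: "graded_ideal N Q"
  proof -
    have "N = (N \<inter> even_part Q) <+>\<^bsub>Q\<^esub> (N \<inter> odd_part Q)"
    proof
      show "N \<subseteq> (N \<inter> even_part Q) <+>\<^bsub>Q\<^esub> (N \<inter> odd_part Q)"
      proof
        fix x assume "x \<in> N"
        then obtain m where m: "m \<in> M" "x = J +> m" by (auto simp: N_def)
        obtain m0 m1 where m01: "m0 \<in> M" "m1 \<in> M" "m0 \<in> even_part A" "m1 \<in> odd_part A" "m = m0 \<oplus> m1"
          using Mdec m(1) unfolding set_add_def' by blast
        then have "x = (J +> m0) \<oplus>\<^bsub>Q\<^esub> (J +> m1)" using m M.Icarr by (simp add: q')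
        then show "x \<in> (N \<inter> even_part Q) <+>\<^bsub>Q\<^esub> (N \<inter> odd_part Q)"
          using m01 unfolding set_add_def' N_def q' by blast
      qed
      show "(N \<inter> even_part Q) <+>\<^bsub>Q\<^esub> (N \<inter> odd_part Q) \<subseteq> N"
        using additive_subgroup.a_closed[OF ideal.axioms(1)[OF N]] unfolding set_add_def' by blast
    qed
    then show ?thesis using N by (simp add: graded_ideal_def)
  qed
  have pN: "ideal_power Q N (k + 1) = {\<zero>\<^bsub>Q\<^esub>}"
  proof -
    have "ideal_power Q N n \<subseteq> (\<lambda>a. J +> a) ` ideal_power A M n" for n
    proof (induction n)
      case 0
      then show ?case by (simp add: q')
    next
      case (Suc n)
      interpret P: ideal "ideal_power A M n" A by (rule ideal_ideal_power[OF MI])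
      interpret P1: ideal "ideal_power A M n \<cdot> M" A
        by (rule ideal_prod_is_ideal[OF ideal_ideal_power[OF MI] MI])
      show ?case
      proof
        fix x assume "x \<in> ideal_power Q N (Suc n)"
        then have "x \<in> ideal_power Q N n \<cdot>\<^bsub>Q\<^esub> N" by simp
        then have "x \<in> (\<lambda>a. J +> a) ` (ideal_power A M n \<cdot> M)"
        proof induction
          case (prod i j)
          then obtain a b where "a \<in> ideal_power A M n" "b \<in> M" "i = J +> a" "j = J +> b"
            using Suc.IH by (auto simp: N_def)
          then show ?case using P.Icarr M.Icarr ideal_prod.prod[of a _ b M A] by (auto simp: q')
        next
          case (sum s1 s2)
          then show ?case using P1.Icarr P1.a_closed by (auto simp: q')
        qed
        then show "x \<in> (\<lambda>a. J +> a) ` ideal_power A M (Suc n)" by simp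
      qed
    qed
    moreover have "(\<lambda>a. J +> a) ` ideal_power A M (k + 1) \<subseteq> {\<zero>\<^bsub>Q\<^esub>}"
      using proj_zero_iff J.Icarr unfolding Q_def J_def by blast
    ultimately show ?thesis
      using additive_subgroup.zero_closed[OF ideal.axioms(1)[OF Q.ideal_ideal_power[OF N]]] by blast
  qed
  have uN: "\<exists>!(c, n). n \<in> N \<and> x = (c \<odot>\<^bsub>Q\<^esub> \<one>\<^bsub>Q\<^esub>) \<oplus>\<^bsub>Q\<^esub> n" if x: "x \<in> carrier Q" for x
  proof -
    obtain a where a: "a \<in> carrier A" "x = J +> a" using x by (auto simp: q')
    obtain c where c: "a \<ominus> c \<odot> \<one> \<in> M" using codim[OF a(1)] by blast
    have cc: "c \<odot> \<one> \<in> carrier A" for c by simp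
    have "c \<odot> \<one> \<oplus> (a \<ominus> c \<odot> \<one>) = a" using a cc[of c] by algebra
    then have ex1: "x = (c \<odot>\<^bsub>Q\<^esub> \<one>\<^bsub>Q\<^esub>) \<oplus>\<^bsub>Q\<^esub> (J +> (a \<ominus> c \<odot> \<one>))"
      using a cc[of c] by (simp add: q')
    have ex2: "J +> (a \<ominus> c \<odot> \<one>) \<in> N" using c by (auto simp: N_def)
    have unique: "c1 = c2 \<and> n1 = n2"
      if n: "n1 \<in> N" "n2 \<in> N" and eq: "(c1 \<odot>\<^bsub>Q\<^esub> \<one>\<^bsub>Q\<^esub>) \<oplus>\<^bsub>Q\<^esub> n1 = (c2 \<odot>\<^bsub>Q\<^esub> \<one>\<^bsub>Q\<^esub>) \<oplus>\<^bsub>Q\<^esub> n2" for c1 c2 n1 n2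
    proof -
      obtain m1 m2 where m: "m1 \<in> M" "m2 \<in> M" "n1 = J +> m1" "n2 = J +> m2" using n by (auto simp: N_def)
      have mc: "m1 \<in> carrier A" "m2 \<in> carrier A" using m M.Icarr by auto
      have "J +> (c1 \<odot> \<one> \<oplus> m1) = J +> (c2 \<odot> \<one> \<oplus> m2)" using eq m mc by (simp add: q')
      then have d: "(c1 \<odot> \<one> \<oplus> m1) \<ominus> (c2 \<odot> \<one> \<oplus> m2) \<in> M" using proj_eq_iff mc JM by auto
      have "(c1 - c2) \<odot> \<one> = c1 \<odot> \<one> \<ominus> c2 \<odot> \<one>"
        using smult_add_left[OF one_closed, of c1 "- c2"] smult_minus_left[OF one_closed, of c2]
        by (simp add: a_minus_def)
      also have "\<dots> = ((c1 \<odot> \<one> \<oplus> m1) \<ominus> (c2 \<odot> \<one> \<oplus> m2)) \<oplus> (m2 \<ominus> m1)"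
        using mc cc[of c1] cc[of c2] by algebra
      also have "\<dots> \<in> M" using d m M.a_closed M.a_inv_closed unfolding a_minus_def by blast
      finally have cM: "(c1 - c2) \<odot> \<one> \<in> M" .
      have "c1 = c2"
      proof (rule ccontr)
        assume "c1 \<noteq> c2"
        then have "\<one> = inverse (c1 - c2) \<odot> ((c1 - c2) \<odot> \<one>)"
          using smult_smult[of \<one> "inverse (c1 - c2)" "c1 - c2"] by simp
        then show False using ideal_smult[OF MI cM] one by metis
      qed
      moreover have "n1 = n2"
        using eq Q.add.l_cancel[of "c1 \<odot>\<^bsub>Q\<^esub> \<one>\<^bsub>Q\<^esub>" n1 n2] n ideal.Icarr[OF N] \<open>c1 = c2\<close> by simp
      ultimately show ?thesis by blast
    qed
    show ?thesis
    proof (rule ex1I[of _ "(c, J +> (a \<ominus> c \<odot> \<one>))"])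
      show "case (c, J +> (a \<ominus> c \<odot> \<one>)) of (c, n) \<Rightarrow> n \<in> N \<and> x = (c \<odot>\<^bsub>Q\<^esub> \<one>\<^bsub>Q\<^esub>) \<oplus>\<^bsub>Q\<^esub> n"
        unfolding prod.case using ex1 ex2 by blast
      fix p assume "case p of (c, n) \<Rightarrow> n \<in> N \<and> x = (c \<odot>\<^bsub>Q\<^esub> \<one>\<^bsub>Q\<^esub>) \<oplus>\<^bsub>Q\<^esub> n"
      moreover obtain c' n' where p: "p = (c', n')" by (cases p)
      ultimately have "n' \<in> N" "x = (c' \<odot>\<^bsub>Q\<^esub> \<one>\<^bsub>Q\<^esub>) \<oplus>\<^bsub>Q\<^esub> n'" unfolding p prod.case by blast+
      then show "p = (c, J +> (a \<ominus> c \<odot> \<one>))"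
        using unique[of n' "J +> (a \<ominus> c \<odot> \<one>)" c' c] ex1 ex2 p by metis
    qed
  qed
  have "super_weil_algebra Q"
    unfolding super_weil_algebra_def
    by (intro conjI exI[of _ N] exI[of _ "k + 1"] ballI Q.superalgebra gN pN uN fin[folded J_def Q_def])
  then show ?thesis by (simp add: Q_def J_def)
qed

section \<open>Comparing truncations along a homomorphism\<close>

text \<open>
  The isomorphism takes a coset of \<open>J\<close> to its inverse image under \<open>h\<close>, which is a coset of \<open>I\<close>.
  This avoids a choice of representatives. It requires that each class contains some \<open>h b\<close>,
  and an even or odd class some \<open>h b\<close> with \<open>b\<close> of the same parity.
\<close>

lemma superalg_isomorphic_quotientsI:
  fixes A :: "('k::field, 'a) superalg" and B :: "('k, 'b) superalg"
  assumes A: "superalgebra A" and B: "superalgebra B" and h: "h \<in> superalg_hom B A"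
    and J: "graded_ideal J A" and I: "graded_ideal I B"
    and IJ: "\<And>b. b \<in> carrier B \<Longrightarrow> h b \<in> J \<longleftrightarrow> b \<in> I"
    and surj: "\<And>a. a \<in> carrier A \<Longrightarrow> \<exists>b\<in>carrier B. a \<ominus>\<^bsub>A\<^esub> h b \<in> J"
  shows "superalg_isomorphic (quotient_superalg A J) (quotient_superalg B I)"
proof -
  interpret A: superalg A by (rule superalgI) fact
  interpret B: superalg B by (rule superalgI) fact
  define QA where "QA = quotient_superalg A J"
  define QB where "QB = quotient_superalg B I"
  interpret A: superalg_quotient A J "quotient_superalg A J" by unfold_locales (simp_all add: J)
  interpret B: superalg_quotient B I "quotient_superalg B I" by unfold_locales (simp_all add: I)
  note qa = A.quotient_carrier A.quotient_add A.quotient_mult A.quotient_one A.quotient_zero A.quotient_smult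
    A.quotient_even A.quotient_odd
  note qa = qa[folded QA_def]
  note qb = B.quotient_carrier B.quotient_add B.quotient_mult B.quotient_one B.quotient_zero B.quotient_smult
    B.quotient_even B.quotient_odd
  note qb = qb[folded QB_def]
  define f where "f C = {b \<in> carrier B. h b \<in> C}" for C
  note hD = superalg_homD[OF h]
  have f: "f (J +>\<^bsub>A\<^esub> h b) = I +>\<^bsub>B\<^esub> b" if b: "b \<in> carrier B" for b
  proof -
    have "h b' \<in> J +>\<^bsub>A\<^esub> h b \<longleftrightarrow> b' \<in> I +>\<^bsub>B\<^esub> b" if b': "b' \<in> carrier B" for b'
    proof -
      have "h b' \<in> J +>\<^bsub>A\<^esub> h b \<longleftrightarrow> h b' \<ominus>\<^bsub>A\<^esub> h b \<in> J"
        using A.J.a_rcos_module_minus[OF A.ring_axioms, of "h b" "h b'"] b b' hD(1) by blast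
      also have "\<dots> \<longleftrightarrow> b' \<ominus>\<^bsub>B\<^esub> b \<in> I"
        using IJ[of "b' \<ominus>\<^bsub>B\<^esub> b"] superalg_hom_diff[OF h B A b' b] b b' by simp
      also have "\<dots> \<longleftrightarrow> b' \<in> I +>\<^bsub>B\<^esub> b"
        using B.J.a_rcos_module_minus[OF B.ring_axioms, of b b'] b b' by blast
      finally show ?thesis .
    qed
    moreover have "I +>\<^bsub>B\<^esub> b \<subseteq> carrier B" using B.a_r_coset_subset_G[OF B.J.a_subset b] .
    ultimately show ?thesis unfolding f_def by blast
  qed
  have rep: "\<exists>b\<in>carrier B. x = J +>\<^bsub>A\<^esub> h b" if "x \<in> carrier QA" for x
    using that surj A.proj_eq_iff hD(1) by (force simp: qa)
  have rep_even: "\<exists>b\<in>even_part B. x = J +>\<^bsub>A\<^esub> h b" if x: "x \<in> even_part QA" for x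
  proof -
    obtain a where a: "a \<in> even_part A" "x = J +>\<^bsub>A\<^esub> a" using x by (auto simp: qa)
    obtain b where b: "b \<in> carrier B" "a \<ominus>\<^bsub>A\<^esub> h b \<in> J" using surj A.even_carrier[OF a(1)] by blast
    obtain b0 b1 where b01: "b0 \<in> even_part B" "b1 \<in> odd_part B" "b = b0 \<oplus>\<^bsub>B\<^esub> b1"
      using B.even_odd_decomp[OF b(1)] by blast
    have c: "a \<in> carrier A" "h b0 \<in> carrier A" "h b1 \<in> carrier A" "b0 \<in> carrier B" "b1 \<in> carrier B"
      using a b01 hD(1) A.even_carrier B.even_carrier B.odd_carrier by auto
    have "a \<ominus>\<^bsub>A\<^esub> h b = (a \<ominus>\<^bsub>A\<^esub> h b0) \<oplus>\<^bsub>A\<^esub> \<ominus>\<^bsub>A\<^esub> h b1"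
      unfolding b01(3) hD(3)[OF c(4,5)] using c(1-3) by algebra
    then have "a \<ominus>\<^bsub>A\<^esub> h b0 \<in> J"
      using A.graded_decomp(1)[of "a \<ominus>\<^bsub>A\<^esub> h b0" "\<ominus>\<^bsub>A\<^esub> h b1"] b(2) a(1) b01 hD(6,7)
      by (simp add: a_minus_def A.even_add A.even_minus A.odd_minus)
    then show ?thesis using a(2) b01(1) A.proj_eq_iff c by blast
  qed
  have rep_odd: "\<exists>b\<in>odd_part B. x = J +>\<^bsub>A\<^esub> h b" if x: "x \<in> odd_part QA" for x
  proof -
    obtain a where a: "a \<in> odd_part A" "x = J +>\<^bsub>A\<^esub> a" using x by (auto simp: qa)
    obtain b where b: "b \<in> carrier B" "a \<ominus>\<^bsub>A\<^esub> h b \<in> J" using surj A.odd_carrier[OF a(1)] by blast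
    obtain b0 b1 where b01: "b0 \<in> even_part B" "b1 \<in> odd_part B" "b = b0 \<oplus>\<^bsub>B\<^esub> b1"
      using B.even_odd_decomp[OF b(1)] by blast
    have c: "a \<in> carrier A" "h b0 \<in> carrier A" "h b1 \<in> carrier A" "b0 \<in> carrier B" "b1 \<in> carrier B"
      using a b01 hD(1) A.odd_carrier B.even_carrier B.odd_carrier by auto
    have "a \<ominus>\<^bsub>A\<^esub> h b = \<ominus>\<^bsub>A\<^esub> h b0 \<oplus>\<^bsub>A\<^esub> (a \<ominus>\<^bsub>A\<^esub> h b1)"
      unfolding b01(3) hD(3)[OF c(4,5)] using c(1-3) by algebra
    then have "a \<ominus>\<^bsub>A\<^esub> h b1 \<in> J"
      using A.graded_decomp(2)[of "\<ominus>\<^bsub>A\<^esub> h b0" "a \<ominus>\<^bsub>A\<^esub> h b1"] b(2) a(1) b01 hD(6,7)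
      by (simp add: a_minus_def A.odd_add A.odd_minus A.even_minus)
    then show ?thesis using a(2) b01(2) A.proj_eq_iff c by blast
  qed
  have "f \<in> superalg_hom QA QB"
    unfolding superalg_hom_def ring_hom_def
  proof (intro CollectI conjI ballI allI impI Pi_I subsetI)
    fix x assume "x \<in> carrier QA"
    then show "f x \<in> carrier QB" using rep[of x] f by (auto simp: qb)
  next
    fix x y assume xy: "x \<in> carrier QA \<and> y \<in> carrier QA"
    obtain b b' where b: "b \<in> carrier B" "b' \<in> carrier B" "x = J +>\<^bsub>A\<^esub> h b" "y = J +>\<^bsub>A\<^esub> h b'"
      using rep[OF conjunct1[OF xy]] rep[OF conjunct2[OF xy]] by blast
    show "f (x \<otimes>\<^bsub>QA\<^esub> y) = f x \<otimes>\<^bsub>QB\<^esub> f y"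
      by (simp only: b(3,4) f[OF b(1)] f[OF b(2)] qa(3)[OF hD(1)[OF b(1)] hD(1)[OF b(2)]] qb(3)[OF b(1,2)]
          hD(2)[OF b(1,2), symmetric] f[OF B.m_closed[OF b(1,2)]])
    show "f (x \<oplus>\<^bsub>QA\<^esub> y) = f x \<oplus>\<^bsub>QB\<^esub> f y"
      using f[OF b(1)] f[OF b(2)] f[OF B.add.m_closed[OF b(1,2)]] hD(1)[OF b(1)] hD(1)[OF b(2)]
        qa(2)[of "h b" "h b'"] qb(2)[OF b(1,2)] unfolding b(3,4) hD(3)[OF b(1,2)] by metis
  next
    show "f \<one>\<^bsub>QA\<^esub> = \<one>\<^bsub>QB\<^esub>" using f[of "\<one>\<^bsub>B\<^esub>"] by (simp add: qa qb hD(4))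
  next
    fix c x assume "x \<in> carrier QA"
    then obtain b where b: "b \<in> carrier B" "x = J +>\<^bsub>A\<^esub> h b" using rep by blast
    show "f (c \<odot>\<^bsub>QA\<^esub> x) = c \<odot>\<^bsub>QB\<^esub> f x"
      using f[OF b(1)] f[OF B.smult_closed[OF b(1), of c]] qa(6)[OF hD(1)[OF b(1)], of c]
        qb(6)[OF b(1), of c] unfolding b(2) hD(5)[OF b(1)] by metis
  next
    fix z assume "z \<in> f ` even_part QA"
    then show "z \<in> even_part QB" using rep_even f B.even_carrier by (force simp: qb)
  next
    fix z assume "z \<in> f ` odd_part QA"
    then show "z \<in> odd_part QB" using rep_odd f B.odd_carrier by (force simp: qb)
  qed
  moreover have "bij_betw f (carrier QA) (carrier QB)"
  proof (rule bij_betw_imageI)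
    show "inj_on f (carrier QA)"
    proof (rule inj_onI)
      fix x y assume xy: "x \<in> carrier QA" "y \<in> carrier QA" "f x = f y"
      obtain b b' where b: "b \<in> carrier B" "b' \<in> carrier B" "x = J +>\<^bsub>A\<^esub> h b" "y = J +>\<^bsub>A\<^esub> h b'"
        using rep[OF xy(1)] rep[OF xy(2)] by blast
      have "I +>\<^bsub>B\<^esub> b = I +>\<^bsub>B\<^esub> b'" using xy(3) f[OF b(1)] f[OF b(2)] unfolding b(3,4) by simp
      then have "b \<ominus>\<^bsub>B\<^esub> b' \<in> I" using B.proj_eq_iff[OF b(1,2)] by simp
      then have "h b \<ominus>\<^bsub>A\<^esub> h b' \<in> J"
        using IJ[of "b \<ominus>\<^bsub>B\<^esub> b'"] b(1,2) superalg_hom_diff[OF h B A b(1,2)] by simp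
      then show "x = y" using A.proj_eq_iff[OF hD(1)[OF b(1)] hD(1)[OF b(2)]] b(3,4) by simp
    qed
    show "f ` carrier QA = carrier QB"
    proof
      show "f ` carrier QA \<subseteq> carrier QB" using rep f by (force simp: qb)
      show "carrier QB \<subseteq> f ` carrier QA"
      proof
        fix y assume "y \<in> carrier QB"
        then obtain b where b: "b \<in> carrier B" "y = I +>\<^bsub>B\<^esub> b" by (auto simp: qb)
        then show "y \<in> f ` carrier QA" using f[of b] hD(1)[of b] by (force simp: qa)
      qed
    qed
  qed
  ultimately show ?thesis unfolding superalg_isomorphic_def superalg_iso_def QA_def QB_def by blast
qed

text \<open>
  Surjectivity on \<open>M/M\<^sup>2\<close> gives surjectivity on every \<open>M\<^sup>n/M\<^sup>n\<^sup>+\<^sup>1\<close>, because \<open>M\<^sup>n\<close> is generated by products: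
  if \<open>i\<close> and \<open>j\<close> are approximated by \<open>h u\<close> and \<open>h v\<close>, then \<open>i j\<close> is approximated by \<open>h (u v)\<close>
  one order better. The successive corrections add up to an approximation modulo \<open>M\<^sup>n\<close>.
\<close>

lemma surj_modulo_ideal_power:
  fixes A :: "('k::field, 'a) superalg" and B :: "('k, 'b) superalg"
  assumes A: "superalgebra A" and B: "superalgebra B" and h: "h \<in> superalg_hom B A"
    and M: "ideal M A" and I: "ideal I B" and IM: "h ` I \<subseteq> M"
    and codim: "\<And>a. a \<in> carrier A \<Longrightarrow> \<exists>c. a \<ominus>\<^bsub>A\<^esub> c \<odot>\<^bsub>A\<^esub> \<one>\<^bsub>A\<^esub> \<in> M"
    and cotangent: "\<And>m. m \<in> M \<Longrightarrow> \<exists>b\<in>I. m \<ominus>\<^bsub>A\<^esub> h b \<in> ideal_power A M 2"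
    and a: "a \<in> carrier A"
  shows "\<exists>b\<in>carrier B. a \<ominus>\<^bsub>A\<^esub> h b \<in> ideal_power A M n"
proof -
  interpret A: superalg A by (rule superalgI) fact
  interpret B: superalg B by (rule superalgI) fact
  interpret M: ideal M A by fact
  interpret I: ideal I B by fact
  note hD = superalg_homD[OF h]
  note MP = A.ideal_ideal_power[OF M] and IP = B.ideal_ideal_power[OF I]
  note carr = ideal.Icarr[OF MP] and Icarr = ideal.Icarr[OF IP]
  note Madd = additive_subgroup.a_closed[OF ideal.axioms(1)[OF MP]]
  note Iadd = additive_subgroup.a_closed[OF ideal.axioms(1)[OF IP]]
  have pow_step: "\<exists>b\<in>ideal_power B I n. m \<ominus>\<^bsub>A\<^esub> h b \<in> ideal_power A M (Suc n)"
    if "m \<in> ideal_power A M n" for m n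
    using that
  proof (induction n arbitrary: m)
    case 0
    then obtain c where c: "m \<ominus>\<^bsub>A\<^esub> c \<odot>\<^bsub>A\<^esub> \<one>\<^bsub>A\<^esub> \<in> M" using codim by auto
    have "h (c \<odot>\<^bsub>B\<^esub> \<one>\<^bsub>B\<^esub>) = c \<odot>\<^bsub>A\<^esub> \<one>\<^bsub>A\<^esub>" using hD(4,5) by simp
    then show ?case using c A.ideal_power_1[OF M] by (intro bexI[of _ "c \<odot>\<^bsub>B\<^esub> \<one>\<^bsub>B\<^esub>"]) simp_all
  next
    case (Suc n)
    have "m \<in> ideal_power A M n \<cdot>\<^bsub>A\<^esub> M" using Suc.prems by simp
    then show ?case
    proof induction
      case (prod i j)
      obtain u where u: "u \<in> ideal_power B I n" "i \<ominus>\<^bsub>A\<^esub> h u \<in> ideal_power A M (Suc n)"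
        using Suc.IH[OF prod(1)] by blast
      obtain v where v: "v \<in> I" "j \<ominus>\<^bsub>A\<^esub> h v \<in> ideal_power A M 2" using cotangent[OF prod(2)] by blast
      have c: "i \<in> carrier A" "j \<in> carrier A" "h u \<in> carrier A" "h v \<in> carrier A" "u \<in> carrier B" "v \<in> carrier B"
        using prod u v carr Icarr M.Icarr I.Icarr hD(1) by auto
      have "i \<otimes>\<^bsub>A\<^esub> j \<ominus>\<^bsub>A\<^esub> h (u \<otimes>\<^bsub>B\<^esub> v)
          = (i \<ominus>\<^bsub>A\<^esub> h u) \<otimes>\<^bsub>A\<^esub> j \<oplus>\<^bsub>A\<^esub> h u \<otimes>\<^bsub>A\<^esub> (j \<ominus>\<^bsub>A\<^esub> h v)"
        unfolding hD(2)[OF c(5,6)] using c(1-4) by algebra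
      moreover have "(i \<ominus>\<^bsub>A\<^esub> h u) \<otimes>\<^bsub>A\<^esub> j \<in> ideal_power A M (Suc n + Suc 0)"
        using u(2) prod(2) A.ideal_power_1[OF M] by (intro A.ideal_power_mult[OF M]) auto
      moreover have "h u \<otimes>\<^bsub>A\<^esub> (j \<ominus>\<^bsub>A\<^esub> h v) \<in> ideal_power A M (n + 2)"
        using superalg_hom_ideal_power[OF h B I IM u(1)] v(2) by (intro A.ideal_power_mult[OF M])
      ultimately have "i \<otimes>\<^bsub>A\<^esub> j \<ominus>\<^bsub>A\<^esub> h (u \<otimes>\<^bsub>B\<^esub> v) \<in> ideal_power A M (Suc (Suc n))"
        using Madd[of _ "Suc (Suc n)"] by (simp only: add_Suc_right add_Suc add_0_right numeral_2_eq_2)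
      moreover have "u \<otimes>\<^bsub>B\<^esub> v \<in> ideal_power B I (Suc n)"
        unfolding ideal_power_Suc using u(1) v(1) by (rule ideal_prod.prod)
      ultimately show ?case by blast
    next
      case (sum s1 s2)
      then obtain b1 b2 where b: "b1 \<in> ideal_power B I (Suc n)" "s1 \<ominus>\<^bsub>A\<^esub> h b1 \<in> ideal_power A M (Suc (Suc n))"
        "b2 \<in> ideal_power B I (Suc n)" "s2 \<ominus>\<^bsub>A\<^esub> h b2 \<in> ideal_power A M (Suc (Suc n))" by blast
      have bc: "b1 \<in> carrier B" "b2 \<in> carrier B" using b Icarr by blast+
      have hc: "h b1 \<in> carrier A" "h b2 \<in> carrier A" using hD(1) bc by auto
      have "s1 \<in> ideal_power A M (Suc n)" "s2 \<in> ideal_power A M (Suc n)"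
        unfolding ideal_power_Suc using sum.hyps by blast+
      then have sc: "s1 \<in> carrier A" "s2 \<in> carrier A" using carr by blast+
      have "s1 \<oplus>\<^bsub>A\<^esub> s2 \<ominus>\<^bsub>A\<^esub> h (b1 \<oplus>\<^bsub>B\<^esub> b2) = (s1 \<ominus>\<^bsub>A\<^esub> h b1) \<oplus>\<^bsub>A\<^esub> (s2 \<ominus>\<^bsub>A\<^esub> h b2)"
        unfolding hD(3)[OF bc] using hc sc by algebra
      then show ?case using Madd[OF b(2,4)] Iadd[OF b(1,3)] by (intro bexI[of _ "b1 \<oplus>\<^bsub>B\<^esub> b2"]) simp_all
    qed
  qed
  show ?thesis
  proof (induction n)
    case 0
    then show ?case using a hD(1) by (intro bexI[of _ "\<zero>\<^bsub>B\<^esub>"]) auto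
  next
    case (Suc n)
    then obtain b where b: "b \<in> carrier B" "a \<ominus>\<^bsub>A\<^esub> h b \<in> ideal_power A M n" by blast
    obtain u where u: "u \<in> ideal_power B I n" "a \<ominus>\<^bsub>A\<^esub> h b \<ominus>\<^bsub>A\<^esub> h u \<in> ideal_power A M (Suc n)"
      using pow_step[OF b(2)] by blast
    have c: "u \<in> carrier B" "h u \<in> carrier A" "h b \<in> carrier A" using Icarr[OF u(1)] b hD(1) by auto
    have "a \<ominus>\<^bsub>A\<^esub> h (b \<oplus>\<^bsub>B\<^esub> u) = a \<ominus>\<^bsub>A\<^esub> h b \<ominus>\<^bsub>A\<^esub> h u"
      unfolding hD(3)[OF b(1) c(1)] using a c(2,3) by algebra
    then show ?case using u(2) b(1) c(1) by (intro bexI[of _ "b \<oplus>\<^bsub>B\<^esub> u"]) simp_all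
  qed
qed

section \<open>Functionals on a quotient\<close>

text \<open>
  The homomorphism is the projection onto the quotient, and the functional on the quotient
  is \<open>v\<close> on representatives.
\<close>

lemma functional_factors_through_quotient:
  fixes A :: "('k::field, 'a) superalg"
  assumes A: "superalgebra A" and J: "graded_ideal J A"
    and v: "v \<in> dual A" and vJ: "\<And>a. a \<in> J \<Longrightarrow> v a = 0"
  shows "\<exists>h\<in>superalg_hom A (quotient_superalg A J). \<exists>w\<in>dual (quotient_superalg A J).
    v = compose (carrier A) w h"
proof -
  interpret superalg A by (rule superalgI) fact
  interpret superalg_quotient A J "quotient_superalg A J" by unfold_locales (rule J)
  define Q where "Q = quotient_superalg A J"
  note q = quotient_carrier quotient_add quotient_mult quotient_one quotient_zero quotient_smult
    quotient_even quotient_odd proj_hom proj_eq_iff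
  note q = q[folded Q_def]
  have vadd: "v (a \<oplus>\<^bsub>A\<^esub> b) = v a + v b" if "a \<in> carrier A" "b \<in> carrier A" for a b
    using v that unfolding dual_def by blast
  have vsm: "v (c \<odot>\<^bsub>A\<^esub> a) = c * v a" if "a \<in> carrier A" for a c
    using v that unfolding dual_def by blast
  have v_cong: "v a = v b" if "a \<in> carrier A" "b \<in> carrier A" "J +>\<^bsub>A\<^esub> a = J +>\<^bsub>A\<^esub> b" for a b
  proof -
    have "a = (a \<ominus>\<^bsub>A\<^esub> b) \<oplus>\<^bsub>A\<^esub> b" using that(1,2) by algebra
    then have "v a = v (a \<ominus>\<^bsub>A\<^esub> b) + v b" using that(1,2) vadd[of "a \<ominus>\<^bsub>A\<^esub> b" b] by simp
    then show ?thesis using that q vJ by simp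
  qed
  define w where "w = (\<lambda>C\<in>carrier Q. v (SOME a. a \<in> carrier A \<and> C = J +>\<^bsub>A\<^esub> a))"
  have w: "w (J +>\<^bsub>A\<^esub> a) = v a" if a: "a \<in> carrier A" for a
  proof -
    have "\<exists>b. b \<in> carrier A \<and> J +>\<^bsub>A\<^esub> a = J +>\<^bsub>A\<^esub> b" using a by blast
    from someI_ex[OF this] have "v (SOME b. b \<in> carrier A \<and> J +>\<^bsub>A\<^esub> a = J +>\<^bsub>A\<^esub> b) = v a"
      using a by (intro v_cong) auto
    then show ?thesis using a by (simp add: w_def q)
  qed
  have "w \<in> dual Q"
    unfolding dual_def
  proof (intro CollectI conjI ballI allI)
    show "w \<in> carrier Q \<rightarrow>\<^sub>E UNIV" by (simp add: w_def)
    show "w (x \<oplus>\<^bsub>Q\<^esub> y) = w x + w y" if "x \<in> carrier Q" "y \<in> carrier Q" for x y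
      using that by (auto simp: q w vadd)
    show "w (c \<odot>\<^bsub>Q\<^esub> x) = c * w x" if "x \<in> carrier Q" for c x
      using that by (auto simp: q w vsm)
  qed
  moreover have "v = compose (carrier A) w (\<lambda>a. J +>\<^bsub>A\<^esub> a)"
  proof
    fix a
    show "v a = compose (carrier A) w (\<lambda>a. J +>\<^bsub>A\<^esub> a) a"
      using v by (cases "a \<in> carrier A") (auto simp: compose_def w dual_def PiE_def extensional_def)
  qed
  ultimately show ?thesis using q(9) unfolding Q_def by blast
qed

lemma functional_compose_hom:
  assumes h: "h \<in> superalg_hom S A" and S: "superalgebra S" and w: "w \<in> dual A"
  shows "compose (carrier S) w h \<in> dual S"
proof -
  interpret S: superalg S by (rule superalgI) fact
  show ?thesis using w superalg_homD[OF h]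
    unfolding dual_def by (auto simp: compose_def)
qed

lemma dual_zero:
  assumes "superalgebra A" "w \<in> dual A"
  shows "w \<zero>\<^bsub>A\<^esub> = 0"
proof -
  interpret superalg A by (rule superalgI) fact
  have "w (0 \<odot>\<^bsub>A\<^esub> \<zero>\<^bsub>A\<^esub>) = 0 * w \<zero>\<^bsub>A\<^esub>"
    using assms(2) zero_closed unfolding dual_def by blast
  then show ?thesis by simp
qed

section \<open>Grassmann multiplication over a commutative ring\<close>

definition shuffle_sign :: "nat set \<Rightarrow> nat set \<Rightarrow> 'r::comm_ring_1" where
  "shuffle_sign J K = (- 1) ^ inversions J K"

text \<open>
  The product of the Grassmann algebra over a commutative ring that is a type. A ring homomorphism
  from a ring structure to such a ring carries the product of the structure to this one
  (see \<open>grassmann_mult_eval\<close>).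
\<close>

definition gmult :: "(nat set \<Rightarrow> 'r::comm_ring_1) \<Rightarrow> (nat set \<Rightarrow> 'r) \<Rightarrow> nat set \<Rightarrow> 'r" where
  "gmult f g I = (\<Sum>J\<in>Pow I. shuffle_sign J (I - J) * f J * g (I - J))"

lemma finite_inversions: "finite J \<Longrightarrow> finite K \<Longrightarrow> finite {(j, k). j \<in> J \<and> k \<in> K \<and> k < j}"
  by (rule finite_subset[of _ "J \<times> K"]) auto

lemma inversions_empty [simp]: "inversions {} K = 0" "inversions J {} = 0"
  by (simp_all add: inversions_def)

lemma inversions_Un_left:
  assumes "finite J" "finite K" "finite L" "J \<inter> K = {}"
  shows "inversions (J \<union> K) L = inversions J L + inversions K L"
proof -
  have "{(j, k). j \<in> J \<union> K \<and> k \<in> L \<and> k < j} =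
      {(j, k). j \<in> J \<and> k \<in> L \<and> k < j} \<union> {(j, k). j \<in> K \<and> k \<in> L \<and> k < j}" by auto
  then show ?thesis
    using assms unfolding inversions_def by (auto intro!: card_Un_disjoint finite_inversions)
qed

lemma inversions_Un_right:
  assumes "finite J" "finite K" "finite L" "J \<inter> K = {}"
  shows "inversions L (J \<union> K) = inversions L J + inversions L K"
proof -
  have "{(j, k). j \<in> L \<and> k \<in> J \<union> K \<and> k < j} =
      {(j, k). j \<in> L \<and> k \<in> J \<and> k < j} \<union> {(j, k). j \<in> L \<and> k \<in> K \<and> k < j}" by auto
  then show ?thesis
    using assms unfolding inversions_def by (auto intro!: card_Un_disjoint finite_inversions)
qed

text \<open>Each pair of distinct indices is an inversion in exactly one of the two orders.\<close>

lemma inversions_swap: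
  assumes "finite J" "finite K" "J \<inter> K = {}"
  shows "inversions J K + inversions K J = card J * card K"
proof -
  have "inversions K J = card (prod.swap ` {(j, k). j \<in> K \<and> k \<in> J \<and> k < j})"
    unfolding inversions_def by (simp add: card_image)
  also have "prod.swap ` {(j, k). j \<in> K \<and> k \<in> J \<and> k < j} = {(j, k). j \<in> J \<and> k \<in> K \<and> j < k}"
    by (auto simp: image_iff)
  finally have 1: "inversions K J = card {(j, k). j \<in> J \<and> k \<in> K \<and> j < k}" .
  have "J \<times> K = {(j, k). j \<in> J \<and> k \<in> K \<and> k < j} \<union> {(j, k). j \<in> J \<and> k \<in> K \<and> j < k}"
    using assms(3) by auto
  moreover have "finite {(j, k). j \<in> J \<and> k \<in> K \<and> j < k}"
    by (rule finite_subset[of _ "J \<times> K"]) (use assms in auto)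
  moreover have "{(j, k). j \<in> J \<and> k \<in> K \<and> k < j} \<inter> {(j, k). j \<in> J \<and> k \<in> K \<and> j < k} = {}" by auto
  ultimately have "card (J \<times> K) = card {(j, k). j \<in> J \<and> k \<in> K \<and> k < j} + card {(j, k). j \<in> J \<and> k \<in> K \<and> j < k}"
    using finite_inversions[OF assms(1,2)] by (simp only: card_Un_disjoint)
  then show ?thesis unfolding 1 by (simp add: inversions_def card_cartesian_product)
qed

lemma shuffle_sign_swap:
  assumes "finite J" "finite K" "J \<inter> K = {}"
  shows "(shuffle_sign K J :: 'r::comm_ring_1) = (- 1) ^ (card J * card K) * shuffle_sign J K"
proof -
  have "(shuffle_sign J K * shuffle_sign J K :: 'r) = 1"
    by (simp add: shuffle_sign_def flip: power_add mult_2)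
  moreover have "(shuffle_sign J K * shuffle_sign K J :: 'r) = (- 1) ^ (card J * card K)"
    unfolding shuffle_sign_def by (simp add: inversions_swap[OF assms] flip: power_add)
  ultimately show ?thesis by (metis mult.assoc mult.commute mult_1)
qed

text \<open>
  Both sides sum over the partitions of \<open>I\<close> into three blocks \<open>K\<close>, \<open>L\<close>, \<open>N\<close>, and both signs
  count the inversions between every two of the blocks, since inversions are additive in each argument.
\<close>

lemma gmult_assoc:
  assumes I: "finite I"
  shows "gmult (gmult f g) h I = gmult f (gmult g h) I"
proof -
  have "gmult (gmult f g) h I = (\<Sum>(J, K)\<in>Sigma (Pow I) Pow. shuffle_sign J (I - J) *
      (shuffle_sign K (J - K) * f K * g (J - K)) * h (I - J))"
    unfolding gmult_def using I
    by (subst sum.Sigma[symmetric]) (auto simp: sum_distrib_left sum_distrib_right finite_subset)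
  also have "\<dots> = (\<Sum>(K, L)\<in>Sigma (Pow I) (\<lambda>K. Pow (I - K)). shuffle_sign K (I - K) * f K *
      (shuffle_sign L (I - K - L) * g L * h (I - K - L)))"
  proof (rule sum.reindex_bij_witness[where i = "\<lambda>(K, L). (K \<union> L, K)" and j = "\<lambda>(J, K). (K, J - K)"])
    fix JK assume "JK \<in> Sigma (Pow I) Pow"
    then obtain J K where JK: "JK = (J, K)" "J \<subseteq> I" "K \<subseteq> J" by auto
    define L N where "L = J - K" and "N = I - J"
    have fin: "finite K" "finite L" "finite N" using JK I by (auto simp: L_def N_def intro: finite_subset)
    have eq: "J = K \<union> L" "I - K = L \<union> N" "I - K - L = N" "J - K = L" "I - J = N" and dis: "K \<inter> L = {}" "L \<inter> N = {}"
      using JK by (auto simp: L_def N_def)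
    have "shuffle_sign J N * shuffle_sign K L = (shuffle_sign K (L \<union> N) * shuffle_sign L N :: 'a)"
      unfolding eq(1) shuffle_sign_def
      by (simp add: inversions_Un_left inversions_Un_right fin dis power_add)
    then have "shuffle_sign J N * (shuffle_sign K L * f K * g L) * h N =
       shuffle_sign K (L \<union> N) * f K * (shuffle_sign L N * g L * h N)"
      by (simp add: mult_ac)
    then show "(case case JK of (J, K) \<Rightarrow> (K, J - K) of (K, L) \<Rightarrow> shuffle_sign K (I - K) * f K *
          (shuffle_sign L (I - K - L) * g L * h (I - K - L))) =
        (case JK of (J, K) \<Rightarrow> shuffle_sign J (I - J) * (shuffle_sign K (J - K) * f K * g (J - K)) * h (I - J))"
      unfolding JK prod.case eq(4) unfolding eq(3) unfolding eq(2,5) by simp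
  qed auto
  also have "\<dots> = gmult f (gmult g h) I"
    unfolding gmult_def using I
    by (subst sum.Sigma[symmetric]) (auto simp: sum_distrib_left sum_distrib_right finite_subset)
  finally show ?thesis .
qed

lemma gmult_one_left:
  assumes "finite I"
  shows "gmult (\<lambda>J. if J = {} then 1 else 0) f I = f I"
proof -
  have "gmult (\<lambda>J. if J = {} then 1 else 0) f I = (\<Sum>J\<in>Pow I. if J = {} then f I else 0)"
    unfolding gmult_def by (intro sum.cong) (auto simp: shuffle_sign_def)
  then show ?thesis using assms by simp
qed

lemma gmult_one_right:
  assumes "finite I"
  shows "gmult f (\<lambda>J. if J = {} then 1 else 0) I = f I"
proof -
  have "gmult f (\<lambda>J. if J = {} then 1 else 0) I = (\<Sum>J\<in>Pow I. if J = I then f I else 0)"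
    unfolding gmult_def by (intro sum.cong) (auto simp: shuffle_sign_def)
  then show ?thesis using assms by simp
qed

lemma gmult_add_left: "gmult (\<lambda>J. f J + g J) h I = gmult f h I + gmult g h I"
  and gmult_add_right: "gmult h (\<lambda>J. f J + g J) I = gmult h f I + gmult h g I"
  and gmult_scale_left: "gmult (\<lambda>J. c * f J) h I = c * gmult f h I"
  and gmult_scale_right: "gmult h (\<lambda>J. c * f J) I = c * gmult h f I"
  unfolding gmult_def
  by (simp_all add: algebra_simps sum.distrib sum_distrib_left)

lemma gmult_cong:
  assumes "\<And>J. J \<subseteq> I \<Longrightarrow> f J = f' J" "\<And>J. J \<subseteq> I \<Longrightarrow> g J = g' J"
  shows "gmult f g I = gmult f' g' I"
  unfolding gmult_def using assms by (intro sum.cong) auto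

lemma gmult_empty [simp]: "gmult f g {} = f {} * g {}"
  by (simp add: gmult_def shuffle_sign_def)

text \<open>
  Exchanging \<open>\<theta>\<^sub>J\<close> and \<open>\<theta>\<^sub>K\<close> costs the sign \<open>(-1)\<close> to the power \<open>card J * card K\<close>. If it is the same
  for all terms that occur, as it is for homogeneous factors, then it comes out of the sum.
\<close>

lemma gmult_swap:
  assumes I: "finite I" and s: "\<And>J. J \<subseteq> I \<Longrightarrow> f J \<noteq> 0 \<Longrightarrow> g (I - J) \<noteq> 0 \<Longrightarrow> (- 1) ^ (card J * card (I - J)) = s"
  shows "gmult f g I = s * gmult g f I"
proof -
  have "gmult f g I = (\<Sum>J\<in>Pow I. s * (shuffle_sign (I - J) J * g (I - J) * f J))"
    unfolding gmult_def
  proof (rule sum.cong)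
    fix J assume J: "J \<in> Pow I"
    show "shuffle_sign J (I - J) * f J * g (I - J) = s * (shuffle_sign (I - J) J * g (I - J) * f J)"
    proof (cases "f J = 0 \<or> g (I - J) = 0")
      case False
      then have e: "(- 1) ^ (card J * card (I - J)) = s" using s[of J] J by blast
      have f: "finite (I - J)" "finite J" "(I - J) \<inter> J = {}" using I J by (auto intro: finite_subset)
      show ?thesis
        using shuffle_sign_swap[OF f, where 'r = 'a] e by (simp add: mult_ac)
    qed auto
  qed simp
  also have "\<dots> = (\<Sum>J\<in>Pow I. s * (shuffle_sign J (I - J) * g J * f (I - J)))"
    by (rule sum.reindex_bij_witness[where i = "\<lambda>J. I - J" and j = "\<lambda>J. I - J"]) (auto simp: double_diff)
  finally show ?thesis unfolding gmult_def by (simp add: sum_distrib_left)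
qed

lemma gmult_single:
  assumes "finite I"
  shows "gmult (\<lambda>L. if L = J then u else 0) (\<lambda>L. if L = K then v else 0) I =
    (if J \<inter> K = {} \<and> I = J \<union> K then shuffle_sign J K * u * v else 0)"
proof -
  have "gmult (\<lambda>L. if L = J then u else 0) (\<lambda>L. if L = K then v else 0) I =
    (\<Sum>L\<in>Pow I. if L = J then (if I - J = K then shuffle_sign J K * u * v else 0) else 0)"
    unfolding gmult_def by (intro sum.cong) auto
  also have "\<dots> = (if J \<subseteq> I \<and> I - J = K then shuffle_sign J K * u * v else 0)"
    using assms by simp
  also have "(J \<subseteq> I \<and> I - J = K) \<longleftrightarrow> (J \<inter> K = {} \<and> I = J \<union> K)" by auto
  finally show ?thesis .
qed

lemma shuffle_sign_below:
  assumes "\<And>i. i \<in> J \<Longrightarrow> i < k"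
  shows "shuffle_sign J {k} = 1"
proof -
  have "{(j, l). j \<in> J \<and> l \<in> {k} \<and> l < j} = {}" using assms by force
  then show ?thesis by (simp only: shuffle_sign_def inversions_def card.empty power_0)
qed

lemma gmult_nonzeroD:
  assumes "gmult f g I \<noteq> 0"
  obtains J where "J \<subseteq> I" "f J \<noteq> 0" "g (I - J) \<noteq> 0"
proof -
  obtain J where "J \<in> Pow I" "shuffle_sign J (I - J) * f J * g (I - J) \<noteq> 0"
    using assms unfolding gmult_def by (metis (no_types, lifting) sum.neutral)
  then show ?thesis by (intro that[of J]) auto
qed

lemma finsum_ring_of_type_algebra:
  "finite S \<Longrightarrow> (\<Oplus>\<^bsub>(ring_of_type_algebra :: 'r::comm_ring_1 ring)\<^esub>i\<in>S. f i) = (\<Sum>i\<in>S. f i)"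
proof -
  interpret R: cring "ring_of_type_algebra :: 'r ring" by (rule cring_from_type_algebra)
  show "finite S \<Longrightarrow> ?thesis"
  proof (induction rule: finite_induct)
    case empty
    then show ?case by simp (simp add: ring_of_type_algebra_def)
  next
    case (insert x F)
    have "f \<in> F \<rightarrow> carrier (ring_of_type_algebra :: 'r ring)" "f x \<in> carrier (ring_of_type_algebra :: 'r ring)"
      by (simp_all add: ring_of_type_algebra_def)
    then show ?case using insert by (simp add: R.finsum_insert) (simp add: ring_of_type_algebra_def)
  qed
qed

section \<open>The Grassmann algebra of a commutative algebra\<close>

lemma grassmann_mult_closed:
  fixes R :: "('k, 'a) module" (structure)
  assumes R: "cring R" and f: "f \<in> carrier (grassmann R q)" and g: "g \<in> carrier (grassmann R q)"
  shows "f \<otimes>\<^bsub>grassmann R q\<^esub> g \<in> carrier (grassmann R q)"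
proof -
  interpret R: cring R by fact
  have fc: "f J \<in> carrier R" if "J \<subseteq> {..<q}" for J using f that by (auto simp: grassmann_def)
  have gc: "g J \<in> carrier R" if "J \<subseteq> {..<q}" for J using g that by (auto simp: grassmann_def)
  have "(\<Oplus>J\<in>Pow I. if even (inversions J (I - J)) then f J \<otimes> g (I - J) else \<ominus> (f J \<otimes> g (I - J))) \<in> carrier R"
    if "I \<subseteq> {..<q}" for I
  proof (intro R.finsum_closed Pi_I)
    fix J assume "J \<in> Pow I"
    then have "f J \<in> carrier R" "g (I - J) \<in> carrier R" using fc[of J] gc[of "I - J"] that by auto
    then show "(if even (inversions J (I - J)) then f J \<otimes> g (I - J) else \<ominus> (f J \<otimes> g (I - J))) \<in> carrier R"
      by simp
  qed
  then show ?thesis by (auto simp: grassmann_def)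
qed

text \<open>
  Applied to point evaluations of functions and to the identity on polynomials, this turns the
  structure-based product into sums and products in a type.
\<close>

lemma grassmann_mult_eval:
  fixes R :: "('k, 'a) module" (structure)
  assumes R: "cring R" and e: "e \<in> ring_hom R (ring_of_type_algebra :: 'r::comm_ring_1 ring)"
    and f: "f \<in> carrier (grassmann R q)" and g: "g \<in> carrier (grassmann R q)" and I: "I \<subseteq> {..<q}"
  shows "e ((f \<otimes>\<^bsub>grassmann R q\<^esub> g) I) = gmult (\<lambda>J. e (f J)) (\<lambda>J. e (g J)) I"
proof -
  interpret R: cring R by fact
  interpret e: ring_hom_cring R "ring_of_type_algebra :: 'r ring" e
    by (intro ring_hom_cringI ring_hom_ringI2 R cring_from_type_algebra R.ring_axioms ring_from_type_algebra e)
  have fc: "f J \<in> carrier R" if "J \<subseteq> {..<q}" for J using f that by (auto simp: grassmann_def)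
  have gc: "g J \<in> carrier R" if "J \<subseteq> {..<q}" for J using g that by (auto simp: grassmann_def)
  have finI: "finite I" using I finite_subset by blast
  have type: "x \<otimes>\<^bsub>ring_of_type_algebra\<^esub> y = x * y" "\<ominus>\<^bsub>ring_of_type_algebra\<^esub> x = - x" for x y :: 'r
  proof -
    show "x \<otimes>\<^bsub>ring_of_type_algebra\<^esub> y = x * y" by (simp add: ring_of_type_algebra_def)
    show "\<ominus>\<^bsub>ring_of_type_algebra\<^esub> x = - x"
      by (rule e.S.minus_equality) (simp_all add: ring_of_type_algebra_def)
  qed
  have "e ((f \<otimes>\<^bsub>grassmann R q\<^esub> g) I) = e (\<Oplus>J\<in>Pow I. if even (inversions J (I - J)) then f J \<otimes> g (I - J)
                else \<ominus> (f J \<otimes> g (I - J)))"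
    using I by (simp add: grassmann_def)
  also have "\<dots> = (\<Oplus>\<^bsub>ring_of_type_algebra\<^esub>J\<in>Pow I. e (if even (inversions J (I - J)) then f J \<otimes> g (I - J)
                else \<ominus> (f J \<otimes> g (I - J))))"
  proof -
    have "(\<lambda>J. if even (inversions J (I - J)) then f J \<otimes> g (I - J) else \<ominus> (f J \<otimes> g (I - J))) \<in> Pow I \<rightarrow> carrier R"
    proof (rule Pi_I)
      fix J assume "J \<in> Pow I"
      then have "f J \<in> carrier R" "g (I - J) \<in> carrier R" using fc[of J] gc[of "I - J"] I by auto
      then show "(if even (inversions J (I - J)) then f J \<otimes> g (I - J) else \<ominus> (f J \<otimes> g (I - J))) \<in> carrier R"
        by simp
    qed
    then show ?thesis by (simp only: e.hom_finsum o_def)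
  qed
  also have "\<dots> = (\<Sum>J\<in>Pow I. e (if even (inversions J (I - J)) then f J \<otimes> g (I - J)
                else \<ominus> (f J \<otimes> g (I - J))))"
    using finI by (intro finsum_ring_of_type_algebra) simp
  also have "\<dots> = gmult (\<lambda>J. e (f J)) (\<lambda>J. e (g J)) I"
    unfolding gmult_def
  proof (rule sum.cong)
    fix J assume J: "J \<in> Pow I"
    then have c: "f J \<in> carrier R" "g (I - J) \<in> carrier R" using fc[of J] gc[of "I - J"] I by auto
    then show "e (if even (inversions J (I - J)) then f J \<otimes> g (I - J) else \<ominus> (f J \<otimes> g (I - J))) =
      shuffle_sign J (I - J) * e (f J) * e (g (I - J))"
      by (auto simp: shuffle_sign_def type)
  qed simp
  finally show ?thesis .
qed

section \<open>The polynomial superalgebra\<close>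

lemma poly_algebra_mult_closed:
  "P \<in> carrier (poly_algebra p) \<Longrightarrow> Q \<in> carrier (poly_algebra p) \<Longrightarrow> P * Q \<in> carrier (poly_algebra p)"
proof -
  assume P: "P \<in> carrier (poly_algebra p)" and Q: "Q \<in> carrier (poly_algebra p)"
  have "Poly_Mapping.keys m \<subseteq> {..<p}" if m: "m \<in> Poly_Mapping.keys (P * Q)" for m
  proof -
    obtain a b where ab: "m = a + b" "a \<in> Poly_Mapping.keys P" "b \<in> Poly_Mapping.keys Q"
      using keys_mult[of P Q] m by blast
    then show ?thesis using keys_add[of a b] P Q by (auto simp: poly_algebra_def)
  qed
  then show ?thesis by (simp add: poly_algebra_def)
qed

lemma poly_algebra_add_closed:
  "P \<in> carrier (poly_algebra p) \<Longrightarrow> Q \<in> carrier (poly_algebra p) \<Longrightarrow> P + Q \<in> carrier (poly_algebra p)"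
  using keys_add[of P Q] by (auto simp: poly_algebra_def)

lemma poly_algebra_single_closed:
  "Poly_Mapping.keys m \<subseteq> {..<p} \<Longrightarrow> Poly_Mapping.single m c \<in> carrier (poly_algebra p)"
  by (simp add: poly_algebra_def)

lemma poly_algebra_zero_closed [simp]: "0 \<in> carrier (poly_algebra p)"
  and poly_algebra_one_closed [simp]: "1 \<in> carrier (poly_algebra p)"
  by (simp_all add: poly_algebra_def)

lemma poly_algebra_smult_closed:
  "P \<in> carrier (poly_algebra p) \<Longrightarrow> Poly_Mapping.single 0 c * P \<in> carrier (poly_algebra p)"
  by (intro poly_algebra_mult_closed poly_algebra_single_closed) auto

lemma poly_algebra_ops:
  "P \<otimes>\<^bsub>poly_algebra p\<^esub> Q = P * Q" "P \<oplus>\<^bsub>poly_algebra p\<^esub> Q = P + Q"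
  "\<one>\<^bsub>poly_algebra p\<^esub> = 1" "\<zero>\<^bsub>poly_algebra p\<^esub> = 0"
  "c \<odot>\<^bsub>poly_algebra p\<^esub> P = Poly_Mapping.single 0 c * P"
  by (simp_all add: poly_algebra_def)

lemma cring_poly_algebra: "cring (poly_algebra p :: ('k::field, _) module)"
proof (rule cringI)
  show "abelian_group (poly_algebra p :: ('k, _) module)"
  proof (rule abelian_groupI)
    fix P :: "(nat \<Rightarrow>\<^sub>0 nat) \<Rightarrow>\<^sub>0 'k" assume "P \<in> carrier (poly_algebra p)"
    then have "- P \<in> carrier (poly_algebra p)" by (simp add: poly_algebra_def keys_def)
    then show "\<exists>Q\<in>carrier (poly_algebra p). Q \<oplus>\<^bsub>poly_algebra p\<^esub> P = \<zero>\<^bsub>poly_algebra p\<^esub>"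
      by (intro bexI[of _ "- P"]) (simp_all add: poly_algebra_ops)
  qed (simp_all add: poly_algebra_ops poly_algebra_add_closed ac_simps)
  show "Group.comm_monoid (poly_algebra p :: ('k, _) module)"
    by (rule comm_monoidI) (simp_all add: poly_algebra_ops poly_algebra_mult_closed ac_simps)
qed (simp add: poly_algebra_ops distrib_right)

lemma poly_superalg_carrier:
  "P \<in> carrier (poly_superalg p q) \<longleftrightarrow> P \<in> Pow {..<q} \<rightarrow>\<^sub>E carrier (poly_algebra p)"
  by (simp add: poly_superalg_def grassmann_def)

lemma poly_superalg_coeff:
  "P \<in> carrier (poly_superalg p q) \<Longrightarrow> I \<subseteq> {..<q} \<Longrightarrow> P I \<in> carrier (poly_algebra p)"
  by (auto simp: poly_superalg_carrier)

lemma poly_superalg_eqI: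
  assumes "P \<in> carrier (poly_superalg p q)" "Q \<in> carrier (poly_superalg p q)"
    and "\<And>I. I \<subseteq> {..<q} \<Longrightarrow> P I = Q I"
  shows "P = Q"
  using assms by (intro PiE_ext[of P "Pow {..<q}" "\<lambda>_. carrier (poly_algebra p)" Q])
    (auto simp: poly_superalg_carrier)

lemma poly_superalg_add: "I \<subseteq> {..<q} \<Longrightarrow> (P \<oplus>\<^bsub>poly_superalg p q\<^esub> Q) I = P I + Q I"
  and poly_superalg_zero: "I \<subseteq> {..<q} \<Longrightarrow> \<zero>\<^bsub>poly_superalg p q\<^esub> I = 0"
  and poly_superalg_one: "I \<subseteq> {..<q} \<Longrightarrow> \<one>\<^bsub>poly_superalg p q\<^esub> I = (if I = {} then 1 else 0)"
  and poly_superalg_smult: "I \<subseteq> {..<q} \<Longrightarrow> (c \<odot>\<^bsub>poly_superalg p q\<^esub> P) I = Poly_Mapping.single 0 c * P I"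
  by (simp_all add: poly_superalg_def grassmann_def poly_algebra_ops)

lemma poly_superalg_mult_closed:
  "P \<in> carrier (poly_superalg p q) \<Longrightarrow> Q \<in> carrier (poly_superalg p q) \<Longrightarrow>
    P \<otimes>\<^bsub>poly_superalg p q\<^esub> Q \<in> carrier (poly_superalg p q)"
  unfolding poly_superalg_def by (rule grassmann_mult_closed[OF cring_poly_algebra])

lemma poly_superalg_mult:
  assumes "P \<in> carrier (poly_superalg p q)" "Q \<in> carrier (poly_superalg p q)" "I \<subseteq> {..<q}"
  shows "(P \<otimes>\<^bsub>poly_superalg p q\<^esub> Q) I = gmult P Q I"
proof -
  have "(\<lambda>x. x) \<in> ring_hom (poly_algebra p) ring_of_type_algebra"
    by (rule ring_hom_memI) (simp_all add: poly_algebra_ops, simp_all add: ring_of_type_algebra_def)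
  from grassmann_mult_eval[OF cring_poly_algebra this assms[unfolded poly_superalg_def]]
  show ?thesis by (simp add: poly_superalg_def)
qed

lemma poly_superalg_closed:
  "\<zero>\<^bsub>poly_superalg p q\<^esub> \<in> carrier (poly_superalg p q)"
  "\<one>\<^bsub>poly_superalg p q\<^esub> \<in> carrier (poly_superalg p q)"
  "P \<in> carrier (poly_superalg p q) \<Longrightarrow> Q \<in> carrier (poly_superalg p q) \<Longrightarrow>
     P \<oplus>\<^bsub>poly_superalg p q\<^esub> Q \<in> carrier (poly_superalg p q)"
  "P \<in> carrier (poly_superalg p q) \<Longrightarrow> c \<odot>\<^bsub>poly_superalg p q\<^esub> P \<in> carrier (poly_superalg p q)"
  by (auto simp: poly_superalg_def grassmann_def poly_algebra_ops
      intro!: poly_algebra_add_closed poly_algebra_smult_closed)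

lemma poly_superalg_even:
  "even_part (poly_superalg p q) =
     {P \<in> carrier (poly_superalg p q). \<forall>I\<subseteq>{..<q}. odd (card I) \<longrightarrow> P I = 0}"
  and poly_superalg_odd:
  "odd_part (poly_superalg p q) =
     {P \<in> carrier (poly_superalg p q). \<forall>I\<subseteq>{..<q}. even (card I) \<longrightarrow> P I = 0}"
  by (auto simp: poly_superalg_def grassmann_def poly_algebra_ops)

lemma superalgebra_poly_superalg: "superalgebra (poly_superalg p q :: ('k::field, _) superalg)"
proof -
  let ?A = "poly_superalg p q :: ('k, _) superalg"
  note ops = poly_superalg_add poly_superalg_zero poly_superalg_one poly_superalg_smult poly_superalg_mult
  note closed = poly_superalg_closed poly_superalg_mult_closed
  note eqI = poly_superalg_eqI[where p = p and q = q]
  note even = poly_superalg_even and odd = poly_superalg_odd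
  have fin: "finite I" if "I \<subseteq> {..<q}" for I using that finite_subset by blast
  have cong: "gmult P Q I = gmult P' Q' I"
    if "I \<subseteq> {..<q}" "\<And>J. J \<subseteq> {..<q} \<Longrightarrow> P J = P' J" "\<And>J. J \<subseteq> {..<q} \<Longrightarrow> Q J = Q' J"
    for P Q P' Q' :: "nat set \<Rightarrow> (nat \<Rightarrow>\<^sub>0 nat) \<Rightarrow>\<^sub>0 'k" and I
    using that by (intro gmult_cong) auto
  have r: "ring ?A"
  proof (rule ringI)
    show "abelian_group ?A"
    proof (rule abelian_groupI)
      fix P assume P: "P \<in> carrier ?A"
      show "\<exists>Q\<in>carrier ?A. Q \<oplus>\<^bsub>?A\<^esub> P = \<zero>\<^bsub>?A\<^esub>"
      proof (rule bexI)
        show "(-1) \<odot>\<^bsub>?A\<^esub> P \<oplus>\<^bsub>?A\<^esub> P = \<zero>\<^bsub>?A\<^esub>"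
          by (rule eqI) (simp_all add: ops closed P single_uminus)
      qed (rule closed(4)[OF P])
    qed (auto intro!: eqI simp: ops closed)
    show "Group.monoid ?A"
    proof (rule monoidI)
      fix P Q R assume PQR: "P \<in> carrier ?A" "Q \<in> carrier ?A" "R \<in> carrier ?A"
      show "P \<otimes>\<^bsub>?A\<^esub> Q \<otimes>\<^bsub>?A\<^esub> R = P \<otimes>\<^bsub>?A\<^esub> (Q \<otimes>\<^bsub>?A\<^esub> R)"
      proof (rule eqI)
        fix I assume I: "I \<subseteq> {..<q}"
        have "(P \<otimes>\<^bsub>?A\<^esub> Q \<otimes>\<^bsub>?A\<^esub> R) I = gmult (P \<otimes>\<^bsub>?A\<^esub> Q) R I" using PQR I by (simp add: ops closed)
        also have "\<dots> = gmult (gmult P Q) R I" using PQR I by (intro cong) (simp_all add: ops)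
        also have "\<dots> = gmult P (gmult Q R) I" by (rule gmult_assoc[OF fin[OF I]])
        also have "\<dots> = gmult P (Q \<otimes>\<^bsub>?A\<^esub> R) I" using PQR I by (intro cong) (simp_all add: ops)
        also have "\<dots> = (P \<otimes>\<^bsub>?A\<^esub> (Q \<otimes>\<^bsub>?A\<^esub> R)) I" using PQR I by (simp add: ops closed)
        finally show "(P \<otimes>\<^bsub>?A\<^esub> Q \<otimes>\<^bsub>?A\<^esub> R) I = (P \<otimes>\<^bsub>?A\<^esub> (Q \<otimes>\<^bsub>?A\<^esub> R)) I" .
      qed (simp_all add: closed PQR)
    next
      fix P assume P: "P \<in> carrier ?A"
      have one: "gmult \<one>\<^bsub>?A\<^esub> P I = P I" "gmult P \<one>\<^bsub>?A\<^esub> I = P I" if I: "I \<subseteq> {..<q}" for I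
      proof -
        have "gmult \<one>\<^bsub>?A\<^esub> P I = gmult (\<lambda>J. if J = {} then 1 else 0) P I"
          "gmult P \<one>\<^bsub>?A\<^esub> I = gmult P (\<lambda>J. if J = {} then 1 else 0) I"
          using I by (intro cong; simp add: ops)+
        then show "gmult \<one>\<^bsub>?A\<^esub> P I = P I" "gmult P \<one>\<^bsub>?A\<^esub> I = P I"
          using gmult_one_left[OF fin[OF I]] gmult_one_right[OF fin[OF I]] by simp_all
      qed
      show "\<one>\<^bsub>?A\<^esub> \<otimes>\<^bsub>?A\<^esub> P = P" "P \<otimes>\<^bsub>?A\<^esub> \<one>\<^bsub>?A\<^esub> = P"
        using P one by (auto intro!: eqI simp: ops(5) closed)
    qed (simp_all add: closed)
  next
    fix P Q R assume PQR: "P \<in> carrier ?A" "Q \<in> carrier ?A" "R \<in> carrier ?A"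
    have "gmult (P \<oplus>\<^bsub>?A\<^esub> Q) R I = gmult (\<lambda>J. P J + Q J) R I"
      "gmult R (P \<oplus>\<^bsub>?A\<^esub> Q) I = gmult R (\<lambda>J. P J + Q J) I" if I: "I \<subseteq> {..<q}" for I
      using I by (intro cong; simp add: ops)+
    then show "(P \<oplus>\<^bsub>?A\<^esub> Q) \<otimes>\<^bsub>?A\<^esub> R = P \<otimes>\<^bsub>?A\<^esub> R \<oplus>\<^bsub>?A\<^esub> Q \<otimes>\<^bsub>?A\<^esub> R"
      "R \<otimes>\<^bsub>?A\<^esub> (P \<oplus>\<^bsub>?A\<^esub> Q) = R \<otimes>\<^bsub>?A\<^esub> P \<oplus>\<^bsub>?A\<^esub> R \<otimes>\<^bsub>?A\<^esub> Q"
      using PQR by (auto intro!: eqI simp: ops(1,5) closed gmult_add_left gmult_add_right)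
  qed
  have m: "module (ring_of_type_algebra :: 'k ring) ?A"
  proof (rule moduleI)
    show "cring (ring_of_type_algebra :: 'k ring)" by (rule cring_from_type_algebra)
    show "abelian_group ?A" using r by (rule ring.is_abelian_group)
  qed (auto intro!: eqI simp: ops closed ring_of_type_algebra_def single_add algebra_simps mult_single mult.assoc[symmetric])
  interpret A: ring ?A by fact
  have scale: "gmult (c \<odot>\<^bsub>?A\<^esub> P) Q I = Poly_Mapping.single 0 c * gmult P Q I"
    "gmult P (c \<odot>\<^bsub>?A\<^esub> Q) I = Poly_Mapping.single 0 c * gmult P Q I" if I: "I \<subseteq> {..<q}" for c P Q I
  proof -
    have "gmult (c \<odot>\<^bsub>?A\<^esub> P) Q I = gmult (\<lambda>J. Poly_Mapping.single 0 c * P J) Q I"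
      "gmult P (c \<odot>\<^bsub>?A\<^esub> Q) I = gmult P (\<lambda>J. Poly_Mapping.single 0 c * Q J) I"
      using I by (intro cong; simp add: ops)+
    then show "gmult (c \<odot>\<^bsub>?A\<^esub> P) Q I = Poly_Mapping.single 0 c * gmult P Q I"
      "gmult P (c \<odot>\<^bsub>?A\<^esub> Q) I = Poly_Mapping.single 0 c * gmult P Q I"
      by (simp_all only: gmult_scale_left gmult_scale_right)
  qed
  have card_diff: "card I = card J + card (I - J)" if "I \<subseteq> {..<q}" "J \<subseteq> I" for I J :: "nat set"
    using that fin[of I] fin[of J] card_mono[of I J] by (simp add: card_Diff_subset)
  show ?thesis
  proof (rule superalgebraI[OF r m])
    show "(c \<odot>\<^bsub>?A\<^esub> P) \<otimes>\<^bsub>?A\<^esub> Q = c \<odot>\<^bsub>?A\<^esub> (P \<otimes>\<^bsub>?A\<^esub> Q)" "P \<otimes>\<^bsub>?A\<^esub> (c \<odot>\<^bsub>?A\<^esub> Q) = c \<odot>\<^bsub>?A\<^esub> (P \<otimes>\<^bsub>?A\<^esub> Q)"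
      if "P \<in> carrier ?A" "Q \<in> carrier ?A" for c P Q
      using that by (auto intro!: eqI simp: ops(4,5) closed scale)
  next
    fix P assume P: "P \<in> carrier ?A"
    let ?P0 = "\<lambda>I\<in>Pow {..<q}. if even (card I) then P I else 0"
    let ?P1 = "\<lambda>I\<in>Pow {..<q}. if odd (card I) then P I else 0"
    have c: "?P0 \<in> carrier ?A" "?P1 \<in> carrier ?A"
      using P poly_superalg_coeff[of P p q] by (auto simp: poly_superalg_carrier)
    then have "?P0 \<in> even_part ?A" "?P1 \<in> odd_part ?A" by (auto simp: even odd)
    moreover have "P = ?P0 \<oplus>\<^bsub>?A\<^esub> ?P1" by (rule eqI) (auto simp: P c closed ops)
    ultimately show "\<exists>a0\<in>even_part ?A. \<exists>a1\<in>odd_part ?A. P = a0 \<oplus>\<^bsub>?A\<^esub> a1" by blast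
  next
    fix P assume P: "P \<in> even_part ?A" "P \<in> odd_part ?A"
    then show "P = \<zero>\<^bsub>?A\<^esub>" by (intro eqI) (auto simp: even odd closed ops)
  next
    fix P Q assume PQ: "P \<in> even_part ?A" "Q \<in> even_part ?A"
    have "gmult P Q I = 0" if I: "I \<subseteq> {..<q}" "odd (card I)" for I
    proof (rule ccontr)
      assume "gmult P Q I \<noteq> 0"
      then obtain J where J: "J \<subseteq> I" "P J \<noteq> 0" "Q (I - J) \<noteq> 0" by (rule gmult_nonzeroD)
      have "J \<subseteq> {..<q}" "I - J \<subseteq> {..<q}" using J(1) I by auto
      then have "even (card J)" "even (card (I - J))" using J(2,3) PQ unfolding even odd by blast+
      then show False using card_diff[OF I(1) J(1)] I(2) by simp
    qed
    then show "P \<otimes>\<^bsub>?A\<^esub> Q \<in> even_part ?A" using PQ by (auto simp: even closed ops)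
  next
    fix P Q assume PQ: "P \<in> even_part ?A" "Q \<in> odd_part ?A"
    have "gmult P Q I = 0" if I: "I \<subseteq> {..<q}" "even (card I)" for I
    proof (rule ccontr)
      assume "gmult P Q I \<noteq> 0"
      then obtain J where J: "J \<subseteq> I" "P J \<noteq> 0" "Q (I - J) \<noteq> 0" by (rule gmult_nonzeroD)
      have "J \<subseteq> {..<q}" "I - J \<subseteq> {..<q}" using J(1) I by auto
      then have "even (card J)" "odd (card (I - J))" using J(2,3) PQ unfolding even odd by blast+
      then show False using card_diff[OF I(1) J(1)] I(2) by simp
    qed
    then show "P \<otimes>\<^bsub>?A\<^esub> Q \<in> odd_part ?A" using PQ by (auto simp: even odd closed ops)
  next
    fix P Q assume PQ: "P \<in> odd_part ?A" "Q \<in> odd_part ?A"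
    have "gmult P Q I = 0" if I: "I \<subseteq> {..<q}" "odd (card I)" for I
    proof (rule ccontr)
      assume "gmult P Q I \<noteq> 0"
      then obtain J where J: "J \<subseteq> I" "P J \<noteq> 0" "Q (I - J) \<noteq> 0" by (rule gmult_nonzeroD)
      have "J \<subseteq> {..<q}" "I - J \<subseteq> {..<q}" using J(1) I by auto
      then have "odd (card J)" "odd (card (I - J))" using J(2,3) PQ unfolding even odd by blast+
      then show False using card_diff[OF I(1) J(1)] I(2) by simp
    qed
    then show "P \<otimes>\<^bsub>?A\<^esub> Q \<in> even_part ?A" using PQ by (auto simp: even odd closed ops)
    have "gmult P Q I = (- 1) * gmult Q P I" if I: "I \<subseteq> {..<q}" for I
    proof (rule gmult_swap[OF fin[OF I]])
      fix J assume J: "J \<subseteq> I" "P J \<noteq> 0" "Q (I - J) \<noteq> 0"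
      have "J \<subseteq> {..<q}" "I - J \<subseteq> {..<q}" using J(1) I by auto
      then have "odd (card J)" "odd (card (I - J))" using J(2,3) PQ unfolding even odd by blast+
      then show "(- 1) ^ (card J * card (I - J)) = (- 1 :: (nat \<Rightarrow>\<^sub>0 nat) \<Rightarrow>\<^sub>0 'k)" by simp
    qed
    then have "P \<otimes>\<^bsub>?A\<^esub> Q \<oplus>\<^bsub>?A\<^esub> Q \<otimes>\<^bsub>?A\<^esub> P = \<zero>\<^bsub>?A\<^esub>"
      using PQ by (intro eqI) (auto simp: odd closed ops)
    then show "P \<otimes>\<^bsub>?A\<^esub> Q = \<ominus>\<^bsub>?A\<^esub> (Q \<otimes>\<^bsub>?A\<^esub> P)"
      using PQ A.minus_equality[of "P \<otimes>\<^bsub>?A\<^esub> Q" "Q \<otimes>\<^bsub>?A\<^esub> P"] by (simp add: odd)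
  next
    fix P Q assume PQ: "P \<in> even_part ?A" "Q \<in> carrier ?A"
    have "gmult P Q I = 1 * gmult Q P I" if I: "I \<subseteq> {..<q}" for I
    proof (rule gmult_swap[OF fin[OF I]])
      fix J assume J: "J \<subseteq> I" "P J \<noteq> 0" "Q (I - J) \<noteq> 0"
      have "J \<subseteq> {..<q}" "I - J \<subseteq> {..<q}" using J(1) I by auto
      then have "even (card J)" using J(2,3) PQ unfolding even odd by blast+
      then show "(- 1) ^ (card J * card (I - J)) = (1 :: (nat \<Rightarrow>\<^sub>0 nat) \<Rightarrow>\<^sub>0 'k)" by simp
    qed
    then show "P \<otimes>\<^bsub>?A\<^esub> Q = Q \<otimes>\<^bsub>?A\<^esub> P"
      using PQ by (intro eqI) (auto simp: even closed ops)
  qed (auto simp: even odd closed ops)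
qed

section \<open>Evaluating polynomials\<close>

definition monom_eval :: "nat \<Rightarrow> (nat \<Rightarrow>\<^sub>0 nat) \<Rightarrow> (nat \<Rightarrow> 'r::comm_ring_1) \<Rightarrow> 'r" where
  "monom_eval p m z = (\<Prod>i<p. z i ^ Poly_Mapping.lookup m i)"

definition poly_eval :: "nat \<Rightarrow> ((nat \<Rightarrow>\<^sub>0 nat) \<Rightarrow>\<^sub>0 'r) \<Rightarrow> (nat \<Rightarrow> 'r::comm_ring_1) \<Rightarrow> 'r" where
  "poly_eval p P z = (\<Sum>m\<in>Poly_Mapping.keys P. Poly_Mapping.lookup P m * monom_eval p m z)"

lemma monom_eval_add: "monom_eval p (m + n) z = monom_eval p m z * monom_eval p n z"
  by (simp add: monom_eval_def lookup_add power_add prod.distrib)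

lemma monom_eval_0 [simp]: "monom_eval p 0 z = 1"
  by (simp add: monom_eval_def)

lemma poly_eval_superset:
  assumes "finite S" "Poly_Mapping.keys P \<subseteq> S"
  shows "poly_eval p P z = (\<Sum>m\<in>S. Poly_Mapping.lookup P m * monom_eval p m z)"
  unfolding poly_eval_def using assms by (intro sum.mono_neutral_left) (auto simp: in_keys_iff)

lemma poly_eval_add: "poly_eval p (P + Q) z = poly_eval p P z + poly_eval p Q z"
proof -
  let ?S = "Poly_Mapping.keys P \<union> Poly_Mapping.keys Q"
  have "poly_eval p (P + Q) z = (\<Sum>m\<in>?S. Poly_Mapping.lookup (P + Q) m * monom_eval p m z)"
    by (intro poly_eval_superset keys_add) simp
  also have "\<dots> = (\<Sum>m\<in>?S. Poly_Mapping.lookup P m * monom_eval p m z) +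
      (\<Sum>m\<in>?S. Poly_Mapping.lookup Q m * monom_eval p m z)"
    by (simp add: lookup_add distrib_right sum.distrib)
  also have "\<dots> = poly_eval p P z + poly_eval p Q z"
    by (subst (1 2) poly_eval_superset[of ?S]) auto
  finally show ?thesis .
qed

lemma poly_eval_0 [simp]: "poly_eval p 0 z = 0"
  by (simp add: poly_eval_def)

lemma poly_eval_single [simp]: "poly_eval p (Poly_Mapping.single m c) z = c * monom_eval p m z"
  by (simp add: poly_eval_def)

lemma poly_eval_1 [simp]: "poly_eval p 1 z = 1"
  using poly_eval_single[of p 0 1 z] by simp

lemma poly_eval_sum: "poly_eval p (\<Sum>i\<in>S. f i) z = (\<Sum>i\<in>S. poly_eval p (f i) z)"
  by (induction S rule: infinite_finite_induct) (simp_all add: poly_eval_add)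

lemma poly_mapping_sum_single: "(\<Sum>m\<in>Poly_Mapping.keys P. Poly_Mapping.single m (Poly_Mapping.lookup P m)) = P"
  by (intro poly_mapping_eqI) (simp add: lookup_sum lookup_single when_def in_keys_iff)

lemma poly_eval_mult: "poly_eval p (P * Q) z = poly_eval p P z * poly_eval p Q z"
proof -
  let ?s = "\<lambda>P m. Poly_Mapping.single m (Poly_Mapping.lookup P m)"
  have "P * Q = (\<Sum>m\<in>Poly_Mapping.keys P. ?s P m) * (\<Sum>n\<in>Poly_Mapping.keys Q. ?s Q n)"
    by (simp only: poly_mapping_sum_single)
  also have "\<dots> = (\<Sum>m\<in>Poly_Mapping.keys P. \<Sum>n\<in>Poly_Mapping.keys Q.
      Poly_Mapping.single (m + n) (Poly_Mapping.lookup P m * Poly_Mapping.lookup Q n))"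
    by (simp add: sum_product mult_single)
  also have "poly_eval p \<dots> z = (\<Sum>m\<in>Poly_Mapping.keys P. \<Sum>n\<in>Poly_Mapping.keys Q.
      (Poly_Mapping.lookup P m * monom_eval p m z) * (Poly_Mapping.lookup Q n * monom_eval p n z))"
    by (simp add: poly_eval_sum monom_eval_add mult_ac)
  also have "\<dots> = poly_eval p P z * poly_eval p Q z"
    by (simp add: poly_eval_def sum_product)
  finally show ?thesis .
qed

lemma poly_eval_zero_point:
  assumes "P \<in> carrier (poly_algebra p)"
  shows "poly_eval p P (\<lambda>_. 0) = Poly_Mapping.lookup P 0"
proof -
  have "monom_eval p m (\<lambda>_. 0 :: 'a) = (if m = 0 then 1 else 0)" if "m \<in> Poly_Mapping.keys P" for m
  proof (cases "m = 0")
    case False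
    then obtain i where i: "Poly_Mapping.lookup m i \<noteq> 0" by (metis lookup_zero poly_mapping_eqI)
    then have "i \<in> Poly_Mapping.keys m" by (simp add: in_keys_iff)
    then have "i < p" using assms that unfolding poly_algebra_def by auto
    then show ?thesis using i False by (auto simp: monom_eval_def prod_zero_iff intro!: prod_zero bexI[of _ i])
  qed simp
  then have "poly_eval p P (\<lambda>_. 0) = (\<Sum>m\<in>Poly_Mapping.keys P. if m = 0 then Poly_Mapping.lookup P m else 0)"
    unfolding poly_eval_def by (intro sum.cong) auto
  also have "\<dots> = Poly_Mapping.lookup P 0" by (simp add: in_keys_iff)
  finally show ?thesis .
qed

section \<open>The ideal of polynomials without constant term\<close>

lemma poly_no_const_iff:
  "P \<in> poly_no_const p q \<longleftrightarrow> P \<in> carrier (poly_superalg p q) \<and> poly_eval p (P {}) (\<lambda>_. 0) = 0"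
  unfolding poly_no_const_def using poly_superalg_coeff[of P p q "{}"] by (auto simp: poly_eval_zero_point)

lemma graded_ideal_poly_no_const:
  "graded_ideal (poly_no_const p q) (poly_superalg p q :: ('k::field, _) superalg)"
proof -
  let ?A = "poly_superalg p q :: ('k, _) superalg"
  let ?N = "poly_no_const p q :: (nat set \<Rightarrow> (nat \<Rightarrow>\<^sub>0 nat) \<Rightarrow>\<^sub>0 'k) set"
  interpret A: superalg ?A by (rule superalgI[OF superalgebra_poly_superalg])
  have N: "ideal ?N ?A"
    by (rule A.idealI_superalg)
      (auto simp: poly_no_const_iff poly_superalg_zero poly_superalg_add poly_superalg_mult
        poly_eval_add poly_eval_mult)
  interpret N: ideal ?N ?A by fact
  have "?N = (?N \<inter> even_part ?A) <+>\<^bsub>?A\<^esub> (?N \<inter> odd_part ?A)"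
  proof
    show "?N \<subseteq> (?N \<inter> even_part ?A) <+>\<^bsub>?A\<^esub> (?N \<inter> odd_part ?A)"
    proof
      fix P assume P: "P \<in> ?N"
      then obtain P0 P1 where P01: "P0 \<in> even_part ?A" "P1 \<in> odd_part ?A" "P = P0 \<oplus>\<^bsub>?A\<^esub> P1"
        using A.even_odd_decomp[OF N.Icarr[OF P]] by blast
      have "P1 \<in> ?N" using P01(2) by (simp add: poly_no_const_iff poly_superalg_odd)
      moreover have "P0 \<in> ?N" using P P01 \<open>P1 \<in> ?N\<close> A.even_carrier
        by (simp add: poly_no_const_iff poly_superalg_add poly_eval_add)
      ultimately show "P \<in> (?N \<inter> even_part ?A) <+>\<^bsub>?A\<^esub> (?N \<inter> odd_part ?A)"
        using P01 unfolding set_add_def' by blast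
    qed
    show "(?N \<inter> even_part ?A) <+>\<^bsub>?A\<^esub> (?N \<inter> odd_part ?A) \<subseteq> ?N"
      using N.a_closed unfolding set_add_def' by blast
  qed
  then show ?thesis using N by (simp add: graded_ideal_def)
qed

text \<open>
  The element \<open>c t\<^sup>m \<theta>\<^sub>I\<close> of \<open>\<KK>[p|q]\<close>.
\<close>

definition super_monom :: "nat \<Rightarrow> 'k \<Rightarrow> (nat \<Rightarrow>\<^sub>0 nat) \<Rightarrow> nat set \<Rightarrow> nat set \<Rightarrow> (nat \<Rightarrow>\<^sub>0 nat) \<Rightarrow>\<^sub>0 'k::field" where
  "super_monom q c m I = (\<lambda>J\<in>Pow {..<q}. if J = I then Poly_Mapping.single m c else 0)"

definition total_degree :: "nat \<Rightarrow> (nat \<Rightarrow>\<^sub>0 nat) \<Rightarrow> nat" where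
  "total_degree p m = (\<Sum>i<p. Poly_Mapping.lookup m i)"

lemma super_monom_closed:
  "Poly_Mapping.keys m \<subseteq> {..<p} \<Longrightarrow> super_monom q c m I \<in> carrier (poly_superalg p q)"
  by (auto simp: super_monom_def poly_superalg_carrier intro!: poly_algebra_single_closed)

text \<open>
  Two products without a sign: in the first, the new odd variable comes after all the others.
\<close>

lemma super_monom_mult:
  assumes "Poly_Mapping.keys m \<subseteq> {..<p}" "Poly_Mapping.keys n \<subseteq> {..<p}"
  shows "I \<subseteq> {..<j} \<Longrightarrow> j < q \<Longrightarrow> super_monom q c m I \<otimes>\<^bsub>poly_superalg p q\<^esub> super_monom q d n {j} = super_monom q (c * d) (m + n) (insert j I)"
    and "I \<subseteq> {..<q} \<Longrightarrow> super_monom q c m I \<otimes>\<^bsub>poly_superalg p q\<^esub> super_monom q d n {} = super_monom q (c * d) (m + n) I"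
proof -
  have eval: "gmult (super_monom q c m I) (super_monom q d n K) L =
     (if I \<inter> K = {} \<and> L = I \<union> K then shuffle_sign I K * Poly_Mapping.single m c * Poly_Mapping.single n d else 0)"
    if L: "L \<subseteq> {..<q}" for K L
  proof -
    have "gmult (super_monom q c m I) (super_monom q d n K) L =
      gmult (\<lambda>J. if J = I then Poly_Mapping.single m c else 0) (\<lambda>J. if J = K then Poly_Mapping.single n d else 0) L"
      using L by (intro gmult_cong) (auto simp: super_monom_def)
    then show ?thesis using L finite_subset[OF L] by (simp add: gmult_single)
  qed
  show "super_monom q c m I \<otimes>\<^bsub>poly_superalg p q\<^esub> super_monom q d n {j} = super_monom q (c * d) (m + n) (insert j I)"
    if j: "I \<subseteq> {..<j}" "j < q"
  proof (rule poly_superalg_eqI[where p = p])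
    fix L assume L: "L \<subseteq> {..<q}"
    show "(super_monom q c m I \<otimes>\<^bsub>poly_superalg p q\<^esub> super_monom q d n {j}) L = super_monom q (c * d) (m + n) (insert j I) L"
    proof -
      have "shuffle_sign I {j} = (1 :: (nat \<Rightarrow>\<^sub>0 nat) \<Rightarrow>\<^sub>0 'a)" using j(1) by (intro shuffle_sign_below) auto
      moreover have "j \<notin> I" using j(1) by auto
      ultimately show ?thesis
        unfolding poly_superalg_mult[OF super_monom_closed[OF assms(1)] super_monom_closed[OF assms(2)] L] eval[OF L]
        using L by (simp add: mult_single super_monom_def)
    qed
  qed (use assms keys_add[of m n] in \<open>auto intro!: poly_superalg_mult_closed super_monom_closed\<close>)
  show "super_monom q c m I \<otimes>\<^bsub>poly_superalg p q\<^esub> super_monom q d n {} = super_monom q (c * d) (m + n) I"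
    if "I \<subseteq> {..<q}"
  proof (rule poly_superalg_eqI[where p = p])
    fix L assume L: "L \<subseteq> {..<q}"
    show "(super_monom q c m I \<otimes>\<^bsub>poly_superalg p q\<^esub> super_monom q d n {}) L = super_monom q (c * d) (m + n) I L"
      unfolding poly_superalg_mult[OF super_monom_closed[OF assms(1)] super_monom_closed[OF assms(2)] L] eval[OF L]
      using L by (simp add: mult_single super_monom_def shuffle_sign_def)
  qed (use assms keys_add[of m n] in \<open>auto intro!: poly_superalg_mult_closed super_monom_closed\<close>)
qed

text \<open>
  Every element is the sum of its own monomials; a property that is preserved by sums has to be
  checked only for those monomials, not for all.
\<close>

lemma poly_superalg_induct:
  assumes P: "P \<in> carrier (poly_superalg p q)" and zero: "\<zero>\<^bsub>poly_superalg p q\<^esub> \<in> Y"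
    and add: "\<And>Q R. Q \<in> Y \<Longrightarrow> R \<in> Y \<Longrightarrow> Q \<oplus>\<^bsub>poly_superalg p q\<^esub> R \<in> Y"
    and monom: "\<And>I m. I \<subseteq> {..<q} \<Longrightarrow> m \<in> Poly_Mapping.keys (P I) \<Longrightarrow> super_monom q (Poly_Mapping.lookup (P I) m) m I \<in> Y"
  shows "P \<in> Y"
proof -
  define T where "T = (SIGMA I:Pow {..<q}. Poly_Mapping.keys (P I))"
  define R where "R S = (\<lambda>J\<in>Pow {..<q}. \<Sum>(I, m)\<in>S. if J = I then Poly_Mapping.single m (Poly_Mapping.lookup (P I) m) else 0)" for S
  have T: "finite T" unfolding T_def by simp
  have "R S \<in> Y" if "S \<subseteq> T" for S
    using finite_subset[OF that T] that
  proof (induction rule: finite_induct)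
    case empty
    have "R {} = \<zero>\<^bsub>poly_superalg p q\<^esub>"
      by (auto simp: R_def poly_superalg_def grassmann_def poly_algebra_ops)
    then show ?case using zero by simp
  next
    case (insert Im S)
    obtain I m where Im: "Im = (I, m)" by (cases Im)
    have "R (insert Im S) = super_monom q (Poly_Mapping.lookup (P I) m) m I \<oplus>\<^bsub>poly_superalg p q\<^esub> R S"
      using insert(1,2) by (auto simp: R_def Im super_monom_def poly_superalg_def grassmann_def poly_algebra_ops restrict_def)
    moreover have "super_monom q (Poly_Mapping.lookup (P I) m) m I \<in> Y"
      using insert(4) by (intro monom) (auto simp: T_def Im)
    ultimately show ?case using insert add by auto
  qed
  moreover have "R T = P"
  proof (rule ext)
    fix J
    show "R T J = P J"
    proof (cases "J \<subseteq> {..<q}")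
      case True
      have "R T J = (\<Sum>I\<in>Pow {..<q}. \<Sum>m\<in>Poly_Mapping.keys (P I). if J = I then Poly_Mapping.single m (Poly_Mapping.lookup (P I) m) else 0)"
        using True unfolding R_def T_def by (simp add: sum.Sigma)
      also have "\<dots> = (\<Sum>I\<in>Pow {..<q}. if J = I then \<Sum>m\<in>Poly_Mapping.keys (P I). Poly_Mapping.single m (Poly_Mapping.lookup (P I) m) else 0)"
        by (intro sum.cong) auto
      also have "\<dots> = P J" using True by (simp add: poly_mapping_sum_single)
      finally show ?thesis .
    next
      case False
      then show ?thesis using P by (auto simp: R_def poly_superalg_carrier PiE_def extensional_def)
    qed
  qed
  ultimately show ?thesis by auto
qed

text \<open>
  A monomial is a product of as many variables as its degree, and each variable is in \<open>\<M>\<^sub>0\<close>.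
  The even variables are split off first; the odd ones are then added in increasing order.
\<close>

lemma super_monom_in_power:
  assumes m: "Poly_Mapping.keys m \<subseteq> {..<p}" and I: "I \<subseteq> {..<q}"
  shows "super_monom q (c :: 'a::field) m I \<in> ideal_power (poly_superalg p q) (poly_no_const p q) (total_degree p m + card I)"
proof -
  let ?A = "poly_superalg p q :: ('a, _) superalg"
  let ?N = "poly_no_const p q :: (nat set \<Rightarrow> (nat \<Rightarrow>\<^sub>0 nat) \<Rightarrow>\<^sub>0 'a) set"
  interpret A: superalg "?A" by (rule superalgI[OF superalgebra_poly_superalg])
  have even: "super_monom q c m {} \<in> ideal_power ?A ?N (total_degree p m)" if "Poly_Mapping.keys m \<subseteq> {..<p}" for m
    using that
  proof (induction "total_degree p m" arbitrary: m)
    case 0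
    then show ?case using super_monom_closed by simp
  next
    case (Suc d)
    then obtain i where i: "i < p" "Poly_Mapping.lookup m i \<noteq> 0"
      unfolding total_degree_def by (metis (mono_tags, lifting) lessThan_iff sum.neutral Zero_not_Suc)
    define n where "n = m - Poly_Mapping.single i 1"
    have mn: "m = n + Poly_Mapping.single i 1"
      using i(2) by (intro poly_mapping_eqI) (auto simp: n_def lookup_add lookup_minus lookup_single when_def)
    have n: "Poly_Mapping.keys n \<subseteq> {..<p}"
    proof -
      have "Poly_Mapping.keys n \<subseteq> Poly_Mapping.keys m" by (auto simp: n_def in_keys_iff lookup_minus)
      then show ?thesis using Suc.prems by blast
    qed
    have deg: "total_degree p m = Suc (total_degree p n)"
      using i(1) unfolding mn total_degree_def by (simp add: lookup_add sum.distrib lookup_single when_def)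
    then have IH: "super_monom q c n {} \<in> ideal_power ?A ?N (total_degree p n)"
      using Suc.hyps(1)[of n] Suc.hyps(2) n by simp
    have "Poly_Mapping.single i 1 \<noteq> (0 :: nat \<Rightarrow>\<^sub>0 nat)"
      by (metis lookup_single_eq lookup_zero one_neq_zero)
    then have "Poly_Mapping.lookup (super_monom q (1 :: 'a) (Poly_Mapping.single i 1) {} {}) 0 = 0"
      unfolding super_monom_def by (simp add: lookup_single_not_eq)
    then have "super_monom q 1 (Poly_Mapping.single i 1) {} \<in> ?N"
      unfolding poly_no_const_def using super_monom_closed[of "Poly_Mapping.single i 1" p q 1 "{}"] i(1) by simp
    then have "super_monom q c n {} \<otimes>\<^bsub>?A\<^esub> super_monom q 1 (Poly_Mapping.single i 1) {} \<in> ideal_power ?A ?N (Suc (total_degree p n))"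
      unfolding ideal_power_Suc using IH by (intro ideal_prod.prod)
    also have "super_monom q c n {} \<otimes>\<^bsub>?A\<^esub> super_monom q 1 (Poly_Mapping.single i 1) {} = super_monom q c m {}"
      using super_monom_mult(2)[of n p "Poly_Mapping.single i 1" "{}" q c 1] n i(1) mn by simp
    finally show ?case by (simp only: deg)
  qed
  show ?thesis
    using finite_subset[OF I finite_lessThan] I
  proof (induction I rule: finite_linorder_max_induct)
    case empty
    then show ?case using even[OF m] by simp
  next
    case (insert j I)
    have "super_monom q 1 0 {j} \<in> ?N"
      unfolding poly_no_const_def using super_monom_closed[of 0 p q 1 "{j}"]
      by (simp add: super_monom_def)
    then have "super_monom q c m I \<otimes>\<^bsub>?A\<^esub> super_monom q 1 0 {j} \<in> ideal_power ?A ?N (Suc (total_degree p m + card I))"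
      unfolding ideal_power_Suc using insert by (intro ideal_prod.prod) auto
    also have "super_monom q c m I \<otimes>\<^bsub>?A\<^esub> super_monom q 1 0 {j} = super_monom q c m (insert j I)"
      using super_monom_mult(1)[of m p 0 I j q c 1] m insert by (auto simp: subset_iff)
    finally show ?case using insert by (auto simp: card_insert_if)
  qed
qed

lemma poly_in_power:
  fixes P :: "nat set \<Rightarrow> (nat \<Rightarrow>\<^sub>0 nat) \<Rightarrow>\<^sub>0 'a::field"
  assumes P: "P \<in> carrier (poly_superalg p q)"
    and deg: "\<And>I m. I \<subseteq> {..<q} \<Longrightarrow> m \<in> Poly_Mapping.keys (P I) \<Longrightarrow> n \<le> total_degree p m + card I"
  shows "P \<in> ideal_power (poly_superalg p q) (poly_no_const p q) n"
proof -
  interpret A: superalg "poly_superalg p q :: ('a, _) superalg" by (rule superalgI[OF superalgebra_poly_superalg])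
  have N: "ideal (poly_no_const p q) (poly_superalg p q :: ('a, _) superalg)"
    using graded_ideal_poly_no_const by (auto simp: graded_ideal_def)
  interpret P: ideal "ideal_power (poly_superalg p q) (poly_no_const p q :: (_ \<Rightarrow> _ \<Rightarrow>\<^sub>0 'a) set) n" "poly_superalg p q"
    by (rule A.ideal_ideal_power[OF N])
  show ?thesis
  proof (rule poly_superalg_induct[OF P])
    fix I m assume I: "I \<subseteq> {..<q}" and m: "m \<in> Poly_Mapping.keys (P I)"
    have "Poly_Mapping.keys m \<subseteq> {..<p}"
      using poly_superalg_coeff[OF P I] m by (auto simp: poly_algebra_def)
    then have "super_monom q (Poly_Mapping.lookup (P I) m) m I
        \<in> ideal_power (poly_superalg p q) (poly_no_const p q) (total_degree p m + card I)"
      using super_monom_in_power I by blast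
    then show "super_monom q (Poly_Mapping.lookup (P I) m) m I \<in> ideal_power (poly_superalg p q) (poly_no_const p q) n"
      using A.ideal_power_antimono[OF N deg[OF I m]] by blast
  qed (auto intro: P.a_closed)
qed

section \<open>Coordinate space\<close>

definition polydisc :: "nat \<Rightarrow> (nat \<Rightarrow> 'k::real_normed_field) \<Rightarrow> real \<Rightarrow> (nat \<Rightarrow> 'k) set" where
  "polydisc p a r = PiE {..<p} (\<lambda>i. ball (a i) r)"

lemma topspace_coord_space [simp]: "topspace (coord_space p) = PiE {..<p} (\<lambda>_. UNIV)"
  by (simp add: coord_space_def)

lemma openin_polydisc: "openin (coord_space p) (polydisc p a r)"
proof -
  have "openin euclidean (ball (a i) r)" for i by simp
  then show ?thesis unfolding coord_space_def polydisc_def openin_PiE_gen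
    by (intro disjI2 conjI ballI finite_subset[OF _ finite_lessThan[of p]]) auto
qed

lemma polydisc_center: "a \<in> topspace (coord_space p) \<Longrightarrow> 0 < r \<Longrightarrow> a \<in> polydisc p a r"
  by (simp add: polydisc_def PiE_iff)

lemma polydisc_mono: "r \<le> s \<Longrightarrow> polydisc p a r \<subseteq> polydisc p a s"
  unfolding polydisc_def by (intro PiE_mono subset_ball) auto

lemma polydisc_subset_open:
  fixes U :: "(nat \<Rightarrow> 'k::real_normed_field) set"
  assumes "openin (coord_space p) U" "a \<in> U"
  obtains r where "0 < r" "polydisc p a r \<subseteq> U"
proof -
  have "\<exists>V. finite {i \<in> {..<p}. V i \<noteq> topspace euclidean} \<and> (\<forall>i\<in>{..<p}. openin euclidean (V i)) \<and>
      a \<in> PiE {..<p} V \<and> PiE {..<p} V \<subseteq> U"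
    using assms unfolding coord_space_def openin_product_topology_alt by blast
  then obtain V where "\<forall>i\<in>{..<p}. openin euclidean (V i)" and aV: "a \<in> PiE {..<p} V" "PiE {..<p} V \<subseteq> U"
    by blast
  then have V: "\<And>i. i < p \<Longrightarrow> open (V i)" "a \<in> PiE {..<p} V" "PiE {..<p} V \<subseteq> U" by simp_all
  have "\<exists>r>0. ball (a i) r \<subseteq> V i" if "i < p" for i
    using V(1)[OF that] V(2) that by (meson PiE_mem lessThan_iff open_contains_ball)
  then obtain r where r: "\<And>i. i < p \<Longrightarrow> 0 < r i \<and> ball (a i) (r i) \<subseteq> V i" by metis
  define s where "s = Min (insert 1 (r ` {..<p}))"
  have s: "0 < s" "\<And>i. i < p \<Longrightarrow> s \<le> r i" unfolding s_def using r by auto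
  have "polydisc p a s \<subseteq> PiE {..<p} V"
    unfolding polydisc_def
  proof (rule PiE_mono)
    fix i assume "i \<in> {..<p}"
    then show "ball (a i) s \<subseteq> V i" using r[of i] s(2)[of i] subset_ball[of s "r i" "a i"] by auto
  qed
  then show thesis using that[of s] s(1) V(3) by blast
qed

lemma polydisc_coord: "x \<in> polydisc p a r \<Longrightarrow> i < p \<Longrightarrow> x i \<in> ball (a i) r"
  using PiE_mem[of x "{..<p}" "\<lambda>i. ball (a i) r" i] by (simp add: polydisc_def)

lemma upd_in_polydisc:
  assumes "x \<in> polydisc p a r" "i < p"
  shows "x(i := t) \<in> polydisc p a r \<longleftrightarrow> t \<in> ball (a i) r"
  using assms by (auto simp: polydisc_def PiE_iff extensional_def)

lemma open_line_section:
  assumes U: "openin (coord_space p) U" and x: "x \<in> U" and i: "i < p"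
  shows "open {t. x(i := t) \<in> U}"
proof -
  have ext: "x \<in> PiE {..<p} (\<lambda>_. UNIV)" using openin_subset[OF U] x by auto
  have "continuous_map euclidean (coord_space p) (\<lambda>t. x(i := t))"
    unfolding coord_space_def continuous_map_componentwise
  proof (intro conjI ballI)
    show "(\<lambda>t. x(i := t)) ` topspace euclidean \<subseteq> extensional {..<p}"
      using ext i by (auto simp: extensional_def PiE_def)
    show "continuous_map euclidean euclidean (\<lambda>t. (x(i := t)) k)" if "k \<in> {..<p}" for k
      by (cases "k = i") (auto simp: continuous_on_id)
  qed
  from openin_continuous_map_preimage[OF this U] show ?thesis by simp
qed

lemma eventually_line_section:
  assumes U: "openin (coord_space p) U" and x: "x \<in> U" and i: "i < p"
  shows "eventually (\<lambda>t. x(i := t) \<in> U) (nhds (x i))"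
  using eventually_nhds_in_open[OF open_line_section[OF assms], of "x i"] x by simp

lemma continuous_map_coord_space_id:
  "continuous_map (coord_space p :: (nat \<Rightarrow> 'k::topological_space) topology) euclidean (\<lambda>x. x)"
proof -
  have "continuous_map (coord_space p) euclidean (\<lambda>x. x k :: 'k)" for k
  proof (cases "k < p")
    case True
    then show ?thesis unfolding coord_space_def
      using continuous_map_product_projection[of k "{..<p}" "\<lambda>_. euclidean"] by simp
  next
    case False
    then have u: "undefined = x k" if "x \<in> topspace (coord_space p)" for x :: "nat \<Rightarrow> 'k"
      using that by (auto simp: coord_space_def PiE_def extensional_def)
    show ?thesis by (rule continuous_map_eq[of _ _ "\<lambda>_. undefined"]) (use u in simp_all)
  qed
  then show ?thesis
    unfolding euclidean_product_topology[symmetric] continuous_map_componentwise_UNIV by simp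
qed

text \<open>
  The topology of coordinate space is the one induced by the topology of all functions, the
  values outside \<open>{..<p}\<close> being constant. This gives access to \<open>continuous_on\<close>.
\<close>

lemma continuous_map_coord_space_iff:
  fixes U :: "(nat \<Rightarrow> 'k::topological_space) set" and f :: "(nat \<Rightarrow> 'k) \<Rightarrow> 'b::topological_space"
  assumes U: "U \<subseteq> topspace (coord_space p)"
  shows "continuous_map (subtopology (coord_space p) U) euclidean f \<longleftrightarrow> continuous_on U f"
proof
  assume f: "continuous_map (subtopology (coord_space p) U) euclidean f"
  have "continuous_map (top_of_set U) (coord_space p) (\<lambda>x. x)"
    unfolding coord_space_def continuous_map_componentwise
  proof (intro conjI ballI)
    show "(\<lambda>x. x) ` topspace (top_of_set U) \<subseteq> extensional {..<p}" using U by (auto simp: PiE_def)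
    show "continuous_map (top_of_set U) euclidean (\<lambda>x. x k)" if "k \<in> {..<p}" for k
      unfolding continuous_map_iff_continuous
      by (rule continuous_on_product_then_coordinatewise[OF continuous_on_id])
  qed
  then have "continuous_map (top_of_set U) (subtopology (coord_space p) U) (\<lambda>x. x)"
    by (simp add: continuous_map_in_subtopology)
  from continuous_map_compose[OF this f] show "continuous_on U f"
    by (simp add: o_def)
next
  assume f: "continuous_on U f"
  have "continuous_map (subtopology (coord_space p) U) (top_of_set U) (\<lambda>x. x)"
    using continuous_map_from_subtopology[OF continuous_map_coord_space_id]
    by (auto simp: continuous_map_in_subtopology)
  moreover have "continuous_map (top_of_set U) euclidean f" using f by simp
  ultimately show "continuous_map (subtopology (coord_space p) U) euclidean f"
    using continuous_map_compose[of _ "top_of_set U" "\<lambda>x. x" euclidean f] by (simp add: o_def)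
qed

section \<open>Smooth functions\<close>

abbreviation pderivative :: "nat \<Rightarrow> ((nat \<Rightarrow> 'k) \<Rightarrow> 'k::real_normed_field) \<Rightarrow> (nat \<Rightarrow> 'k) \<Rightarrow> 'k" where
  "pderivative i f x \<equiv> deriv (\<lambda>t. f (x(i := t))) (x i)"

lemma Cr_on_cong_imp:
  assumes U: "openin (coord_space p) U"
  shows "Cr_on p r U f \<Longrightarrow> (\<And>x. x \<in> U \<Longrightarrow> f x = g x) \<Longrightarrow> Cr_on p r U g"
proof (induction r arbitrary: f g)
  case 0
  then show ?case by (auto intro: continuous_map_eq)
next
  case (Suc r)
  have ev: "eventually (\<lambda>t. f (x(i := t)) = g (x(i := t))) (nhds (x i))" if "x \<in> U" "i < p" for x i
    using eventually_line_section[OF U that] by eventually_elim (rule Suc.prems(2))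
  show ?case
    unfolding Cr_on.simps
  proof (intro conjI allI impI ballI)
    show "continuous_map (subtopology (coord_space p) U) euclidean g"
      using Suc.prems by (auto intro: continuous_map_eq)
    fix i assume i: "i < p"
    show "(\<lambda>t. g (x(i := t))) field_differentiable at (x i)" if x: "x \<in> U" for x
    proof -
      have "(\<lambda>t. f (x(i := t))) field_differentiable at (x i)" using Suc.prems(1) i x by simp
      then show ?thesis
        unfolding field_differentiable_def using DERIV_cong_ev[OF refl ev[OF x i] refl] by blast
    qed
    have "pderivative i f x = pderivative i g x" if "x \<in> U" for x
      using ev[OF that i] by (intro deriv_cong_ev) auto
    then show "Cr_on p r U (pderivative i g)"
      using Suc.IH[of "pderivative i f" "pderivative i g"] Suc.prems(1) i by simp
  qed
qed

lemma Cr_on_subset: "Cr_on p r U f \<Longrightarrow> V \<subseteq> U \<Longrightarrow> Cr_on p r V f"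
proof (induction r arbitrary: f)
  case 0
  then show ?case by (auto intro: continuous_map_from_subtopology_mono)
next
  case (Suc r)
  then show ?case by (auto intro: continuous_map_from_subtopology_mono)
qed

lemma Cr_on_SucD: "Cr_on p (Suc r) U f \<Longrightarrow> Cr_on p r U f"
  by (induction r arbitrary: f) auto

lemma Cr_on_const: "Cr_on p r U (\<lambda>x. c)"
  by (induction r arbitrary: c) auto

lemma Cr_on_coord: assumes "i < p" shows "Cr_on p r U (\<lambda>x. x i)"
proof -
  have c: "continuous_map (subtopology (coord_space p) U) euclidean (\<lambda>x. x i :: real)"
    unfolding coord_space_def using assms continuous_map_product_projection[of i "{..<p}" "\<lambda>_. euclidean"]
    by (intro continuous_map_from_subtopology) simp
  show ?thesis
  proof (cases r)
    case (Suc r')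
    have "pderivative j (\<lambda>x. x i :: real) = (\<lambda>x. if i = j then 1 else 0)" for j
      by (cases "i = j") (auto simp: fun_eq_iff)
    moreover have "(\<lambda>t. (x(j := t)) i) field_differentiable at (x j)" for j and x :: "nat \<Rightarrow> real"
      by (cases "i = j") auto
    moreover have "Cr_on p r' U (\<lambda>x. if i = j then 1 else 0)" for j by (rule Cr_on_const)
    ultimately show ?thesis unfolding Suc Cr_on.simps using c by metis
  qed (simp add: c)
qed

lemma Cr_on_add:
  assumes U: "openin (coord_space p) U"
  shows "Cr_on p r U f \<Longrightarrow> Cr_on p r U g \<Longrightarrow> Cr_on p r U (\<lambda>x. f x + g x)"
proof (induction r arbitrary: f g)
  case 0
  then show ?case by (auto intro: continuous_map_add)
next
  case (Suc r)
  have "Cr_on p r U (pderivative i (\<lambda>x. f x + g x))" if i: "i < p" for i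
  proof (rule Cr_on_cong_imp[OF U])
    show "Cr_on p r U (\<lambda>x. pderivative i f x + pderivative i g x)" using Suc i by simp
    show "pderivative i f x + pderivative i g x = pderivative i (\<lambda>x. f x + g x) x" if "x \<in> U" for x
      using Suc.prems i that by simp
  qed
  then show ?case using Suc.prems by (auto intro!: continuous_map_add field_differentiable_add)
qed

lemma Cr_on_mult:
  assumes U: "openin (coord_space p) U"
  shows "Cr_on p r U f \<Longrightarrow> Cr_on p r U g \<Longrightarrow> Cr_on p r U (\<lambda>x. f x * g x)"
proof (induction r arbitrary: f g)
  case 0
  then show ?case by (auto intro: continuous_map_real_mult)
next
  case (Suc r)
  have "Cr_on p r U (pderivative i (\<lambda>x. f x * g x))" if i: "i < p" for i
  proof (rule Cr_on_cong_imp[OF U])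
    show "Cr_on p r U (\<lambda>x. f x * pderivative i g x + pderivative i f x * g x)"
    proof -
      have fi: "Cr_on p r U (pderivative i f)" and gi: "Cr_on p r U (pderivative i g)"
        using Suc.prems i unfolding Cr_on.simps by blast+
      show ?thesis
        by (rule Cr_on_add[OF U Suc.IH[OF Cr_on_SucD[OF Suc.prems(1)] gi] Suc.IH[OF fi Cr_on_SucD[OF Suc.prems(2)]]])
    qed
    show "f x * pderivative i g x + pderivative i f x * g x = pderivative i (\<lambda>x. f x * g x) x" if "x \<in> U" for x
      using Suc.prems i that by simp
  qed
  then show ?case using Suc.prems by (auto intro!: continuous_map_real_mult field_differentiable_mult)
qed

lemma continuous_on_upd:
  fixes f :: "'a::topological_space \<Rightarrow> nat \<Rightarrow> 'k::topological_space"
  assumes "continuous_on S f" "continuous_on S g"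
  shows "continuous_on S (\<lambda>z. (f z)(i := g z))"
proof (rule continuous_on_coordinatewise_then_product)
  fix j
  show "continuous_on S (\<lambda>z. ((f z)(i := g z)) j)"
    using assms continuous_on_product_then_coordinatewise[of S f] by (cases "j = i") auto
qed

text \<open>
  For \<open>m = 0\<close> and \<open>h\<close> the \<open>i\<close>-th partial derivative of \<open>f\<close>, this is the quotient of
  \<open>f x - f (x(i := a i))\<close> by \<open>x i - a i\<close>. The factor \<open>s ^ m\<close> is there because differentiating by \<open>x i\<close>
  under the integral produces a factor \<open>s\<close>.
\<close>

definition line_integral :: "nat \<Rightarrow> (nat \<Rightarrow> real) \<Rightarrow> nat \<Rightarrow> ((nat \<Rightarrow> real) \<Rightarrow> real) \<Rightarrow> (nat \<Rightarrow> real) \<Rightarrow> real" where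
  "line_integral i a m h x = integral {0..1} (\<lambda>s. s ^ m * h (x(i := a i + s * (x i - a i))))"

lemma segment_in_polydisc:
  fixes x :: "nat \<Rightarrow> real"
  assumes x: "x \<in> polydisc p a r" and i: "i < p" and s: "s \<in> {0..1}"
  shows "x(i := a i + s * (x i - a i)) \<in> polydisc p a r"
proof -
  have "\<bar>x i - a i\<bar> < r" using polydisc_coord[OF x i] by (simp add: dist_real_def abs_minus_commute)
  moreover have "\<bar>s * (x i - a i)\<bar> \<le> \<bar>x i - a i\<bar>" using s by (simp add: abs_mult mult_left_le_one_le)
  ultimately show ?thesis using upd_in_polydisc[OF x i] by (simp add: dist_real_def)
qed

lemma continuous_on_segment_integrand:
  fixes a :: "nat \<Rightarrow> real" and h :: "(nat \<Rightarrow> real) \<Rightarrow> real"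
  assumes h: "continuous_on (polydisc p a r) h" and i: "i < p"
  shows "continuous_on (polydisc p a r \<times> {0..1}) (\<lambda>(x, s). s ^ m * h (x(i := a i + s * (x i - a i))))"
proof -
  let ?S = "polydisc p a r \<times> {0..1 :: real}"
  have fst_i: "continuous_on ?S (\<lambda>z. fst z i)"
    by (rule continuous_on_product_then_coordinatewise[OF continuous_on_fst[OF continuous_on_id]])
  have "continuous_on ?S (\<lambda>z. a i + snd z * (fst z i - a i))" by (intro continuous_intros fst_i)
  then have "continuous_on ?S (\<lambda>z. (fst z)(i := a i + snd z * (fst z i - a i)))"
    by (intro continuous_on_upd continuous_on_fst continuous_on_id)
  moreover have "(\<lambda>z. (fst z)(i := a i + snd z * (fst z i - a i))) ` ?S \<subseteq> polydisc p a r"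
    using segment_in_polydisc[OF _ i] by fastforce
  ultimately have "continuous_on ?S (\<lambda>z. h ((fst z)(i := a i + snd z * (fst z i - a i))))"
    by (rule continuous_on_compose2[OF h])
  then have "continuous_on ?S (\<lambda>z. snd z ^ m * h ((fst z)(i := a i + snd z * (fst z i - a i))))"
    by (intro continuous_on_mult continuous_on_power continuous_on_snd continuous_on_id)
  then show ?thesis by (simp add: split_beta)
qed

text \<open>
  Differentiation under the integral sign gives an integral of the same kind with a partial
  derivative of \<open>h\<close> in place of \<open>h\<close> and, for the direction \<open>i\<close>, with exponent \<open>m + 1\<close>. So the
  induction on the order has to run over all \<open>h\<close> and \<open>m\<close>.
\<close>

lemma Cr_on_line_integral:
  fixes a :: "nat \<Rightarrow> real"
  assumes i: "i < p"
  shows "Cr_on p r (polydisc p a R) h \<Longrightarrow> Cr_on p r (polydisc p a R) (line_integral i a m h)"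
proof (induction r arbitrary: h m)
  let ?B = "polydisc p a R"
  have sub: "?B \<subseteq> topspace (coord_space p)" by (rule openin_subset[OF openin_polydisc])
  have cont: "continuous_map (subtopology (coord_space p) ?B) euclidean (line_integral i a m h)"
    if "continuous_map (subtopology (coord_space p) ?B) euclidean h" for h m
    using integral_continuous_on_param[of ?B 0 1 "\<lambda>x s. s ^ m * h (x(i := a i + s * (x i - a i)))"]
      continuous_on_segment_integrand[OF _ i, of a R h m] that
    by (simp add: continuous_map_coord_space_iff[OF sub] line_integral_def[abs_def])
  {
    case 0
    then show ?case using cont by simp
  next
    case (Suc r)
    have hc: "continuous_on ?B h" and hj: "\<And>j. j < p \<Longrightarrow> continuous_on ?B (pderivative j h)"
      and hd: "\<And>j x. j < p \<Longrightarrow> x \<in> ?B \<Longrightarrow> (\<lambda>t. h (x(j := t))) field_differentiable at (x j)"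
      and hr: "\<And>j. j < p \<Longrightarrow> Cr_on p r ?B (pderivative j h)"
    proof -
      show "continuous_on ?B h" using Suc.prems by (simp add: continuous_map_coord_space_iff[OF sub])
      show "Cr_on p r ?B (pderivative j h)" if "j < p" for j using Suc.prems that by simp
      then show "continuous_on ?B (pderivative j h)" if "j < p" for j
        using that by (cases r) (auto simp: continuous_map_coord_space_iff[OF sub])
      show "(\<lambda>t. h (x(j := t))) field_differentiable at (x j)" if "j < p" "x \<in> ?B" for j x
        using Suc.prems that by simp
    qed
    have der: "((\<lambda>u. line_integral i a m h (x(j := u))) has_field_derivative
        line_integral i a (if j = i then Suc m else m) (pderivative j h) x) (at (x j))"
      if x: "x \<in> ?B" and j: "j < p" for x j
    proof -
      let ?k = "if j = i then Suc m else m"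
      let ?U = "ball (a j) R"
      let ?f = "\<lambda>u s. s ^ m * h ((x(j := u))(i := a i + s * ((x(j := u)) i - a i)))"
      let ?d = "\<lambda>u s. s ^ ?k * pderivative j h ((x(j := u))(i := a i + s * ((x(j := u)) i - a i)))"
      have U: "x(j := u) \<in> ?B" if "u \<in> ?U" for u using upd_in_polydisc[OF x j] that by blast
      have xj: "x j \<in> ?U" by (rule polydisc_coord[OF x j])
      have "((\<lambda>u. integral (cbox 0 1) (?f u)) has_field_derivative integral (cbox 0 1) (?d (x j))) (at (x j) within ?U)"
      proof (rule leibniz_rule_field_derivative)
        fix u s :: real assume u: "u \<in> ?U" and "s \<in> cbox 0 1"
        then have s: "s \<in> {0..1}" by simp
        let ?y = "(x(j := u))(i := a i + s * ((x(j := u)) i - a i))"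
        have y: "?y \<in> ?B" by (rule segment_in_polydisc[OF U[OF u] i s])
        have D: "((\<lambda>t. h (?y(j := t))) has_field_derivative pderivative j h ?y) (at (?y j))"
          using hd[OF j y] by (simp add: DERIV_deriv_iff_field_differentiable)
        have "((\<lambda>u. ?f u s) has_field_derivative ?d u s) (at u)"
        proof (cases "j = i")
          case True
          have "((\<lambda>u. h (?y(j := a i + s * (u - a i)))) has_field_derivative pderivative j h ?y * s) (at u)"
            using D by (intro DERIV_chain2[where g = "\<lambda>u. a i + s * (u - a i)" and f = "\<lambda>t. h (?y(j := t))"])
              (auto simp: True intro!: derivative_eq_intros)
          moreover have "?y(j := a i + s * (v - a i)) = (x(j := v))(i := a i + s * ((x(j := v)) i - a i))" for v
            using True by simp
          ultimately have "((\<lambda>u. h ((x(j := u))(i := a i + s * ((x(j := u)) i - a i)))) has_field_derivative pderivative j h ?y * s) (at u)"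
            by simp
          from DERIV_cmult[OF this, of "s ^ m"] show ?thesis using True by (simp add: mult_ac)
        next
          case False
          have "?y(j := v) = (x(j := v))(i := a i + s * ((x(j := v)) i - a i))" for v
            using False by (auto simp: fun_eq_iff)
          moreover have "?y j = u" using False by simp
          ultimately have "((\<lambda>u. h ((x(j := u))(i := a i + s * ((x(j := u)) i - a i)))) has_field_derivative pderivative j h ?y) (at u)"
            using D by simp
          from DERIV_cmult[OF this, of "s ^ m"] show ?thesis using False by simp
        qed
        then show "((\<lambda>u. ?f u s) has_field_derivative ?d u s) (at u within ?U)"
          by (rule has_field_derivative_at_within)
      next
        have upd: "continuous_on (?U \<times> {0..1}) (\<lambda>z. (x(j := fst z), snd z :: real))"
          by (intro continuous_on_Pair continuous_on_upd continuous_intros)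
        have "continuous_on (?U \<times> {0..1}) (\<lambda>z. (\<lambda>(x, s). s ^ ?k * pderivative j h (x(i := a i + s * (x i - a i)))) (x(j := fst z), snd z))"
          by (rule continuous_on_compose2[OF continuous_on_segment_integrand[OF hj[OF j] i] upd]) (use U in auto)
        then show "continuous_on (?U \<times> cbox 0 1) (\<lambda>(u, s). ?d u s)"
          by (simp only: case_prod_unfold fst_conv snd_conv cbox_interval)
        have "continuous_on {0..1} (?f u)" if u: "u \<in> ?U" for u
        proof -
          have "continuous_on {0..1 :: real} (\<lambda>s. (x(j := u), s))"
            by (intro continuous_on_Pair continuous_on_const continuous_on_id)
          from continuous_on_compose2[OF continuous_on_segment_integrand[OF hc i, of m] this] U[OF u]
          show ?thesis unfolding prod.case by blast
        qed
        then show "?f u integrable_on cbox 0 1" if "u \<in> ?U" for u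
          using that by (auto intro: integrable_continuous_real)
      qed (use xj in auto)
      then show ?thesis using xj at_within_open[of "x j" ?U] by (simp add: line_integral_def)
    qed
    show ?case
      unfolding Cr_on.simps
    proof (intro conjI allI impI ballI)
      show "continuous_map (subtopology (coord_space p) ?B) euclidean (line_integral i a m h)"
        using cont Suc.prems by simp
      fix j assume j: "j < p"
      show "(\<lambda>t. line_integral i a m h (x(j := t))) field_differentiable at (x j)" if "x \<in> ?B" for x
        using der[OF that j] by (auto simp: field_differentiable_def)
      show "Cr_on p r ?B (pderivative j (line_integral i a m h))"
      proof (rule Cr_on_cong_imp[OF openin_polydisc Suc.IH[OF hr[OF j]]])
        fix x assume "x \<in> ?B"
        from DERIV_imp_deriv[OF der[OF this j]]
        show "line_integral i a (if j = i then Suc m else m) (pderivative j h) x = pderivative j (line_integral i a m h) x"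
          by (rule sym)
      qed
    qed
  }
qed

text \<open>
  The fundamental theorem of calculus along the segment that varies the coordinate \<open>i\<close>.
\<close>

lemma smooth_divide_coordinate:
  fixes a :: "nat \<Rightarrow> real"
  assumes f: "\<And>r. Cr_on p r (polydisc p a R) f" and i: "i < p" and x: "x \<in> polydisc p a R"
  shows "f x = f (x(i := a i)) + (x i - a i) * line_integral i a 0 (pderivative i f) x"
proof -
  let ?\<gamma> = "\<lambda>s. a i + s * (x i - a i)"
  have B: "x(i := ?\<gamma> s) \<in> polydisc p a R" if "s \<in> {0..1}" for s by (rule segment_in_polydisc[OF x i that])
  have "((\<lambda>s. f (x(i := ?\<gamma> s))) has_vector_derivative pderivative i f (x(i := ?\<gamma> s)) * (x i - a i)) (at s within {0..1})"
    if s: "s \<in> {0..1}" for s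
  proof -
    let ?y = "x(i := ?\<gamma> s)"
    have "\<forall>x\<in>polydisc p a R. (\<lambda>t. f (x(i := t))) field_differentiable at (x i)"
      using f[of "Suc 0"] i by simp
    then have "(\<lambda>t. f (?y(i := t))) field_differentiable at (?y i)" using B[OF s] by (rule bspec)
    then have "((\<lambda>t. f (?y(i := t))) has_field_derivative pderivative i f ?y) (at (?\<gamma> s))"
      using DERIV_deriv_iff_field_differentiable by fastforce
    then have "((\<lambda>s. f (?y(i := ?\<gamma> s))) has_field_derivative pderivative i f ?y * (x i - a i)) (at s)"
      by (intro DERIV_chain2[where g = ?\<gamma> and f = "\<lambda>t. f (?y(i := t))"]) (auto intro!: derivative_eq_intros)
    then show ?thesis
      by (simp add: has_real_derivative_iff_has_vector_derivative has_vector_derivative_at_within)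
  qed
  then have "((\<lambda>s. pderivative i f (x(i := ?\<gamma> s)) * (x i - a i)) has_integral f (x(i := ?\<gamma> 1)) - f (x(i := ?\<gamma> 0))) {0..1}"
    by (intro fundamental_theorem_of_calculus[where f = "\<lambda>s. f (x(i := ?\<gamma> s))", OF zero_le_one])
  from integral_unique[OF this]
  have "integral {0..1} (\<lambda>s. pderivative i f (x(i := ?\<gamma> s)) * (x i - a i)) = f x - f (x(i := a i))"
    by simp
  then show ?thesis by (simp add: line_integral_def mult.commute)
qed

section \<open>Function classes with division by coordinates\<close>

text \<open>
  What the rest of the proof uses of smooth and of holomorphic functions. The point is \<open>divide\<close>:
  near \<open>a\<close>, the change of \<open>f\<close> from the hyperplane \<open>x i = a i\<close> is a multiple of \<open>x i - a i\<close>.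
  The polydisc may shrink, since only germs matter; in the holomorphic case it does.
\<close>

locale function_class =
  fixes F :: "nat \<Rightarrow> (nat \<Rightarrow> 'k::real_normed_field) set \<Rightarrow> ((nat \<Rightarrow> 'k) \<Rightarrow> 'k) set" and p :: nat
  assumes ext: "f \<in> F p U \<Longrightarrow> f \<in> extensional U"
    and cont: "openin (coord_space p) U \<Longrightarrow> f \<in> F p U \<Longrightarrow> continuous_map (subtopology (coord_space p) U) euclidean f"
    and const: "openin (coord_space p) U \<Longrightarrow> (\<lambda>x\<in>U. c) \<in> F p U"
    and coord: "openin (coord_space p) U \<Longrightarrow> i < p \<Longrightarrow> (\<lambda>x\<in>U. x i) \<in> F p U"
    and add: "openin (coord_space p) U \<Longrightarrow> f \<in> F p U \<Longrightarrow> g \<in> F p U \<Longrightarrow> (\<lambda>x\<in>U. f x + g x) \<in> F p U"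
    and mult: "openin (coord_space p) U \<Longrightarrow> f \<in> F p U \<Longrightarrow> g \<in> F p U \<Longrightarrow> (\<lambda>x\<in>U. f x * g x) \<in> F p U"
    and restrict: "openin (coord_space p) U \<Longrightarrow> openin (coord_space p) V \<Longrightarrow> V \<subseteq> U \<Longrightarrow> f \<in> F p U \<Longrightarrow> restrict f V \<in> F p V"
    and divide: "a \<in> topspace (coord_space p) \<Longrightarrow> 0 < r \<Longrightarrow> i < p \<Longrightarrow> f \<in> F p (polydisc p a r) \<Longrightarrow>
      \<exists>s. 0 < s \<and> s \<le> r \<and> (\<exists>g\<in>F p (polydisc p a s). \<forall>x\<in>polydisc p a s. f x = f (x(i := a i)) + (x i - a i) * g x)"

lemma function_class_smooth: "function_class smooth_functions p"
proof
  have *: "restrict f U \<in> smooth_functions p U" if "openin (coord_space p) U" "\<And>r. Cr_on p r U f" for U f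
    using that Cr_on_cong_imp[OF that(1,2), where g = "restrict f U"] by (simp add: smooth_functions_def)
  fix U :: "(nat \<Rightarrow> real) set" and f
  show "f \<in> smooth_functions p U \<Longrightarrow> f \<in> extensional U" by (simp add: smooth_functions_def)
  assume U: "openin (coord_space p) U"
  show "continuous_map (subtopology (coord_space p) U) euclidean f" if f: "f \<in> smooth_functions p U"
  proof -
    have "Cr_on p 0 U f" using f unfolding smooth_functions_def by blast
    then show ?thesis by simp
  qed
  show "(\<lambda>x\<in>U. c) \<in> smooth_functions p U" for c by (intro * U Cr_on_const)
  show "(\<lambda>x\<in>U. x i) \<in> smooth_functions p U" if "i < p" for i by (intro * U Cr_on_coord that)
  show "(\<lambda>x\<in>U. f x + g x) \<in> smooth_functions p U" if "f \<in> smooth_functions p U" "g \<in> smooth_functions p U" for g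
    using that by (intro * U Cr_on_add) (auto simp: smooth_functions_def)
  show "(\<lambda>x\<in>U. f x * g x) \<in> smooth_functions p U" if "f \<in> smooth_functions p U" "g \<in> smooth_functions p U" for g
    using that by (intro * U Cr_on_mult) (auto simp: smooth_functions_def)
  show "restrict f V \<in> smooth_functions p V" if "openin (coord_space p) V" "V \<subseteq> U" "f \<in> smooth_functions p U" for V
    using that by (intro *) (auto simp: smooth_functions_def intro: Cr_on_subset)
next
  fix a :: "nat \<Rightarrow> real" and R i f
  assume R: "0 < R" and i: "i < p" and f: "f \<in> smooth_functions p (polydisc p a R)"
  have fr: "Cr_on p r (polydisc p a R) f" for r using f unfolding smooth_functions_def by blast
  have "Cr_on p (Suc r) (polydisc p a R) f" for r by (rule fr)
  then have "Cr_on p r (polydisc p a R) (pderivative i f)" for r using i unfolding Cr_on.simps by blast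
  then have gr: "Cr_on p r (polydisc p a R) (line_integral i a 0 (pderivative i f))" for r
    by (intro Cr_on_line_integral i)
  let ?g = "restrict (line_integral i a 0 (pderivative i f)) (polydisc p a R)"
  have "?g \<in> smooth_functions p (polydisc p a R)"
    using Cr_on_cong_imp[OF openin_polydisc gr, where g = ?g] by (simp add: smooth_functions_def)
  moreover have "f x = f (x(i := a i)) + (x i - a i) * ?g x" if "x \<in> polydisc p a R" for x
    using smooth_divide_coordinate[OF fr i that] that by simp
  ultimately show "\<exists>s. 0 < s \<and> s \<le> R \<and> (\<exists>g\<in>smooth_functions p (polydisc p a s). \<forall>x\<in>polydisc p a s. f x = f (x(i := a i)) + (x i - a i) * g x)"
    using R by blast
qed

section \<open>Holomorphic functions\<close>

text \<open>
  Cauchy's formula on the circle at \<open>u\<close> and at the centre, subtracted. Since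
  \<open>1/(c - u) - 1/(c - a) = (u - a) / ((c - u) (c - a))\<close> and the derivative of the circle path is
  \<open>2 \<pi> \<i>\<close> times \<open>c - a\<close>, the factor \<open>c - a\<close> cancels.
\<close>

lemma circle_difference_quotient:
  fixes \<phi> :: "complex \<Rightarrow> complex"
  assumes \<phi>: "\<phi> holomorphic_on ball a R" and \<rho>: "0 < \<rho>" "\<rho> < R" and u: "u \<in> ball a \<rho>"
  shows "\<phi> u = \<phi> a + (u - a) * integral {0..1} (\<lambda>t. \<phi> (circlepath a \<rho> t) / (circlepath a \<rho> t - u))"
proof -
  let ?\<gamma> = "circlepath a \<rho>"
  have ne: "?\<gamma> t \<noteq> w" if "w \<in> ball a \<rho>" for t w
    using that \<rho>(1) by (auto simp: circlepath dist_norm norm_mult)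
  have hol: "\<phi> holomorphic_on cball a \<rho>"
    using \<phi> by (rule holomorphic_on_subset) (use \<rho> in \<open>auto simp: subset_iff\<close>)
  have cauchy: "((\<lambda>t. \<phi> (?\<gamma> t) / (?\<gamma> t - w) * (?\<gamma> t - a)) has_integral \<phi> w) {0..1}" if w: "w \<in> ball a \<rho>" for w
  proof -
    have "((\<lambda>z. \<phi> z / (z - w)) has_contour_integral 2 * of_real pi * \<i> * \<phi> w) ?\<gamma>"
      using Cauchy_integral_circlepath_simple[OF hol, of w] w by (simp add: dist_norm norm_minus_commute)
    then have "((\<lambda>t. \<phi> (?\<gamma> t) / (?\<gamma> t - w) * vector_derivative ?\<gamma> (at t within {0..1})) has_integral 2 * of_real pi * \<i> * \<phi> w) {0..1}"
      by (simp add: has_contour_integral_def)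
    then have "((\<lambda>t. 2 * of_real pi * \<i> * (\<phi> (?\<gamma> t) / (?\<gamma> t - w) * (?\<gamma> t - a))) has_integral 2 * of_real pi * \<i> * \<phi> w) {0..1}"
      by (rule has_integral_eq[rotated]) (auto simp: vector_derivative_circlepath01, simp add: circlepath)
    from has_integral_mult_right[OF this, of "inverse (2 * of_real pi * \<i>)"] show ?thesis
      by (simp add: field_simps)
  qed
  have "((\<lambda>t. \<phi> (?\<gamma> t) / (?\<gamma> t - u) * (?\<gamma> t - a) - \<phi> (?\<gamma> t) / (?\<gamma> t - a) * (?\<gamma> t - a)) has_integral \<phi> u - \<phi> a) {0..1}"
    using \<rho>(1) by (intro has_integral_diff cauchy u) simp
  then have "((\<lambda>t. (u - a) * (\<phi> (?\<gamma> t) / (?\<gamma> t - u))) has_integral \<phi> u - \<phi> a) {0..1}"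
  proof (rule has_integral_eq[rotated])
    have quotient: "A / c * d - A / d * d = (d - c) * (A / c)" if "c \<noteq> 0" "d \<noteq> 0" for A c d :: complex
      using that by (simp add: field_simps)
    fix t :: real
    have "?\<gamma> t - u \<noteq> 0" "?\<gamma> t - a \<noteq> 0" using ne[OF u, of t] ne[of a t] \<rho>(1) by auto
    then show "\<phi> (?\<gamma> t) / (?\<gamma> t - u) * (?\<gamma> t - a) - \<phi> (?\<gamma> t) / (?\<gamma> t - a) * (?\<gamma> t - a) = (u - a) * (\<phi> (?\<gamma> t) / (?\<gamma> t - u))"
      using quotient[of "?\<gamma> t - u" "?\<gamma> t - a"] by simp
  qed
  from integral_unique[OF this] have e: "(u - a) * integral {0..1} (\<lambda>t. \<phi> (?\<gamma> t) / (?\<gamma> t - u)) = \<phi> u - \<phi> a"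
    unfolding integral_mult_right .
  show ?thesis unfolding e by simp
qed

text \<open>
  The quotient of \<open>f x - f (x(i := a))\<close> by \<open>x i - a\<close>, written as an integral that makes sense
  and is continuous also where \<open>x i = a\<close>.
\<close>

definition circle_quotient :: "nat \<Rightarrow> complex \<Rightarrow> real \<Rightarrow> ((nat \<Rightarrow> complex) \<Rightarrow> complex) \<Rightarrow> (nat \<Rightarrow> complex) \<Rightarrow> complex" where
  "circle_quotient i a \<rho> f x = integral {0..1} (\<lambda>t. f (x(i := circlepath a \<rho> t)) / (circlepath a \<rho> t - x i))"

text \<open>
  The integral is continuous in all variables. Where \<open>x i \<noteq> a i\<close> it is a difference quotient of
  holomorphic functions. In the direction \<open>i\<close> the only exception is one point, a removable
  singularity. In another direction, with \<open>x i = a i\<close> fixed, the function is a locally uniform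
  limit of those with \<open>x i\<close> close to \<open>a i\<close>, by continuity on compact sets.

  The radii are chosen such that \<open>s < \<rho> < R\<close>: the circle of radius \<open>\<rho>\<close> lies in the domain of \<open>f\<close>
  and stays away from the smaller polydisc.
\<close>

lemma holomorphic_divide_coordinate:
  assumes a: "a \<in> topspace (coord_space p)" and R: "0 < R" and i: "i < p"
    and f: "f \<in> holomorphic_functions p (polydisc p a R)"
  defines "s \<equiv> R / 3" and "\<rho> \<equiv> R / 2"
  shows "x \<in> polydisc p a s \<Longrightarrow> f x = f (x(i := a i)) + (x i - a i) * circle_quotient i (a i) \<rho> f x"
    and "restrict (circle_quotient i (a i) \<rho> f) (polydisc p a s) \<in> holomorphic_functions p (polydisc p a s)"
proof -
  let ?g = "circle_quotient i (a i) \<rho> f" and ?\<gamma> = "circlepath (a i) \<rho>"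
  let ?B = "polydisc p a R" and ?b = "polydisc p a s"
  have s: "0 < s" "s < \<rho>" "\<rho> < R" "0 < \<rho>" using R by (auto simp: s_def \<rho>_def)
  have bB: "?b \<subseteq> ?B" using s by (intro polydisc_mono) simp
  have subB: "?B \<subseteq> topspace (coord_space p)" and subb: "?b \<subseteq> topspace (coord_space p)"
    by (rule openin_subset[OF openin_polydisc])+
  have fc: "continuous_on ?B f"
    using f unfolding holomorphic_functions_def continuous_map_coord_space_iff[OF subB] by blast
  have fh: "(\<lambda>t. f (x(j := t))) holomorphic_on {t. x(j := t) \<in> ?B}" if "j < p" "x \<in> ?B" for j x
    using f that unfolding holomorphic_functions_def by blast
  have line: "{t. x(j := t) \<in> polydisc p a r} = ball (a j) r" if "x \<in> polydisc p a r" "j < p" for x j r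
    using upd_in_polydisc[OF that] by blast
  have fh': "(\<lambda>t. f (x(j := t))) holomorphic_on ball (a j) R" if "x \<in> ?B" "j < p" for x j
    using fh[OF that(2,1)] unfolding line[OF that] .
  have eq: "f x = f (x(i := a i)) + (x i - a i) * ?g x" if x: "x \<in> ?b" for x
  proof -
    have "x i \<in> ball (a i) \<rho>" using polydisc_coord[OF x i] s by auto
    from circle_difference_quotient[OF fh'[OF _ i] s(4,3) this, of x] x bB
    show ?thesis by (simp add: circle_quotient_def subset_iff)
  qed
  have \<gamma>B: "x(i := ?\<gamma> t) \<in> ?B" if "x \<in> ?b" for x t
    using upd_in_polydisc[of x p a R i "?\<gamma> t"] that bB i s by (auto simp: circlepath dist_norm norm_mult)
  have \<gamma>ne: "?\<gamma> t - x i \<noteq> 0" if "x \<in> ?b" for x t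
  proof -
    have "norm (?\<gamma> t - a i) = \<rho>" using s by (simp add: circlepath norm_mult)
    moreover have "norm (x i - a i) < s" using polydisc_coord[OF that i] by (simp add: dist_norm norm_minus_commute)
    ultimately show ?thesis using s by auto
  qed
  have gc: "continuous_on ?b ?g"
  proof -
    let ?S = "?b \<times> cbox 0 (1::real)"
    have \<gamma>c: "continuous_on ?S (\<lambda>z. ?\<gamma> (snd z))" unfolding circlepath by (intro continuous_intros)
    have "continuous_on ?S (\<lambda>z. (fst z)(i := ?\<gamma> (snd z)))"
      by (intro continuous_on_upd continuous_on_fst continuous_on_id \<gamma>c)
    moreover have "(\<lambda>z. (fst z)(i := ?\<gamma> (snd z))) ` ?S \<subseteq> ?B" using \<gamma>B by auto
    ultimately have "continuous_on ?S (\<lambda>z. f ((fst z)(i := ?\<gamma> (snd z))))"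
      by (rule continuous_on_compose2[OF fc])
    moreover have "continuous_on ?S (\<lambda>z. ?\<gamma> (snd z) - fst z i)"
      by (intro continuous_on_diff \<gamma>c continuous_on_product_then_coordinatewise[OF continuous_on_fst[OF continuous_on_id]])
    moreover have "\<forall>z\<in>?S. ?\<gamma> (snd z) - fst z i \<noteq> 0" using \<gamma>ne by auto
    ultimately have "continuous_on ?S (\<lambda>z. f ((fst z)(i := ?\<gamma> (snd z))) / (?\<gamma> (snd z) - fst z i))"
      by (rule continuous_on_divide)
    then have "continuous_on ?S (\<lambda>(x, t). f (x(i := ?\<gamma> t)) / (?\<gamma> t - x i))"
      by (simp only: case_prod_unfold)
    from integral_continuous_on_param[OF this] show ?thesis
      by (simp add: circle_quotient_def[abs_def])
  qed
  have line_c: "continuous_on (ball (a j) s) (\<lambda>t. ?g (x(j := t)))" if x: "x \<in> ?b" and j: "j < p" for x j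
  proof (rule continuous_on_compose2[OF gc])
    show "continuous_on (ball (a j) s) (\<lambda>t. x(j := t))"
      by (intro continuous_on_upd continuous_on_const continuous_on_id)
    show "(\<lambda>t. x(j := t)) ` ball (a j) s \<subseteq> ?b" using upd_in_polydisc[OF x j] by blast
  qed
  have off: "(\<lambda>t. ?g (x(j := t))) holomorphic_on ball (a j) s"
    if x: "x \<in> ?b" and j: "j < p" "j \<noteq> i" and xi: "x i \<noteq> a i" for x j
  proof -
    have y: "x(i := a i) \<in> ?B" using upd_in_polydisc[of x p a R i "a i"] x bB i R by auto
    have "(\<lambda>t. (f (x(j := t)) - f ((x(i := a i))(j := t))) / (x i - a i)) holomorphic_on ball (a j) s"
      using holomorphic_on_subset[OF fh'[OF _ j(1)], of x] holomorphic_on_subset[OF fh'[OF y j(1)]] x bB s xi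
      by (intro holomorphic_intros) (auto simp: subset_iff)
    then show ?thesis
    proof (rule holomorphic_transform)
      fix t assume "t \<in> ball (a j) s"
      then have "x(j := t) \<in> ?b" using upd_in_polydisc[OF x j(1)] by simp
      from eq[OF this] j(2) xi show "(f (x(j := t)) - f ((x(i := a i))(j := t))) / (x i - a i) = ?g (x(j := t))"
        by (simp add: field_simps fun_upd_twist)
    qed
  qed
  have gh: "(\<lambda>t. ?g (x(j := t))) holomorphic_on ball (a j) s" if x: "x \<in> ?b" and j: "j < p" for x j
  proof (cases "j = i")
    case True
    have "(\<lambda>t. ?g (x(i := t))) holomorphic_on ball (a i) s - {a i}"
    proof (rule holomorphic_transform)
      show "(\<lambda>t. (f (x(i := t)) - f (x(i := a i))) / (t - a i)) holomorphic_on ball (a i) s - {a i}"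
        using holomorphic_on_subset[OF fh'[OF _ i], of x "ball (a i) s - {a i}"] x bB s
        by (intro holomorphic_intros) (auto simp: subset_iff)
      fix t assume t: "t \<in> ball (a i) s - {a i}"
      then have "x(i := t) \<in> ?b" using upd_in_polydisc[OF x i] by simp
      from eq[OF this] t show "(f (x(i := t)) - f (x(i := a i))) / (t - a i) = ?g (x(i := t))"
        by (simp add: field_simps)
    qed
    with line_c[OF x i] have "(\<lambda>t. ?g (x(i := t))) holomorphic_on ball (a i) s"
      by (rule no_isolated_singularity) auto
    then show ?thesis using True by simp
  next
    case False
    show ?thesis
    proof (cases "x i = a i")
      case False
      then show ?thesis using off[OF x j \<open>j \<noteq> i\<close>] by simp
    next
      case True
      \<comment> \<open>A sequence in the disc that converges to its centre but avoids it.\<close>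
      define \<delta> where "\<delta> n = s / (real n + 2)" for n :: nat
      define v where "v n = a i + of_real (\<delta> n)" for n
      have v: "v n \<in> ball (a i) s" "v n \<noteq> a i" for n
      proof -
        have "\<delta> n < s" "0 < \<delta> n" using s(1) unfolding \<delta>_def
          by (auto simp: field_simps intro!: add_pos_nonneg)
        then show "v n \<in> ball (a i) s" "v n \<noteq> a i" by (auto simp: v_def dist_norm)
      qed
      have vlim: "v \<longlonglongrightarrow> a i"
      proof -
        have "\<delta> \<longlonglongrightarrow> 0" unfolding \<delta>_def by real_asymp
        then have "v \<longlonglongrightarrow> a i + of_real 0" unfolding v_def by (intro tendsto_add tendsto_const tendsto_of_real)
        then show ?thesis by simp
      qed
      show ?thesis
      proof (rule holomorphic_uniform_sequence)
        show "(\<lambda>t. ?g ((x(i := v n))(j := t))) holomorphic_on ball (a j) s" for n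
          using off[of "x(i := v n)" j] upd_in_polydisc[OF x i] v j \<open>j \<noteq> i\<close> by simp
        fix u assume u: "u \<in> ball (a j) s"
        then obtain d where d: "0 < d" "cball u d \<subseteq> ball (a j) s" using open_contains_cball open_ball by blast
        have "continuous_on (ball (a i) s \<times> cball u d) (\<lambda>z. (x(i := fst z))(j := snd z))"
          by (intro continuous_on_upd continuous_on_const continuous_on_fst continuous_on_snd continuous_on_id)
        moreover have "(\<lambda>z. (x(i := fst z))(j := snd z)) ` (ball (a i) s \<times> cball u d) \<subseteq> ?b"
        proof (rule image_subsetI)
          fix z assume z: "z \<in> ball (a i) s \<times> cball u d"
          then have "x(i := fst z) \<in> ?b" "snd z \<in> ball (a j) s" using upd_in_polydisc[OF x i] d(2) by auto
          then show "(x(i := fst z))(j := snd z) \<in> ?b" using upd_in_polydisc[OF _ j] by blast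
        qed
        ultimately have G: "continuous_on (ball (a i) s \<times> cball u d) (\<lambda>z. ?g ((x(i := fst z))(j := snd z)))"
          by (rule continuous_on_compose2[OF gc])
        have "uniform_limit (cball u d) (\<lambda>n t. ?g ((x(i := v n))(j := t))) (\<lambda>t. ?g (x(j := t))) sequentially"
          unfolding uniform_limit_iff
        proof (intro allI impI)
          fix e :: real assume e: "0 < e"
          have ai: "a i \<in> ball (a i) s" using s by simp
          obtain W where W: "a i \<in> W" "open W"
            "\<forall>y\<in>W \<inter> ball (a i) s. \<forall>t\<in>cball u d. dist (?g ((x(i := fst (y, t)))(j := snd (y, t)))) (?g ((x(i := fst (a i, t)))(j := snd (a i, t)))) \<le> e / 2"
            using continuous_on_prod_compactE[OF G compact_cball ai, of "e / 2"] e by auto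
          have "eventually (\<lambda>n. v n \<in> W) sequentially" using topological_tendstoD[OF vlim W(2,1)] .
          then show "\<forall>\<^sub>F n in sequentially. \<forall>t\<in>cball u d. dist (?g ((x(i := v n))(j := t))) (?g (x(j := t))) < e"
          proof eventually_elim
            case (elim n)
            have "x(i := a i) = x" using True by auto
            then show ?case using bspec[OF W(3), of "v n"] v(1)[of n] elim e by fastforce
          qed
        qed
        then show "\<exists>d. 0 < d \<and> cball u d \<subseteq> ball (a j) s \<and>
            uniform_limit (cball u d) (\<lambda>n t. ?g ((x(i := v n))(j := t))) (\<lambda>t. ?g (x(j := t))) sequentially"
          using d by blast
      qed simp
    qed
  qed
  show "x \<in> ?b \<Longrightarrow> f x = f (x(i := a i)) + (x i - a i) * ?g x" by (rule eq)
  show "restrict ?g ?b \<in> holomorphic_functions p ?b"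
    unfolding holomorphic_functions_def
  proof (intro CollectI conjI allI impI ballI)
    show "continuous_map (subtopology (coord_space p) ?b) euclidean (restrict ?g ?b)"
      using gc by (simp add: continuous_map_coord_space_iff[OF subb])
    fix j x assume jx: "j < p" "x \<in> ?b"
    show "(\<lambda>t. restrict ?g ?b (x(j := t))) holomorphic_on {t. x(j := t) \<in> ?b}"
      unfolding line[OF jx(2,1)]
    proof (rule holomorphic_transform[OF gh[OF jx(2,1)]])
      fix t assume "t \<in> ball (a j) s"
      then show "?g (x(j := t)) = restrict ?g ?b (x(j := t))"
        using upd_in_polydisc[OF jx(2,1)] by (simp only: restrict_apply')
    qed
  qed simp
qed

lemma function_class_holomorphic: "function_class holomorphic_functions p"
proof
  fix U :: "(nat \<Rightarrow> complex) set" and f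
  show "f \<in> holomorphic_functions p U \<Longrightarrow> f \<in> extensional U" by (simp add: holomorphic_functions_def)
  assume U: "openin (coord_space p) U"
  have sub: "U \<subseteq> topspace (coord_space p)" by (rule openin_subset[OF U])
  have *: "restrict f V \<in> holomorphic_functions p V" if V: "openin (coord_space p) V" and "continuous_on V f"
    "\<And>i x. i < p \<Longrightarrow> x \<in> V \<Longrightarrow> (\<lambda>t. f (x(i := t))) holomorphic_on {t. x(i := t) \<in> V}" for f V
    unfolding holomorphic_functions_def
  proof (intro CollectI conjI allI impI ballI)
    show "continuous_map (subtopology (coord_space p) V) euclidean (restrict f V)"
      using that(2) by (simp add: continuous_map_coord_space_iff[OF openin_subset[OF V]])
    fix i x assume "i < p" "x \<in> V"
    from that(3)[OF this] show "(\<lambda>t. restrict f V (x(i := t))) holomorphic_on {t. x(i := t) \<in> V}"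
      by (rule holomorphic_transform) simp
  qed simp
  have c: "continuous_on U f" and h: "\<And>i x. i < p \<Longrightarrow> x \<in> U \<Longrightarrow> (\<lambda>t. f (x(i := t))) holomorphic_on {t. x(i := t) \<in> U}"
    if "f \<in> holomorphic_functions p U" for f
    using that unfolding holomorphic_functions_def continuous_map_coord_space_iff[OF sub] by blast+
  show "f \<in> holomorphic_functions p U \<Longrightarrow> continuous_map (subtopology (coord_space p) U) euclidean f"
    unfolding holomorphic_functions_def by blast
  show "(\<lambda>x\<in>U. c) \<in> holomorphic_functions p U" for c by (intro * U continuous_on_const holomorphic_on_const)
  show "(\<lambda>x\<in>U. x i) \<in> holomorphic_functions p U" if "i < p" for i
  proof (rule *[OF U continuous_on_product_then_coordinatewise[OF continuous_on_id]])
    show "(\<lambda>t. (x(j := t)) i) holomorphic_on {t. x(j := t) \<in> U}" for j x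
      by (cases "i = j") (auto intro: holomorphic_on_ident)
  qed
  show "(\<lambda>x\<in>U. f x + g x) \<in> holomorphic_functions p U" if "f \<in> holomorphic_functions p U" "g \<in> holomorphic_functions p U" for g
    by (intro * U continuous_on_add holomorphic_on_add c h that)
  show "(\<lambda>x\<in>U. f x * g x) \<in> holomorphic_functions p U" if "f \<in> holomorphic_functions p U" "g \<in> holomorphic_functions p U" for g
    by (intro * U continuous_on_mult holomorphic_on_mult c h that)
  show "restrict f V \<in> holomorphic_functions p V" if V: "openin (coord_space p) V" "V \<subseteq> U" and f: "f \<in> holomorphic_functions p U" for V
  proof (rule *[OF V(1) continuous_on_subset[OF c[OF f] V(2)]])
    show "(\<lambda>t. f (x(i := t))) holomorphic_on {t. x(i := t) \<in> V}" if "i < p" "x \<in> V" for i x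
      by (rule holomorphic_on_subset[OF h[OF f, of i x]]) (use that V(2) in auto)
  qed
next
  fix a :: "nat \<Rightarrow> complex" and R i f
  assume *: "a \<in> topspace (coord_space p)" "0 < R" "i < p" "f \<in> holomorphic_functions p (polydisc p a R)"
  from holomorphic_divide_coordinate[OF *]
  show "\<exists>s. 0 < s \<and> s \<le> R \<and> (\<exists>g\<in>holomorphic_functions p (polydisc p a s). \<forall>x\<in>polydisc p a s. f x = f (x(i := a i)) + (x i - a i) * g x)"
    using *(2) by (intro exI[of _ "R / 3"] conjI bexI[of _ "restrict (circle_quotient i (a i) (R / 2) f) (polydisc p a (R / 3))"]) auto
qed

section \<open>Stalks\<close>

locale presheaf_at =
  fixes M :: "('m, 'k::field, 's) superspace" and x :: 'm
  assumes presheaf: "presheaf_of_superalgebras M" and x: "x \<in> topspace (body M)"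
begin

abbreviation nbhd :: "'m set \<Rightarrow> bool" where
  "nbhd U \<equiv> openin (body M) U \<and> x \<in> U"

lemmas presheafD = presheaf[unfolded presheaf_of_superalgebras_def]

lemma superalgebra_sections: "openin (body M) U \<Longrightarrow> superalgebra (sections M U)"
  by (rule presheafD[THEN conjunct1, rule_format])

lemma restr_hom:
  "openin (body M) U \<Longrightarrow> openin (body M) V \<Longrightarrow> V \<subseteq> U \<Longrightarrow> restr M U V \<in> superalg_hom (sections M U) (sections M V)"
  by (intro presheafD[THEN conjunct2, THEN conjunct1, rule_format] conjI)

lemma restr_restr:
  "openin (body M) U \<Longrightarrow> openin (body M) V \<Longrightarrow> openin (body M) W \<Longrightarrow> W \<subseteq> V \<Longrightarrow> V \<subseteq> U \<Longrightarrow>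
    f \<in> carrier (sections M U) \<Longrightarrow> restr M V W (restr M U V f) = restr M U W f"
  by (intro presheafD[THEN conjunct2, THEN conjunct2, THEN conjunct2, rule_format] conjI)

lemma nbhd_Int: "nbhd U \<Longrightarrow> nbhd V \<Longrightarrow> nbhd (U \<inter> V)"
  by (simp add: openin_Int)

lemma nbhd_top: "nbhd (topspace (body M))"
  using x by simp

lemma mem_germ_iff:
  "(V, g) \<in> germ M x U f \<longleftrightarrow> nbhd V \<and> g \<in> carrier (sections M V) \<and>
    (\<exists>W. nbhd W \<and> W \<subseteq> U \<inter> V \<and> restr M U W f = restr M V W g)"
  unfolding germ_def by auto

lemma germ_eqI:
  assumes U: "nbhd U" and f: "f \<in> carrier (sections M U)" and V: "nbhd V" and g: "g \<in> carrier (sections M V)"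
    and W: "nbhd W" "W \<subseteq> U \<inter> V" "restr M U W f = restr M V W g"
  shows "germ M x U f = germ M x V g"
proof -
  have sub: "germ M x U f \<subseteq> germ M x V g"
    if U: "nbhd U" and f: "f \<in> carrier (sections M U)" and V: "nbhd V" and g: "g \<in> carrier (sections M V)"
      and W: "W \<subseteq> U \<inter> V" "restr M U W f = restr M V W g" for U V f g
  proof
    fix s assume s: "s \<in> germ M x U f"
    obtain Z k where s': "s = (Z, k)" by (cases s)
    obtain W' where Z: "nbhd Z" "k \<in> carrier (sections M Z)" "nbhd W'" "W' \<subseteq> U \<inter> Z" "restr M U W' f = restr M Z W' k"
      using s unfolding s' mem_germ_iff by blast
    have n: "nbhd (W \<inter> W')" using assms(5) Z(3) by (rule nbhd_Int)
    have "restr M V (W \<inter> W') g = restr M W (W \<inter> W') (restr M V W g)"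
      using restr_restr[of V W "W \<inter> W'" g] V g W assms(5) n by auto
    also have "\<dots> = restr M U (W \<inter> W') f"
      unfolding W(2)[symmetric] using restr_restr[of U W "W \<inter> W'" f] U f W assms(5) n by auto
    also have "\<dots> = restr M W' (W \<inter> W') (restr M U W' f)"
      using restr_restr[of U W' "W \<inter> W'" f] U f Z n by auto
    also have "\<dots> = restr M Z (W \<inter> W') k"
      unfolding Z(5) using restr_restr[of Z W' "W \<inter> W'" k] Z n by auto
    finally show "s \<in> germ M x V g"
      unfolding s' mem_germ_iff using Z n W by blast
  qed
  show ?thesis using sub[OF U f V g W(2,3)] sub[OF V g U f _ W(3)[symmetric]] W(2) by blast
qed

lemma self_mem_germ: "nbhd U \<Longrightarrow> f \<in> carrier (sections M U) \<Longrightarrow> (U, f) \<in> germ M x U f"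
  unfolding mem_germ_iff by blast

lemma germ_eqD:
  assumes "nbhd U" "f \<in> carrier (sections M U)" "germ M x U f = germ M x V g"
  obtains W where "nbhd W" "W \<subseteq> U \<inter> V" "restr M U W f = restr M V W g"
  using self_mem_germ[OF assms(1,2)] unfolding assms(3) mem_germ_iff by (metis inf_commute)

lemma restr_closed:
  "openin (body M) U \<Longrightarrow> openin (body M) V \<Longrightarrow> V \<subseteq> U \<Longrightarrow> f \<in> carrier (sections M U) \<Longrightarrow>
    restr M U V f \<in> carrier (sections M V)"
  using superalg_homD(1)[OF restr_hom] by blast

lemma germ_restr:
  assumes "nbhd U" "nbhd V" "V \<subseteq> U" "f \<in> carrier (sections M U)"
  shows "germ M x V (restr M U V f) = germ M x U f"
  by (rule germ_eqI[where W = V]) (use assms restr_closed[of U V f] restr_restr[of U V V f] in auto)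

text \<open>
  The operations of the stalk are unions over all pairs of representatives. Each pair gives the
  same germ, because it agrees with the pair \<open>(f, g)\<close> on a smaller neighbourhood; so the union
  is that germ.
\<close>

lemma germ_op_germ:
  assumes U: "nbhd U" and f: "f \<in> carrier (sections M U)" and g: "g \<in> carrier (sections M U)"
    and closed: "\<And>V a b. openin (body M) V \<Longrightarrow> a \<in> carrier (sections M V) \<Longrightarrow> b \<in> carrier (sections M V) \<Longrightarrow>
       opn (sections M V) a b \<in> carrier (sections M V)"
    and hom: "\<And>V W a b. openin (body M) V \<Longrightarrow> openin (body M) W \<Longrightarrow> W \<subseteq> V \<Longrightarrow> a \<in> carrier (sections M V) \<Longrightarrow>
       b \<in> carrier (sections M V) \<Longrightarrow> restr M V W (opn (sections M V) a b) = opn (sections M W) (restr M V W a) (restr M V W b)"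
  shows "germ_op opn M x (germ M x U f) (germ M x U g) = germ M x U (opn (sections M U) f g)"
proof -
  have eq: "germ M x (V \<inter> V') (opn (sections M (V \<inter> V')) (restr M V (V \<inter> V') a) (restr M V' (V \<inter> V') b)) =
     germ M x U (opn (sections M U) f g)" if a: "(V, a) \<in> germ M x U f" and b: "(V', b) \<in> germ M x U g" for V V' a b
  proof -
    obtain W where W: "nbhd V" "a \<in> carrier (sections M V)" "nbhd W" "W \<subseteq> U \<inter> V" "restr M U W f = restr M V W a"
      using a unfolding mem_germ_iff by blast
    obtain W' where W': "nbhd V'" "b \<in> carrier (sections M V')" "nbhd W'" "W' \<subseteq> U \<inter> V'" "restr M U W' g = restr M V' W' b"
      using b unfolding mem_germ_iff by blast
    let ?Z = "W \<inter> W'" and ?V = "V \<inter> V'"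
    have Z: "nbhd ?Z" "nbhd ?V" using W W' nbhd_Int by blast+
    have sub: "?Z \<subseteq> W" "?Z \<subseteq> W'" "?Z \<subseteq> ?V" "?Z \<subseteq> U" "W \<subseteq> V" "W \<subseteq> U" "W' \<subseteq> V'" "W' \<subseteq> U" "?V \<subseteq> V" "?V \<subseteq> V'"
      using W W' by auto
    have f1: "restr M U ?Z f = restr M V ?Z a"
      using restr_restr[of U W ?Z f] restr_restr[of V W ?Z a] U f W Z sub by simp
    have g1: "restr M U ?Z g = restr M V' ?Z b"
      using restr_restr[of U W' ?Z g] restr_restr[of V' W' ?Z b] U g W' Z sub by simp
    have a': "restr M V ?V a \<in> carrier (sections M ?V)" "restr M V' ?V b \<in> carrier (sections M ?V)"
      using restr_closed[of V ?V a] restr_closed[of V' ?V b] W W' Z sub by blast+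
    show ?thesis
    proof (rule germ_eqI[where W = ?Z])
      show "restr M ?V ?Z (opn (sections M ?V) (restr M V ?V a) (restr M V' ?V b)) = restr M U ?Z (opn (sections M U) f g)"
        using hom[of ?V ?Z] hom[of U ?Z f g] a' Z sub U f g f1 g1 restr_restr[of V ?V ?Z a] restr_restr[of V' ?V ?Z b] W W'
        by simp
    qed (use Z sub U closed a' f g in auto)
  qed
  have "(U, f) \<in> germ M x U f" "(U, g) \<in> germ M x U g" using self_mem_germ U f g by blast+
  then show ?thesis unfolding germ_op_def using eq by (fast intro!: equalityI)
qed

lemma stalk_carrier: "s \<in> carrier (stalk M x) \<longleftrightarrow> (\<exists>U f. nbhd U \<and> f \<in> carrier (sections M U) \<and> s = germ M x U f)"
  and stalk_even: "s \<in> even_part (stalk M x) \<longleftrightarrow> (\<exists>U f. nbhd U \<and> f \<in> even_part (sections M U) \<and> s = germ M x U f)"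
  and stalk_odd: "s \<in> odd_part (stalk M x) \<longleftrightarrow> (\<exists>U f. nbhd U \<and> f \<in> odd_part (sections M U) \<and> s = germ M x U f)"
  unfolding stalk_def by auto

lemma stalk_ops:
  "mult (stalk M x) = germ_op mult M x" "add (stalk M x) = germ_op add M x"
  "\<one>\<^bsub>stalk M x\<^esub> = germ M x (topspace (body M)) \<one>\<^bsub>sections M (topspace (body M))\<^esub>"
  "\<zero>\<^bsub>stalk M x\<^esub> = germ M x (topspace (body M)) \<zero>\<^bsub>sections M (topspace (body M))\<^esub>"
  "c \<odot>\<^bsub>stalk M x\<^esub> s = (\<Union>(U, f)\<in>s. germ M x U (c \<odot>\<^bsub>sections M U\<^esub> f))"
  unfolding stalk_def by simp_all

lemma germ_smult:
  assumes U: "nbhd U" and f: "f \<in> carrier (sections M U)"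
  shows "c \<odot>\<^bsub>stalk M x\<^esub> germ M x U f = germ M x U (c \<odot>\<^bsub>sections M U\<^esub> f)"
proof -
  have eq: "germ M x V (c \<odot>\<^bsub>sections M V\<^esub> a) = germ M x U (c \<odot>\<^bsub>sections M U\<^esub> f)" if mem: "(V, a) \<in> germ M x U f" for V a
  proof -
    obtain W where W: "nbhd V" "a \<in> carrier (sections M V)" "nbhd W" "W \<subseteq> U \<inter> V" "restr M U W f = restr M V W a"
      using mem unfolding mem_germ_iff by blast
    interpret V: superalg "sections M V" using superalgebra_sections W(1) by (blast intro: superalgI)
    interpret U: superalg "sections M U" using superalgebra_sections U by (blast intro: superalgI)
    show ?thesis
    proof (rule germ_eqI[where W = W])
      show "restr M V W (c \<odot>\<^bsub>sections M V\<^esub> a) = restr M U W (c \<odot>\<^bsub>sections M U\<^esub> f)"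
        using superalg_homD(5)[OF restr_hom, of V W a c] superalg_homD(5)[OF restr_hom, of U W f c] W U f by simp
    qed (use W U f in auto)
  qed
  then show ?thesis unfolding stalk_ops using self_mem_germ[OF U f] by (fast intro!: equalityI)
qed

lemma germ_one:
  assumes U: "nbhd U" shows "germ M x U \<one>\<^bsub>sections M U\<^esub> = \<one>\<^bsub>stalk M x\<^esub>"
  and germ_zero: "germ M x U \<zero>\<^bsub>sections M U\<^esub> = \<zero>\<^bsub>stalk M x\<^esub>"
proof -
  let ?T = "topspace (body M)"
  interpret U: superalg "sections M U" using superalgebra_sections U by (blast intro: superalgI)
  interpret T: superalg "sections M ?T" using superalgebra_sections nbhd_top by (blast intro: superalgI)
  have sub: "U \<subseteq> ?T" using U openin_subset by blast
  have h: "restr M ?T U \<in> superalg_hom (sections M ?T) (sections M U)" using restr_hom U nbhd_top sub by blast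
  show "germ M x U \<one>\<^bsub>sections M U\<^esub> = \<one>\<^bsub>stalk M x\<^esub>"
    unfolding stalk_ops using germ_restr[OF nbhd_top U sub, of "\<one>\<^bsub>sections M ?T\<^esub>"] superalg_homD(4)[OF h] by simp
  show "germ M x U \<zero>\<^bsub>sections M U\<^esub> = \<zero>\<^bsub>stalk M x\<^esub>"
    unfolding stalk_ops using germ_restr[OF nbhd_top U sub, of "\<zero>\<^bsub>sections M ?T\<^esub>"]
      superalg_hom_zero[OF h T.superalgebra U.superalgebra] by simp
qed

lemma germ_hom:
  assumes U: "nbhd U"
  shows "germ M x U \<in> superalg_hom (sections M U) (stalk M x)"
proof -
  have closed: "a \<otimes>\<^bsub>sections M V\<^esub> b \<in> carrier (sections M V)" "a \<oplus>\<^bsub>sections M V\<^esub> b \<in> carrier (sections M V)"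
    if "openin (body M) V" "a \<in> carrier (sections M V)" "b \<in> carrier (sections M V)" for V a b
  proof -
    interpret V: superalg "sections M V" using superalgebra_sections that(1) by (blast intro: superalgI)
    show "a \<otimes>\<^bsub>sections M V\<^esub> b \<in> carrier (sections M V)" "a \<oplus>\<^bsub>sections M V\<^esub> b \<in> carrier (sections M V)"
      using that by auto
  qed
  have "germ M x U (f \<otimes>\<^bsub>sections M U\<^esub> g) = germ M x U f \<otimes>\<^bsub>stalk M x\<^esub> germ M x U g"
    if "f \<in> carrier (sections M U)" "g \<in> carrier (sections M U)" for f g
    unfolding stalk_ops using germ_op_germ[OF U that, of mult] closed(1) superalg_homD(2)[OF restr_hom] by simp
  moreover have "germ M x U (f \<oplus>\<^bsub>sections M U\<^esub> g) = germ M x U f \<oplus>\<^bsub>stalk M x\<^esub> germ M x U g"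
    if "f \<in> carrier (sections M U)" "g \<in> carrier (sections M U)" for f g
    unfolding stalk_ops using germ_op_germ[OF U that, of add] closed(2) superalg_homD(3)[OF restr_hom] by simp
  moreover have "germ M x U \<in> carrier (sections M U) \<rightarrow> carrier (stalk M x)"
    using U by (intro Pi_I) (auto simp: stalk_carrier)
  moreover have "germ M x U ` even_part (sections M U) \<subseteq> even_part (stalk M x)"
    "germ M x U ` odd_part (sections M U) \<subseteq> odd_part (stalk M x)"
    using U unfolding image_subset_iff stalk_even stalk_odd by blast+
  ultimately show ?thesis
    unfolding superalg_hom_def ring_hom_def using germ_one[OF U] germ_smult[OF U] by simp
qed

lemma stalk_part: "s \<in> part u (stalk M x) \<longleftrightarrow> (\<exists>U f. nbhd U \<and> f \<in> part u (sections M U) \<and> s = germ M x U f)"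
  by (cases u rule: option.exhaust) (auto simp: stalk_carrier stalk_even stalk_odd part_def)

lemma part_subset: "superalgebra A \<Longrightarrow> part u A \<subseteq> carrier A"
  using superalg.even_carrier[OF superalgI] superalg.odd_carrier[OF superalgI] by (auto simp: part_def split: option.splits)

text \<open>
  Three germs have representatives over one neighbourhood, so that the stalk is locally an
  image of an algebra of sections.
\<close>

lemma superalgebra_stalk: "superalgebra (stalk M x)"
proof (rule superalgebra_local_image)
  fix u v w a b c assume abc: "a \<in> part u (stalk M x)" "b \<in> part v (stalk M x)" "c \<in> part w (stalk M x)"
  obtain U f where U: "nbhd U" "f \<in> part u (sections M U)" "a = germ M x U f" using abc(1) stalk_part by blast
  obtain V g where V: "nbhd V" "g \<in> part v (sections M V)" "b = germ M x V g" using abc(2) stalk_part by blast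
  obtain W k where W: "nbhd W" "k \<in> part w (sections M W)" "c = germ M x W k" using abc(3) stalk_part by blast
  let ?Z = "U \<inter> V \<inter> W"
  have Z: "nbhd ?Z" using U V W nbhd_Int by blast
  have r: "restr M Y ?Z s \<in> part t (sections M ?Z) \<and> germ M x Y s = germ M x ?Z (restr M Y ?Z s)"
    if "nbhd Y" "?Z \<subseteq> Y" "s \<in> part t (sections M Y)" for Y s t
    using that Z superalg_hom_part[OF restr_hom, of Y ?Z s t] germ_restr[of Y ?Z s] part_subset[of "sections M Y" t]
      superalgebra_sections[of Y] by auto
  show "\<exists>(A :: ('k, 's) superalg) h. superalgebra A \<and> h \<in> superalg_hom A (stalk M x) \<and> h \<zero>\<^bsub>A\<^esub> = \<zero>\<^bsub>stalk M x\<^esub> \<and>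
        (\<exists>a'\<in>part u A. \<exists>b'\<in>part v A. \<exists>c'\<in>part w A. a = h a' \<and> b = h b' \<and> c = h c')"
    using superalgebra_sections[of ?Z] germ_hom[OF Z] germ_zero[OF Z] Z U V W r[OF U(1) _ U(2)] r[OF V(1) _ V(2)] r[OF W(1) _ W(2)]
    by (intro exI[of _ "sections M ?Z"] exI[of _ "germ M x ?Z"] conjI
        bexI[of _ "restr M U ?Z f"] bexI[of _ "restr M V ?Z g"] bexI[of _ "restr M W ?Z k"]) auto
next
  interpret T: superalg "sections M (topspace (body M))" using superalgebra_sections nbhd_top by (blast intro: superalgI)
  show "carrier (stalk M x) \<noteq> {}" using nbhd_top stalk_carrier T.zero_closed by blast
  show "even_part (stalk M x) \<subseteq> carrier (stalk M x)" "odd_part (stalk M x) \<subseteq> carrier (stalk M x)"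
    using stalk_part[of _ "Some True"] stalk_part[of _ "Some False"] part_subset superalgebra_sections
    unfolding part_simps stalk_carrier subset_iff
    by (metis (no_types, lifting) part_simps(2,3) subset_iff)+
  show "even_part (stalk M x) \<inter> odd_part (stalk M x) \<subseteq> {\<zero>\<^bsub>stalk M x\<^esub>}"
  proof
    fix s assume s: "s \<in> even_part (stalk M x) \<inter> odd_part (stalk M x)"
    obtain U f where U: "nbhd U" "f \<in> even_part (sections M U)" "s = germ M x U f" using s stalk_even by blast
    obtain V g where V: "nbhd V" "g \<in> odd_part (sections M V)" "s = germ M x V g" using s stalk_odd by blast
    interpret U: superalg "sections M U" using superalgebra_sections U by (blast intro: superalgI)
    have fc: "f \<in> carrier (sections M U)" by (rule U.even_carrier[OF U(2)])
    obtain W where W: "nbhd W" "W \<subseteq> U \<inter> V" "restr M U W f = restr M V W g"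
      using germ_eqD[OF U(1) fc] U(3) V(3) by metis
    interpret W: superalg "sections M W" using superalgebra_sections W(1) by (blast intro: superalgI)
    have "restr M U W f \<in> even_part (sections M W)" "restr M V W g \<in> odd_part (sections M W)"
      using superalg_homD(6)[OF restr_hom, of U W f] superalg_homD(7)[OF restr_hom, of V W g] U V W by auto
    then have "restr M U W f = \<zero>\<^bsub>sections M W\<^esub>" using W(3) W.even_odd_Int by simp
    then have "s = \<zero>\<^bsub>stalk M x\<^esub>"
      using germ_restr[OF U(1) W(1) _ fc] W(2) U(3) germ_zero[OF W(1)] by simp
    then show "s \<in> {\<zero>\<^bsub>stalk M x\<^esub>}" by simp
  qed
qed

end

section \<open>Charts\<close>

lemma superalg_hom_compose:
  assumes h: "h \<in> superalg_hom A B" and k: "k \<in> superalg_hom B C"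
  shows "(\<lambda>a. k (h a)) \<in> superalg_hom A C"
  unfolding superalg_hom_def ring_hom_def
  using superalg_homD[OF h] superalg_homD[OF k] by auto

lemma homeomorphic_map_open_subsets:
  assumes \<phi>: "homeomorphic_map (subtopology T U) (subtopology T' V) \<phi>" and U: "openin T U" and V: "openin T' V"
  shows "\<phi> ` U = V" "inj_on \<phi> U"
    and "\<And>W. openin T W \<Longrightarrow> W \<subseteq> U \<Longrightarrow> openin T' (\<phi> ` W)"
    and "\<And>W. openin T' W \<Longrightarrow> openin T {z \<in> U. \<phi> z \<in> W}"
proof -
  have tops: "topspace (subtopology T U) = U" "topspace (subtopology T' V) = V"
    using openin_subset[OF U] openin_subset[OF V] by auto
  show "\<phi> ` U = V" using homeomorphic_imp_surjective_map[OF \<phi>] unfolding tops .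
  show "inj_on \<phi> U" using homeomorphic_imp_injective_map[OF \<phi>] unfolding tops .
  show "openin T' (\<phi> ` W)" if "openin T W" "W \<subseteq> U" for W
  proof -
    have "openin (subtopology T U) W" using that U by (simp add: openin_open_subtopology)
    then have "openin (subtopology T' V) (\<phi> ` W)"
      using homeomorphic_imp_open_map[OF \<phi>] unfolding open_map_def by blast
    then show ?thesis using V by (simp add: openin_open_subtopology)
  qed
  show "openin T {z \<in> U. \<phi> z \<in> W}" if "openin T' W" for W
  proof -
    have "openin (subtopology T' V) (W \<inter> V)" using that by (simp add: openin_subtopology_Int)
    then have "openin (subtopology T U) {z \<in> U. \<phi> z \<in> W \<inter> V}"
      using openin_continuous_map_preimage[OF homeomorphic_imp_continuous_map[OF \<phi>], of "W \<inter> V"] unfolding tops by blast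
    moreover have "{z \<in> U. \<phi> z \<in> W \<inter> V} = {z \<in> U. \<phi> z \<in> W}" using \<open>\<phi> ` U = V\<close> by auto
    ultimately show ?thesis using U by (simp add: openin_open_subtopology)
  qed
qed

context function_class
begin

lemma cring_function_algebra:
  assumes W: "openin (coord_space p) W"
  shows "cring (function_algebra W (F p W))"
proof (rule cringI)
  have e: "f = g" if "f \<in> F p W" "g \<in> F p W" "\<And>z. z \<in> W \<Longrightarrow> f z = g z" for f g
    using that ext by (intro extensionalityI[of f W g]) auto
  show "abelian_group (function_algebra W (F p W))"
  proof (rule abelian_groupI)
    fix f assume f: "f \<in> carrier (function_algebra W (F p W))"
    then have f': "f \<in> F p W" by (simp add: function_algebra_def)
    have n: "(\<lambda>x\<in>W. (\<lambda>x\<in>W. - 1) x * f x) \<in> F p W" by (rule mult[OF W const[OF W] f'])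
    show "\<exists>g\<in>carrier (function_algebra W (F p W)). g \<oplus>\<^bsub>function_algebra W (F p W)\<^esub> f = \<zero>\<^bsub>function_algebra W (F p W)\<^esub>"
      using n by (intro bexI[of _ "\<lambda>x\<in>W. (\<lambda>x\<in>W. - 1) x * f x"]) (auto simp: function_algebra_def fun_eq_iff restrict_def)
    show "\<zero>\<^bsub>function_algebra W (F p W)\<^esub> \<oplus>\<^bsub>function_algebra W (F p W)\<^esub> f = f"
      using e[OF _ f', of "\<lambda>x\<in>W. (\<lambda>x\<in>W. 0) x + f x"] add[OF W const[OF W] f'] by (simp add: function_algebra_def)
  qed (use add[OF W] const[OF W] in \<open>auto simp: function_algebra_def fun_eq_iff restrict_def\<close>)
  show "Group.comm_monoid (function_algebra W (F p W))"
  proof (rule comm_monoidI)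
    fix f assume "f \<in> carrier (function_algebra W (F p W))"
    then have f': "f \<in> F p W" by (simp add: function_algebra_def)
    then show "\<one>\<^bsub>function_algebra W (F p W)\<^esub> \<otimes>\<^bsub>function_algebra W (F p W)\<^esub> f = f"
      using e[OF _ f', of "\<lambda>x\<in>W. (\<lambda>x\<in>W. 1) x * f x"] mult[OF W const[OF W] f'] by (simp add: function_algebra_def)
  qed (use mult[OF W] const[OF W] in \<open>auto simp: function_algebra_def fun_eq_iff restrict_def\<close>)
qed (auto simp: function_algebra_def fun_eq_iff restrict_def distrib_right)

abbreviation model_sections :: "nat \<Rightarrow> (nat \<Rightarrow> 'k) set \<Rightarrow> ('k, nat set \<Rightarrow> (nat \<Rightarrow> 'k) \<Rightarrow> 'k) superalg" where
  "model_sections q W \<equiv> grassmann (function_algebra W (F p W)) q"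

lemma model_carrier: "f \<in> carrier (model_sections q W) \<longleftrightarrow> f \<in> Pow {..<q} \<rightarrow>\<^sub>E F p W"
  by (simp add: grassmann_def function_algebra_def)

lemma model_coeff: "f \<in> carrier (model_sections q W) \<Longrightarrow> I \<subseteq> {..<q} \<Longrightarrow> f I \<in> F p W"
  unfolding model_carrier by (rule PiE_mem) auto

lemma model_add: "I \<subseteq> {..<q} \<Longrightarrow> z \<in> W \<Longrightarrow> (f \<oplus>\<^bsub>model_sections q W\<^esub> g) I z = f I z + g I z"
  and model_one: "I \<subseteq> {..<q} \<Longrightarrow> z \<in> W \<Longrightarrow> \<one>\<^bsub>model_sections q W\<^esub> I z = (if I = {} then 1 else 0)"
  and model_smult: "I \<subseteq> {..<q} \<Longrightarrow> z \<in> W \<Longrightarrow> (c \<odot>\<^bsub>model_sections q W\<^esub> f) I z = c * f I z"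
  by (auto simp: grassmann_def function_algebra_def)

lemma model_mult_closed:
  "openin (coord_space p) W \<Longrightarrow> f \<in> carrier (model_sections q W) \<Longrightarrow> g \<in> carrier (model_sections q W) \<Longrightarrow>
    f \<otimes>\<^bsub>model_sections q W\<^esub> g \<in> carrier (model_sections q W)"
  by (rule grassmann_mult_closed[OF cring_function_algebra])

lemma model_mult:
  assumes W: "openin (coord_space p) W" and f: "f \<in> carrier (model_sections q W)"
    and g: "g \<in> carrier (model_sections q W)" and I: "I \<subseteq> {..<q}" and z: "z \<in> W"
  shows "(f \<otimes>\<^bsub>model_sections q W\<^esub> g) I z = gmult (\<lambda>J. f J z) (\<lambda>J. g J z) I"
proof -
  have "(\<lambda>h. h z) \<in> ring_hom (function_algebra W (F p W)) ring_of_type_algebra"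
    using z by (intro ring_hom_memI) (simp_all add: function_algebra_def ring_of_type_algebra_def)
  from grassmann_mult_eval[OF cring_function_algebra[OF W] this f g I] show ?thesis .
qed

lemma model_add_closed:
  assumes W: "openin (coord_space p) W" and f: "f \<in> carrier (model_sections q W)" and g: "g \<in> carrier (model_sections q W)"
  shows "f \<oplus>\<^bsub>model_sections q W\<^esub> g \<in> carrier (model_sections q W)"
  using add[OF W model_coeff[OF f] model_coeff[OF g]] unfolding model_carrier
  by (simp add: grassmann_def function_algebra_def)

lemma model_one_closed:
  assumes W: "openin (coord_space p) W"
  shows "\<one>\<^bsub>model_sections q W\<^esub> \<in> carrier (model_sections q W)"
  using const[OF W] unfolding model_carrier by (simp add: grassmann_def function_algebra_def)

lemma model_smult_closed:
  assumes W: "openin (coord_space p) W" and f: "f \<in> carrier (model_sections q W)"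
  shows "c \<odot>\<^bsub>model_sections q W\<^esub> f \<in> carrier (model_sections q W)"
  using mult[OF W const[OF W, of c] model_coeff[OF f]] unfolding model_carrier
  by (simp add: grassmann_def function_algebra_def cong: restrict_cong)

lemma model_eqI:
  assumes "f \<in> carrier (model_sections q W)" "g \<in> carrier (model_sections q W)"
    and "\<And>I z. I \<subseteq> {..<q} \<Longrightarrow> z \<in> W \<Longrightarrow> f I z = g I z"
  shows "f = g"
proof (rule PiE_ext)
  show "f \<in> Pow {..<q} \<rightarrow>\<^sub>E F p W" "g \<in> Pow {..<q} \<rightarrow>\<^sub>E F p W" using assms(1,2) by (simp_all only: model_carrier)
  fix I assume "I \<in> Pow {..<q}"
  then show "f I = g I"
    using ext model_coeff[OF assms(1)] model_coeff[OF assms(2)] assms(3)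
    by (intro extensionalityI[of "f I" W "g I"]) auto
qed

end

text \<open>
  One chart around \<open>x\<close>. Germs at \<open>x\<close> are described by families of functions near \<open>y = \<phi> x\<close>.
\<close>

locale chart_at = function_class F p + presheaf_at M x
  for F :: "nat \<Rightarrow> (nat \<Rightarrow> 'k::real_normed_field) set \<Rightarrow> ((nat \<Rightarrow> 'k) \<Rightarrow> 'k) set" and p
    and M :: "('m, 'k, 's) superspace" and x +
  fixes q U0 V0 \<phi> \<Psi>
  assumes U0: "openin (body M) U0" and xU0: "x \<in> U0" and V0: "openin (coord_space p) V0"
    and iso: "superspace_iso M U0 (model_superspace F p q) V0 \<phi> \<Psi>"
begin

abbreviation "S \<equiv> model_sections q"

definition "y = \<phi> x"

abbreviation nbd :: "(nat \<Rightarrow> 'k) set \<Rightarrow> bool" where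
  "nbd W \<equiv> openin (coord_space p) W \<and> y \<in> W \<and> W \<subseteq> V0"

definition "pre W = {z \<in> U0. \<phi> z \<in> W}"

text \<open>
  The germ at \<open>x\<close> of the pullback of a section of the model over a neighbourhood \<open>W\<close> of \<open>y\<close>.
  Every germ at \<open>x\<close> is of this form (\<open>chart_germ_surj\<close>), and two of them are equal iff the
  functions agree near \<open>y\<close> (\<open>chart_germ_eqI\<close>, \<open>chart_germ_eqD\<close>).
\<close>

definition "chart_germ W f = germ M x (pre W) (\<Psi> (pre W) f)"

definition "rs W f = (\<lambda>I\<in>Pow {..<q}. restrict (f I) W)"

lemma model_body: "body (model_superspace F p q) = coord_space p"
  and model_sections: "sections (model_superspace F p q) W = S W"
  and model_restr: "restr (model_superspace F p q) W W' = rs W'"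
  by (simp_all add: model_superspace_def rs_def fun_eq_iff)

lemmas isoD = iso[unfolded superspace_iso_def model_body model_sections model_restr]

lemma homeo: "homeomorphic_map (subtopology (body M) U0) (subtopology (coord_space p) V0) \<phi>"
  by (rule isoD[THEN conjunct1])

lemma \<Psi>_iso: "openin (body M) W \<Longrightarrow> W \<subseteq> U0 \<Longrightarrow> \<Psi> W \<in> superalg_iso (S (\<phi> ` W)) (sections M W)"
  by (intro isoD[THEN conjunct2, THEN conjunct1, rule_format] conjI)

lemma \<Psi>_restr:
  "openin (body M) W \<Longrightarrow> openin (body M) W' \<Longrightarrow> W' \<subseteq> W \<Longrightarrow> W \<subseteq> U0 \<Longrightarrow> f \<in> carrier (S (\<phi> ` W)) \<Longrightarrow>
    \<Psi> W' (rs (\<phi> ` W') f) = restr M W W' (\<Psi> W f)"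
  by (intro isoD[THEN conjunct2, THEN conjunct2, rule_format] conjI)

lemmas \<phi>_facts = homeomorphic_map_open_subsets[OF homeo U0 V0]

lemma nbd_V0: "nbd V0"
  using V0 \<phi>_facts(1) xU0 by (auto simp: y_def)

lemma y_topspace: "y \<in> topspace (coord_space p)"
  using nbd_V0 openin_subset by blast

lemma nbd_Int: "nbd W \<Longrightarrow> nbd W' \<Longrightarrow> nbd (W \<inter> W')"
  by auto

lemma nbhd_pre: "nbd W \<Longrightarrow> nbhd (pre W)"
  using \<phi>_facts(4) xU0 by (simp add: pre_def y_def)

lemma pre_subset: "pre W \<subseteq> U0"
  by (auto simp: pre_def)

lemma image_pre: "W \<subseteq> V0 \<Longrightarrow> \<phi> ` pre W = W"
  using \<phi>_facts(1) by (auto simp: pre_def)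

lemma pre_image: "W \<subseteq> U0 \<Longrightarrow> pre (\<phi> ` W) = W"
  using \<phi>_facts(2) by (auto simp: pre_def inj_on_def)

lemma nbd_image: "nbhd W \<Longrightarrow> W \<subseteq> U0 \<Longrightarrow> nbd (\<phi> ` W)"
  using \<phi>_facts(1,3) by (auto simp: y_def)

lemma \<Psi>_pre:
  assumes "nbd W"
  shows "\<Psi> (pre W) \<in> superalg_hom (S W) (sections M (pre W))"
    and "bij_betw (\<Psi> (pre W)) (carrier (S W)) (carrier (sections M (pre W)))"
  using \<Psi>_iso[of "pre W"] nbhd_pre[OF assms] pre_subset image_pre assms
  unfolding superalg_iso_def by auto

lemma chart_germ_hom: "nbd W \<Longrightarrow> chart_germ W \<in> superalg_hom (S W) (stalk M x)"
  unfolding chart_germ_def[abs_def] by (intro superalg_hom_compose[OF \<Psi>_pre(1) germ_hom] nbhd_pre)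

lemma rs_apply: "I \<subseteq> {..<q} \<Longrightarrow> z \<in> W \<Longrightarrow> rs W f I z = f I z"
  by (simp add: rs_def)

lemma rs_closed:
  assumes "nbd W" "nbd W'" "W' \<subseteq> W" "f \<in> carrier (S W)"
  shows "rs W' f \<in> carrier (S W')"
  using restrict[of W W'] model_coeff[OF assms(4)] assms unfolding model_carrier by (simp add: rs_def)

lemma chart_germ_restr:
  assumes "nbd W" "nbd W'" "W' \<subseteq> W" "f \<in> carrier (S W)"
  shows "chart_germ W' (rs W' f) = chart_germ W f"
proof -
  have sub: "pre W' \<subseteq> pre W" using assms(3) by (auto simp: pre_def)
  have "\<Psi> (pre W') (rs W' f) = restr M (pre W) (pre W') (\<Psi> (pre W) f)"
    using \<Psi>_restr[of "pre W" "pre W'" f] nbhd_pre assms sub pre_subset image_pre by auto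
  then show ?thesis
    unfolding chart_germ_def
    using germ_restr[OF nbhd_pre[OF assms(1)] nbhd_pre[OF assms(2)] sub] superalg_homD(1)[OF \<Psi>_pre(1)[OF assms(1)] assms(4)]
    by simp
qed

lemma chart_germ_eqI:
  assumes "nbd W" "nbd W'" "f \<in> carrier (S W)" "f' \<in> carrier (S W')" "nbd Z" "Z \<subseteq> W \<inter> W'"
    and "\<And>I z. I \<subseteq> {..<q} \<Longrightarrow> z \<in> Z \<Longrightarrow> f I z = f' I z"
  shows "chart_germ W f = chart_germ W' f'"
proof -
  have "rs Z f = rs Z f'" using assms(7) by (auto simp: rs_def fun_eq_iff)
  moreover have "Z \<subseteq> W" "Z \<subseteq> W'" using assms(6) by auto
  ultimately show ?thesis
    using chart_germ_restr[OF assms(1,5) _ assms(3)] chart_germ_restr[OF assms(2,5) _ assms(4)] by simp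
qed

lemma chart_germ_eqD:
  assumes W: "nbd W" "nbd W'" and f: "f \<in> carrier (S W)" "f' \<in> carrier (S W')"
    and eq: "chart_germ W f = chart_germ W' f'"
  shows "\<exists>Z. nbd Z \<and> Z \<subseteq> W \<inter> W' \<and> (\<forall>I z. I \<subseteq> {..<q} \<longrightarrow> z \<in> Z \<longrightarrow> f I z = f' I z)"
proof -
  have c: "\<Psi> (pre W) f \<in> carrier (sections M (pre W))" using superalg_homD(1)[OF \<Psi>_pre(1)[OF W(1)] f(1)] .
  obtain Z where Z: "nbhd Z" "Z \<subseteq> pre W \<inter> pre W'" "restr M (pre W) Z (\<Psi> (pre W) f) = restr M (pre W') Z (\<Psi> (pre W') f')"
    by (rule germ_eqD[OF nbhd_pre[OF W(1)] c eq[unfolded chart_germ_def]])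
  have ZU: "Z \<subseteq> U0" using Z(2) pre_subset by blast
  define Y where "Y = \<phi> ` Z"
  have Y: "nbd Y" "pre Y = Z" unfolding Y_def using nbd_image[OF Z(1) ZU] pre_image[OF ZU] by blast+
  have YW: "Y \<subseteq> W" "Y \<subseteq> W'" using Z(2) by (auto simp: Y_def pre_def)
  have "\<Psi> Z (rs Y f) = restr M (pre W) Z (\<Psi> (pre W) f)"
    unfolding Y_def using \<Psi>_restr[of "pre W" Z f] nbhd_pre[OF W(1)] Z pre_subset image_pre W f by auto
  moreover have "\<Psi> Z (rs Y f') = restr M (pre W') Z (\<Psi> (pre W') f')"
    unfolding Y_def using \<Psi>_restr[of "pre W'" Z f'] nbhd_pre[OF W(2)] Z pre_subset image_pre W f by auto
  ultimately have "\<Psi> (pre Y) (rs Y f) = \<Psi> (pre Y) (rs Y f')" using Z(3) Y(2) by simp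
  then have "rs Y f = rs Y f'"
    by (rule inj_onD[OF bij_betw_imp_inj_on[OF \<Psi>_pre(2)[OF Y(1)]]])
      (rule rs_closed[OF W(1) Y(1) YW(1) f(1)] rs_closed[OF W(2) Y(1) YW(2) f(2)])+
  then have "f I z = f' I z" if "I \<subseteq> {..<q}" "z \<in> Y" for I z
    using rs_apply[OF that, of f] rs_apply[OF that, of f'] by simp
  then show ?thesis using Y(1) YW by (intro exI[of _ Y]) blast
qed

lemma chart_germ_surj:
  assumes "s \<in> carrier (stalk M x)"
  obtains W f where "nbd W" "f \<in> carrier (S W)" "s = chart_germ W f"
proof -
  obtain U g where U: "nbhd U" "g \<in> carrier (sections M U)" "s = germ M x U g"
    using assms stalk_carrier by blast
  let ?Z = "U \<inter> U0"
  have Z: "nbhd ?Z" "?Z \<subseteq> U0" using U(1) U0 xU0 nbhd_Int by auto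
  define W where "W = \<phi> ` ?Z"
  have W: "nbd W" "pre W = ?Z" unfolding W_def using nbd_image[OF Z] pre_image[OF Z(2)] by blast+
  have "restr M U ?Z g \<in> carrier (sections M (pre W))" unfolding W(2) using restr_closed U Z by blast
  then have "restr M U ?Z g \<in> \<Psi> (pre W) ` carrier (S W)"
    unfolding bij_betw_imp_surj_on[OF \<Psi>_pre(2)[OF W(1)]] .
  then obtain f where f: "restr M U ?Z g = \<Psi> (pre W) f" "f \<in> carrier (S W)" by (rule imageE)
  have "s = germ M x (pre W) (restr M U ?Z g)"
    unfolding U(3) W(2) using germ_restr[OF U(1) Z(1) _ U(2)] by simp
  then have "s = chart_germ W f" unfolding chart_germ_def f(1) .
  then show thesis by (rule that[OF W(1) f(2)])
qed

lemma chart_germ_surj2: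
  assumes "s \<in> carrier (stalk M x)" "t \<in> carrier (stalk M x)"
  obtains W f g where "nbd W" "f \<in> carrier (S W)" "g \<in> carrier (S W)" "s = chart_germ W f" "t = chart_germ W g"
proof -
  obtain W f where W: "nbd W" "f \<in> carrier (S W)" "s = chart_germ W f" by (rule chart_germ_surj[OF assms(1)])
  obtain W' g where W': "nbd W'" "g \<in> carrier (S W')" "t = chart_germ W' g" by (rule chart_germ_surj[OF assms(2)])
  have Z: "nbd (W \<inter> W')" using nbd_Int W(1) W'(1) by blast
  show thesis
    using that[OF Z rs_closed[OF W(1) Z _ W(2)] rs_closed[OF W'(1) Z _ W'(2)]]
      chart_germ_restr[OF W(1) Z _ W(2)] chart_germ_restr[OF W'(1) Z _ W'(2)] W(3) W'(3) by simp
qed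

section \<open>The value of a germ and the maximal ideal\<close>

text \<open>
  The value of the component without odd variables; it does not depend on the representative.
\<close>

definition "germ_value s = (THE c. \<exists>W f. nbd W \<and> f \<in> carrier (S W) \<and> s = chart_germ W f \<and> c = f {} y)"

lemma germ_value: assumes "nbd W" "f \<in> carrier (S W)" shows "germ_value (chart_germ W f) = f {} y"
  unfolding germ_value_def
proof (rule the_equality)
  show "\<exists>W' f'. nbd W' \<and> f' \<in> carrier (S W') \<and> chart_germ W f = chart_germ W' f' \<and> f {} y = f' {} y"
    using assms by blast
  fix c assume "\<exists>W' f'. nbd W' \<and> f' \<in> carrier (S W') \<and> chart_germ W f = chart_germ W' f' \<and> c = f' {} y"
  then obtain W' f' where W': "nbd W'" "f' \<in> carrier (S W')" "chart_germ W f = chart_germ W' f'" "c = f' {} y" by blast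
  obtain Z where Z: "nbd Z \<and> Z \<subseteq> W \<inter> W' \<and> (\<forall>I z. I \<subseteq> {..<q} \<longrightarrow> z \<in> Z \<longrightarrow> f I z = f' I z)"
    using chart_germ_eqD[OF assms(1) W'(1) assms(2) W'(2,3)] by (rule exE)
  then have "f {} y = f' {} y" by blast
  then show "c = f {} y" using W'(4) by simp
qed

lemma germ_value_mult:
  assumes "s \<in> carrier (stalk M x)" "t \<in> carrier (stalk M x)"
  shows "germ_value (s \<otimes>\<^bsub>stalk M x\<^esub> t) = germ_value s * germ_value t"
    and "germ_value (s \<oplus>\<^bsub>stalk M x\<^esub> t) = germ_value s + germ_value t"
proof -
  obtain W f g where W: "nbd W" "f \<in> carrier (S W)" "g \<in> carrier (S W)" "s = chart_germ W f" "t = chart_germ W g"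
    by (rule chart_germ_surj2[OF assms])
  note h = superalg_homD[OF chart_germ_hom[OF W(1)]]
  have oW: "openin (coord_space p) W" "y \<in> W" using W(1) by auto
  show "germ_value (s \<otimes>\<^bsub>stalk M x\<^esub> t) = germ_value s * germ_value t"
    unfolding W(4,5) h(2)[OF W(2,3), symmetric] germ_value[OF W(1,2)] germ_value[OF W(1,3)]
      germ_value[OF W(1) model_mult_closed[OF oW(1) W(2,3)]] using model_mult[OF oW(1) W(2,3) _ oW(2), of "{}"] by simp
  show "germ_value (s \<oplus>\<^bsub>stalk M x\<^esub> t) = germ_value s + germ_value t"
    unfolding W(4,5) h(3)[OF W(2,3), symmetric] germ_value[OF W(1,2)] germ_value[OF W(1,3)]
      germ_value[OF W(1) model_add_closed[OF oW(1) W(2,3)]] using model_add[of "{}" q y W f g] oW(2) by simp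
qed

lemma germ_value_smult:
  assumes "s \<in> carrier (stalk M x)"
  shows "germ_value (c \<odot>\<^bsub>stalk M x\<^esub> s) = c * germ_value s"
proof -
  obtain W f where W: "nbd W" "f \<in> carrier (S W)" "s = chart_germ W f" by (rule chart_germ_surj[OF assms])
  note h = superalg_homD[OF chart_germ_hom[OF W(1)]]
  have oW: "openin (coord_space p) W" "y \<in> W" using W(1) by auto
  show ?thesis
    unfolding W(3) h(5)[OF W(2), symmetric] germ_value[OF W(1,2)] germ_value[OF W(1) model_smult_closed[OF oW(1) W(2)]]
    using model_smult[of "{}" q y W c f] oW(2) by simp
qed

lemma germ_value_one: "germ_value \<one>\<^bsub>stalk M x\<^esub> = 1"
proof -
  have oV: "openin (coord_space p) V0" "y \<in> V0" using nbd_V0 by auto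
  show ?thesis
    unfolding superalg_homD(4)[OF chart_germ_hom[OF nbd_V0], symmetric] germ_value[OF nbd_V0 model_one_closed[OF oV(1)]]
    using model_one[of "{}" q y V0] oV(2) by simp
qed

sublocale stalk: superalg "stalk M x"
  by (rule superalgI[OF superalgebra_stalk])

definition "value_ideal = {s \<in> carrier (stalk M x). germ_value s = 0}"

lemma germ_value_zero: "germ_value \<zero>\<^bsub>stalk M x\<^esub> = 0"
  using germ_value_smult[of "\<one>\<^bsub>stalk M x\<^esub>" 0] by simp

lemma value_ideal: "ideal value_ideal (stalk M x)"
  by (rule stalk.idealI_superalg) (auto simp: value_ideal_def germ_value_mult germ_value_zero)

lemma value_ideal_codim:
  assumes s: "s \<in> carrier (stalk M x)"
  shows "s \<ominus>\<^bsub>stalk M x\<^esub> germ_value s \<odot>\<^bsub>stalk M x\<^esub> \<one>\<^bsub>stalk M x\<^esub> \<in> value_ideal"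
proof -
  have "s \<ominus>\<^bsub>stalk M x\<^esub> germ_value s \<odot>\<^bsub>stalk M x\<^esub> \<one>\<^bsub>stalk M x\<^esub> = s \<oplus>\<^bsub>stalk M x\<^esub> (- germ_value s) \<odot>\<^bsub>stalk M x\<^esub> \<one>\<^bsub>stalk M x\<^esub>"
    by (simp add: a_minus_def stalk.smult_minus_left)
  then show ?thesis
    using s by (simp add: value_ideal_def germ_value_mult germ_value_smult germ_value_one)
qed

lemma one_not_value_ideal: "\<one>\<^bsub>stalk M x\<^esub> \<notin> value_ideal"
  by (simp add: value_ideal_def germ_value_one)

lemma maximal_value_ideal: "maximalideal value_ideal (stalk M x)"
  by (rule stalk.maximalideal_codim_one[OF value_ideal one_not_value_ideal]) (use value_ideal_codim in blast)

text \<open>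
  The square of an odd germ is its own negative, so the value of the germ has square zero.
\<close>

lemma odd_subset_value_ideal: "odd_part (stalk M x) \<subseteq> value_ideal"
proof
  fix b assume b: "b \<in> odd_part (stalk M x)"
  have bc: "b \<in> carrier (stalk M x)" by (rule stalk.odd_carrier[OF b])
  have "b \<otimes>\<^bsub>stalk M x\<^esub> b = (- 1) \<odot>\<^bsub>stalk M x\<^esub> (b \<otimes>\<^bsub>stalk M x\<^esub> b)"
    using stalk.odd_anticommute[OF b b] stalk.smult_minus_left[of "b \<otimes>\<^bsub>stalk M x\<^esub> b" 1] bc by simp
  from arg_cong[OF this, of germ_value] have "germ_value b * germ_value b = - (germ_value b * germ_value b)"
    using bc by (simp add: germ_value_mult germ_value_smult)
  then have "germ_value b * germ_value b + germ_value b * germ_value b = 0"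
    by (rule eq_neg_iff_add_eq_0[THEN iffD1])
  then have "2 * (germ_value b * germ_value b) = 0" by (simp only: mult_2)
  then have "germ_value b = 0" by simp
  then show "b \<in> value_ideal" using bc unfolding value_ideal_def by blast
qed

lemma graded_value_ideal: "graded_ideal value_ideal (stalk M x)"
proof -
  interpret I: ideal value_ideal "stalk M x" by (rule value_ideal)
  have "value_ideal = (value_ideal \<inter> even_part (stalk M x)) <+>\<^bsub>stalk M x\<^esub> (value_ideal \<inter> odd_part (stalk M x))"
  proof
    show "value_ideal \<subseteq> (value_ideal \<inter> even_part (stalk M x)) <+>\<^bsub>stalk M x\<^esub> (value_ideal \<inter> odd_part (stalk M x))"
    proof
      fix s assume s: "s \<in> value_ideal"
      obtain a b where ab: "a \<in> even_part (stalk M x)" "b \<in> odd_part (stalk M x)" "s = a \<oplus>\<^bsub>stalk M x\<^esub> b"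
        by (rule stalk.even_odd_decomp[OF I.Icarr[OF s]])
      have b: "b \<in> value_ideal" using ab(2) odd_subset_value_ideal by blast
      have ac: "a \<in> carrier (stalk M x)" by (rule stalk.even_carrier[OF ab(1)])
      have "germ_value s = 0" "germ_value b = 0" using s b unfolding value_ideal_def by blast+
      then have "germ_value a = 0" using germ_value_mult(2)[OF ac I.Icarr[OF b]] unfolding ab(3) by simp
      then have "a \<in> value_ideal" using ac unfolding value_ideal_def by blast
      then show "s \<in> (value_ideal \<inter> even_part (stalk M x)) <+>\<^bsub>stalk M x\<^esub> (value_ideal \<inter> odd_part (stalk M x))"
        using ab b unfolding set_add_def' by blast
    qed
    show "(value_ideal \<inter> even_part (stalk M x)) <+>\<^bsub>stalk M x\<^esub> (value_ideal \<inter> odd_part (stalk M x)) \<subseteq> value_ideal"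
      using I.a_closed unfolding set_add_def' by blast
  qed
  then show ?thesis using value_ideal by (simp add: graded_ideal_def)
qed

lemma stalk_ideal_eq:
  assumes "\<exists>!I. maximalideal I (stalk M x)"
  shows "stalk_ideal M x = value_ideal"
  unfolding stalk_ideal_def by (rule the1_equality[OF assms maximal_value_ideal])

end

section \<open>Hadamard's lemma\<close>

context function_class
begin

lemma add': "openin (coord_space p) U \<Longrightarrow> (\<lambda>x\<in>U. f x) \<in> F p U \<Longrightarrow> (\<lambda>x\<in>U. g x) \<in> F p U \<Longrightarrow> (\<lambda>x\<in>U. f x + g x) \<in> F p U"
  using add[of U "\<lambda>x\<in>U. f x" "\<lambda>x\<in>U. g x"] by (simp cong: restrict_cong)

lemma mult': "openin (coord_space p) U \<Longrightarrow> (\<lambda>x\<in>U. f x) \<in> F p U \<Longrightarrow> (\<lambda>x\<in>U. g x) \<in> F p U \<Longrightarrow> (\<lambda>x\<in>U. f x * g x) \<in> F p U"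
  using mult[of U "\<lambda>x\<in>U. f x" "\<lambda>x\<in>U. g x"] by (simp cong: restrict_cong)

lemma restrict_self: "f \<in> F p U \<Longrightarrow> (\<lambda>x\<in>U. f x) \<in> F p U"
  using extensional_restrict[OF ext] by (metis (no_types))

lemma shifted_coord: "openin (coord_space p) U \<Longrightarrow> i < p \<Longrightarrow> (\<lambda>x\<in>U. x i - c) \<in> F p U"
  using add'[of U "\<lambda>x. x i" "\<lambda>x. - c"] coord[of U i] const[of U "- c"] by (simp only: diff_conv_add_uminus)

lemma sum_closed:
  assumes "openin (coord_space p) U" "\<And>i. i \<in> A \<Longrightarrow> (\<lambda>x\<in>U. f i x) \<in> F p U"
  shows "(\<lambda>x\<in>U. \<Sum>i\<in>A. f i x) \<in> F p U"
  using assms(2)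
proof (induction A rule: infinite_finite_induct)
  case (insert i A)
  from add'[OF assms(1) insert.prems[OF insertI1] insert.IH[OF insert.prems[OF insertI2]]]
  show ?case by (simp only: sum.insert[OF insert.hyps])
qed (use const[OF assms(1)] in simp_all)

lemma prod_closed:
  assumes "openin (coord_space p) U" "\<And>i. i \<in> A \<Longrightarrow> (\<lambda>x\<in>U. f i x) \<in> F p U"
  shows "(\<lambda>x\<in>U. \<Prod>i\<in>A. f i x) \<in> F p U"
  using assms(2)
proof (induction A rule: infinite_finite_induct)
  case (insert i A)
  from mult'[OF assms(1) insert.prems[OF insertI1] insert.IH[OF insert.prems[OF insertI2]]]
  show ?case by (simp only: prod.insert[OF insert.hyps])
qed (use const[OF assms(1)] in simp_all)

lemma power_closed:
  assumes "openin (coord_space p) U" "(\<lambda>x\<in>U. f x) \<in> F p U"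
  shows "(\<lambda>x\<in>U. f x ^ n) \<in> F p U"
proof (induction n)
  case (Suc n)
  from mult'[OF assms(1) assms(2) this] show ?case by (simp only: power_Suc)
next
  case 0
  from const[OF assms(1), of 1] show ?case by (simp only: power_0)
qed

lemma poly_eval_closed:
  assumes U: "openin (coord_space p) U"
  shows "(\<lambda>x\<in>U. poly_eval p P (\<lambda>i. x i - a i)) \<in> F p U"
  unfolding poly_eval_def monom_eval_def
  by (intro sum_closed prod_closed power_closed mult' const shifted_coord U) simp

text \<open>
  The first \<open>n\<close> coordinates of the argument are replaced by those of \<open>a\<close>, one after the other. The
  remaining function \<open>h\<close> has to be kept in the class, since the next division applies to it.
\<close>

lemma hadamard_aux:
  assumes a: "a \<in> topspace (coord_space p)" and r: "0 < r" and f: "f \<in> F p (polydisc p a r)" and n: "n \<le> p"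
  shows "\<exists>s g h. 0 < s \<and> s \<le> r \<and> h \<in> F p (polydisc p a s) \<and> (\<forall>i<n. g i \<in> F p (polydisc p a s)) \<and>
    (\<forall>z\<in>polydisc p a s. h z = f (\<lambda>i. if i < n then a i else z i) \<and> f z = h z + (\<Sum>i<n. (z i - a i) * g i z))"
  using n
proof (induction n)
  case 0
  show ?case using r f by (intro exI[of _ r] exI[of _ "\<lambda>_. f"] exI[of _ f]) simp
next
  case (Suc n)
  obtain s g h where s: "0 < s" "s \<le> r" and h: "h \<in> F p (polydisc p a s)" and g: "\<And>i. i < n \<Longrightarrow> g i \<in> F p (polydisc p a s)"
    and hz: "\<And>z. z \<in> polydisc p a s \<Longrightarrow> h z = f (\<lambda>i. if i < n then a i else z i)"
    and fz: "\<And>z. z \<in> polydisc p a s \<Longrightarrow> f z = h z + (\<Sum>i<n. (z i - a i) * g i z)"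
  proof -
    have "n \<le> p" using Suc.prems by simp
    from Suc.IH[OF this] obtain s g h where *: "0 < s \<and> s \<le> r \<and> h \<in> F p (polydisc p a s) \<and>
        (\<forall>i<n. g i \<in> F p (polydisc p a s)) \<and>
        (\<forall>z\<in>polydisc p a s. h z = f (\<lambda>i. if i < n then a i else z i) \<and> f z = h z + (\<Sum>i<n. (z i - a i) * g i z))"
      by (elim exE)
    show thesis by (rule that[of s h g]) (use * in blast)+
  qed
  obtain s' k where s': "0 < s'" "s' \<le> s" and k: "k \<in> F p (polydisc p a s')"
    and kz': "\<forall>z\<in>polydisc p a s'. h z = h (z(n := a n)) + (z n - a n) * k z"
    using divide[OF a s(1) Suc_le_lessD[OF Suc.prems] h] by (elim exE conjE bexE) (rule that)
  note kz = bspec[OF kz']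
  let ?D = "polydisc p a s'"
  have D: "?D \<subseteq> polydisc p a s" by (rule polydisc_mono[OF s'(2)])
  note res = restrict[OF openin_polydisc openin_polydisc D]
  have m1: "(\<lambda>z\<in>?D. h z + (- 1) * ((z n - a n) * k z)) \<in> F p ?D"
    using Suc.prems by (intro add' mult' const shifted_coord restrict_self[OF k] res[OF h] openin_polydisc) simp
  have m2: "\<forall>i<Suc n. (if i < n then restrict (g i) ?D else k) \<in> F p ?D" using res[OF g] k by simp
  have m3: "(\<lambda>z\<in>?D. h z + (- 1) * ((z n - a n) * k z)) z = f (\<lambda>i. if i < Suc n then a i else z i) \<and>
      f z = (\<lambda>z\<in>?D. h z + (- 1) * ((z n - a n) * k z)) z + (\<Sum>i<Suc n. (z i - a i) * (if i < n then restrict (g i) ?D else k) z)"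
    if z: "z \<in> ?D" for z
  proof
    have zs: "z \<in> polydisc p a s" using z D by blast
    have "z(n := a n) \<in> polydisc p a s" using upd_in_polydisc[OF zs, of n "a n"] Suc.prems s(1) by simp
    moreover have "(\<lambda>i. if i < n then a i else (z(n := a n)) i) = (\<lambda>i. if i < Suc n then a i else z i)"
      by (auto simp: fun_eq_iff less_Suc_eq)
    ultimately have "h (z(n := a n)) = f (\<lambda>i. if i < Suc n then a i else z i)" using hz by simp
    then show "(\<lambda>z\<in>?D. h z + (- 1) * ((z n - a n) * k z)) z = f (\<lambda>i. if i < Suc n then a i else z i)"
      using kz[OF z] z by simp
    have "(\<Sum>i<n. (z i - a i) * (if i < n then restrict (g i) ?D else k) z) = (\<Sum>i<n. (z i - a i) * g i z)"
      using z by (intro sum.cong) auto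
    then show "f z = (\<lambda>z\<in>?D. h z + (- 1) * ((z n - a n) * k z)) z + (\<Sum>i<Suc n. (z i - a i) * (if i < n then restrict (g i) ?D else k) z)"
      using fz[OF zs] z by (simp add: algebra_simps)
  qed
  show ?case
    by (intro exI[of _ s'] exI[of _ "\<lambda>i. if i < n then restrict (g i) ?D else k"]
        exI[of _ "\<lambda>z\<in>?D. h z + (- 1) * ((z n - a n) * k z)"] conjI s'(1) order_trans[OF s'(2) s(2)] m1 m2 ballI)
      (rule m3[THEN conjunct1] m3[THEN conjunct2], assumption)+
qed

lemma hadamard:
  assumes a: "a \<in> topspace (coord_space p)" and r: "0 < r" and f: "f \<in> F p (polydisc p a r)"
  shows "\<exists>s g. 0 < s \<and> s \<le> r \<and> (\<forall>i<p. g i \<in> F p (polydisc p a s)) \<and>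
    (\<forall>z\<in>polydisc p a s. f z = f a + (\<Sum>i<p. (z i - a i) * g i z))"
proof -
  obtain s g h where s: "0 < s" "s \<le> r" and g: "\<forall>i<p. g i \<in> F p (polydisc p a s)"
    and fz: "\<forall>z\<in>polydisc p a s. h z = f (\<lambda>i. if i < p then a i else z i) \<and> f z = h z + (\<Sum>i<p. (z i - a i) * g i z)"
    using hadamard_aux[OF a r f order_refl] by blast
  have "(\<lambda>i. if i < p then a i else z i) = a" if "z \<in> polydisc p a s" for z
    using that a by (auto simp: polydisc_def PiE_def extensional_def fun_eq_iff)
  then have "\<forall>z\<in>polydisc p a s. f z = f a + (\<Sum>i<p. (z i - a i) * g i z)" using fz by simp
  then show ?thesis using s g by blast
qed

end

section \<open>Orders of vanishing\<close>

lemma power_bigo_power: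
  assumes "m \<le> n"
  shows "(\<lambda>t :: 'k::real_normed_field. t ^ n) \<in> O[at 0](\<lambda>t. t ^ m)"
proof (rule landau_o.bigI[where c = 1])
  have "norm (t ^ n) \<le> 1 * norm (t ^ m)" if "norm t < 1" for t :: 'k
    using power_decreasing[OF assms, of "norm t"] that by (simp add: norm_power)
  then show "\<forall>\<^sub>F t :: 'k in at 0. norm (t ^ n) \<le> 1 * norm (t ^ m)"
    by (auto simp: eventually_at dist_norm intro!: exI[of _ 1])
qed simp

text \<open>
  A bound for \<open>N > 0\<close> forces a zero at the origin, which can be divided out of both sides.
\<close>

lemma poly_bigo_coeff_zero:
  fixes Q :: "'k::real_normed_field poly"
  assumes "(\<lambda>t. poly Q t) \<in> O[at 0](\<lambda>t. t ^ N)" "j < N"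
  shows "Polynomial.coeff Q j = 0"
  using assms
proof (induction N arbitrary: Q j)
  case 0
  then show ?case by (meson not_less_zero)
next
  case (Suc N)
  obtain c Q' where Q: "Q = pCons c Q'" by (cases Q)
  obtain C where C: "0 < C" "\<forall>\<^sub>F t in at 0. norm (poly Q t) \<le> C * norm (t ^ Suc N)"
    using Suc.prems(1) by (rule landau_o.bigE)
  have "((\<lambda>t :: 'k. C * norm (t ^ Suc N)) \<longlongrightarrow> C * norm ((0 :: 'k) ^ Suc N)) (at 0)"
    by (intro tendsto_intros)
  then have "((\<lambda>t :: 'k. C * norm (t ^ Suc N)) \<longlongrightarrow> 0) (at 0)" by simp
  then have "((\<lambda>t. poly Q t) \<longlongrightarrow> 0) (at 0)" by (rule Lim_null_comparison[OF C(2)])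
  moreover have "((\<lambda>t. poly Q t) \<longlongrightarrow> poly Q 0) (at 0)" using poly_isCont[where p = Q and x = 0] by (simp add: isCont_def)
  ultimately have "poly Q 0 = 0" using tendsto_unique by (metis trivial_limit_at)
  then have c: "c = 0" by (simp add: Q)
  have "\<forall>\<^sub>F t in at 0. norm (poly Q' t) \<le> C * norm (t ^ N)"
    using C(2) eventually_neq_at_within[of 0 0 UNIV]
  proof eventually_elim
    case (elim t)
    then have "norm t * norm (poly Q' t) \<le> norm t * (C * norm (t ^ N))"
      by (simp add: Q c norm_mult mult_ac)
    then show ?case using elim(2) by (simp add: mult_le_cancel_left)
  qed
  then have "(\<lambda>t. poly Q' t) \<in> O[at 0](\<lambda>t. t ^ N)" using C(1) by (intro landau_o.bigI)
  then show ?case using Suc.IH[of Q'] Suc.prems(2) c by (cases j) (simp_all add: Q)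
qed

lemma digits_inject:
  fixes b c :: "nat \<Rightarrow> nat"
  assumes "\<And>i. i < p \<Longrightarrow> b i < B" "\<And>i. i < p \<Longrightarrow> c i < B" "(\<Sum>i<p. b i * B ^ i) = (\<Sum>i<p. c i * B ^ i)"
  shows "\<forall>i<p. b i = c i"
  using assms
proof (induction p arbitrary: b c)
  case (Suc p)
  have split: "(\<Sum>i<Suc p. b i * B ^ i) = b 0 + B * (\<Sum>i<p. b (Suc i) * B ^ i)" for b :: "nat \<Rightarrow> nat"
    by (simp add: sum.lessThan_Suc_shift sum_distrib_left mult_ac del: sum.lessThan_Suc)
  have eq: "b 0 + B * (\<Sum>i<p. b (Suc i) * B ^ i) = c 0 + B * (\<Sum>i<p. c (Suc i) * B ^ i)"
    using Suc.prems(3) unfolding split .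
  have bc: "b 0 < B" "c 0 < B" using Suc.prems(1,2) by auto
  from arg_cong[OF eq, of "\<lambda>n. n mod B"] have 0: "b 0 = c 0" using bc by simp
  then have "(\<Sum>i<p. b (Suc i) * B ^ i) = (\<Sum>i<p. c (Suc i) * B ^ i)" using eq bc by simp
  then have "\<forall>i<p. b (Suc i) = c (Suc i)"
    by (intro Suc.IH[of "\<lambda>i. b (Suc i)" "\<lambda>i. c (Suc i)"] Suc.prems(1,2) Suc_mono)
  moreover have "i = 0 \<or> (\<exists>k<p. i = Suc k)" if "i < Suc p" for i using that by (cases i) simp_all
  ultimately show ?case using 0 by blast
qed simp

context chart_at
begin

text \<open>
  Along such a curve the order of vanishing of a germ of several variables becomes a comparison with
  powers of a single variable. The weights keep the coordinates apart.
\<close>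

definition curve :: "(nat \<Rightarrow> nat) \<Rightarrow> 'k \<Rightarrow> nat \<Rightarrow> 'k" where
  "curve w t = (\<lambda>i\<in>{..<p}. y i + t ^ w i)"

lemma curve_continuous: "continuous_on UNIV (curve w)"
proof (rule continuous_on_coordinatewise_then_product)
  show "continuous_on UNIV (\<lambda>t. curve w t i)" for i
    by (cases "i < p") (auto simp: curve_def intro!: continuous_intros)
qed

lemma curve_0: assumes "\<forall>i<p. 0 < w i" shows "curve w 0 = y"
proof
  fix i
  have "y \<in> {..<p} \<rightarrow>\<^sub>E UNIV" using y_topspace by simp
  then show "curve w 0 i = y i"
    using assms PiE_arb[of y "{..<p}" "\<lambda>_. UNIV" i] by (cases "i < p") (simp_all add: curve_def)
qed

lemma curve_tendsto: assumes "\<forall>i<p. 0 < w i" shows "(curve w \<longlongrightarrow> y) (at 0)"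
proof -
  have "(curve w \<longlongrightarrow> curve w 0) (at 0)" using curve_continuous[of w] unfolding continuous_on_def by simp
  then show ?thesis unfolding curve_0[OF assms] .
qed

lemma eventually_curve:
  assumes w: "\<forall>i<p. 0 < w i" and W: "nbd W"
  shows "eventually (\<lambda>t. curve w t \<in> W) (at 0)"
proof -
  have "continuous_map euclidean (coord_space p) (curve w)"
    unfolding coord_space_def continuous_map_componentwise
  proof (intro conjI ballI)
    show "curve w ` topspace euclidean \<subseteq> extensional {..<p}" by (auto simp: curve_def)
    show "continuous_map euclidean euclidean (\<lambda>t. curve w t k)" if "k \<in> {..<p}" for k
      using continuous_on_product_then_coordinatewise[OF curve_continuous, of w k] by simp
  qed
  from openin_continuous_map_preimage[OF this, of W] have "open {t. curve w t \<in> W}" using W by simp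
  from eventually_nhds_in_open[OF this, of 0] have "eventually (\<lambda>t. t \<in> {t. curve w t \<in> W}) (nhds 0)"
    using curve_0[OF w] W by simp
  then show ?thesis unfolding eventually_at_filter by (rule eventually_mono) simp
qed

lemma section_along_curve:
  assumes w: "\<forall>i<p. 0 < w i" and W: "nbd W" and u: "u \<in> F p W"
  shows "((\<lambda>t. u (curve w t)) \<longlongrightarrow> u y) (at 0)"
proof -
  have "W \<subseteq> topspace (coord_space p)" using W openin_subset by blast
  from continuous_map_coord_space_iff[OF this] have "continuous_on W u" using cont[OF _ u] W by blast
  then show ?thesis
    by (rule continuous_on_tendsto_compose[OF _ curve_tendsto[OF w] _ eventually_curve[OF w W]])
      (use W in simp_all)
qed

lemma section_bounded_along_curve:
  assumes "\<forall>i<p. 0 < w i" "nbd W" "u \<in> F p W"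
  shows "(\<lambda>t. u (curve w t)) \<in> O[at 0](\<lambda>t. 1)"
  using section_along_curve[OF assms] by (intro bigoI_tendsto[where c = "u y"]) auto

text \<open>
  An odd variable counts as degree one, so that the coefficient of \<open>\<theta>\<^sub>I\<close> has to contribute only
  \<open>n - card I\<close>, and nothing if \<open>n \<le> card I\<close>. An even variable vanishes at least to
  order \<open>K\<close> along the curve if all weights are at least \<open>K\<close>; hence the factor \<open>K\<close>.
\<close>

definition "order_at_least w K n f \<longleftrightarrow>
  (\<forall>I. I \<subseteq> {..<q} \<longrightarrow> (\<lambda>t. f I (curve w t)) \<in> O[at 0](\<lambda>t. t ^ (K * (n - card I))))"

lemma order_at_least_cong:
  assumes w: "\<forall>i<p. 0 < w i" and Z: "nbd Z" and eq: "\<And>I z. I \<subseteq> {..<q} \<Longrightarrow> z \<in> Z \<Longrightarrow> f I z = g I z"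
    and f: "order_at_least w K n f"
  shows "order_at_least w K n g"
  unfolding order_at_least_def
proof (intro allI impI)
  fix I :: "nat set" assume I: "I \<subseteq> {..<q}"
  have "\<forall>\<^sub>F t in at 0. f I (curve w t) = g I (curve w t)"
    using eventually_curve[OF w Z] by eventually_elim (rule eq[OF I])
  from landau_o.big.in_cong[OF this] show "(\<lambda>t. g I (curve w t)) \<in> O[at 0](\<lambda>t. t ^ (K * (n - card I)))"
    using f I unfolding order_at_least_def by blast
qed

definition "germ_order w K n s \<longleftrightarrow> (\<exists>W f. nbd W \<and> f \<in> carrier (S W) \<and> s = chart_germ W f \<and> order_at_least w K n f)"

lemma germ_order_common:
  assumes w: "\<forall>i<p. 0 < w i" and "germ_order w K m s" "germ_order w K n t"
  shows "\<exists>W f g. nbd W \<and> f \<in> carrier (S W) \<and> g \<in> carrier (S W) \<and> s = chart_germ W f \<and> t = chart_germ W g \<and>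
    order_at_least w K m f \<and> order_at_least w K n g"
proof -
  obtain W f where W: "nbd W" "f \<in> carrier (S W)" "s = chart_germ W f" "order_at_least w K m f"
    using assms(2) unfolding germ_order_def by blast
  obtain W' g where W': "nbd W'" "g \<in> carrier (S W')" "t = chart_germ W' g" "order_at_least w K n g"
    using assms(3) unfolding germ_order_def by blast
  let ?Z = "W \<inter> W'"
  have Z: "nbd ?Z" using nbd_Int W(1) W'(1) by blast
  have "order_at_least w K m (rs ?Z f)" by (rule order_at_least_cong[OF w Z _ W(4)]) (simp add: rs_apply)
  moreover have "order_at_least w K n (rs ?Z g)" by (rule order_at_least_cong[OF w Z _ W'(4)]) (simp add: rs_apply)
  ultimately show ?thesis
    using Z rs_closed[OF W(1) Z _ W(2)] rs_closed[OF W'(1) Z _ W'(2)] W(3) W'(3)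
      chart_germ_restr[OF W(1) Z _ W(2)] chart_germ_restr[OF W'(1) Z _ W'(2)]
    by (intro exI[of _ ?Z] exI[of _ "rs ?Z f"] exI[of _ "rs ?Z g"]) simp
qed

lemma germ_order_add:
  assumes w: "\<forall>i<p. 0 < w i" and "germ_order w K n s" "germ_order w K n t"
  shows "germ_order w K n (s \<oplus>\<^bsub>stalk M x\<^esub> t)"
proof -
  obtain W f g where W: "nbd W" "f \<in> carrier (S W)" "g \<in> carrier (S W)" "s = chart_germ W f" "t = chart_germ W g"
    and o: "order_at_least w K n f" "order_at_least w K n g"
    using germ_order_common[OF assms] by blast
  have "order_at_least w K n (\<lambda>I z. f I z + g I z)"
    using o unfolding order_at_least_def by (intro allI impI sum_in_bigo) blast+
  from order_at_least_cong[OF w W(1) _ this, of "f \<oplus>\<^bsub>S W\<^esub> g"]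
  have "order_at_least w K n (f \<oplus>\<^bsub>S W\<^esub> g)" by (simp add: model_add)
  then show ?thesis
    unfolding germ_order_def W(4,5) superalg_homD(3)[OF chart_germ_hom[OF W(1)] W(2,3), symmetric]
    using model_add_closed[OF _ W(2,3)] W(1) by blast
qed

text \<open>
  The product of the coefficients of \<open>\<theta>\<^sub>J\<close> and \<open>\<theta>\<^sub>L\<close> contributes to \<open>\<theta>\<^sub>J\<^sub>\<union>\<^sub>L\<close> with \<open>card J + card L\<close> odd
  variables, and \<open>(m + n) - (j + l) \<le> (m - j) + (n - l)\<close> also for truncated differences.
\<close>

lemma germ_order_mult:
  assumes w: "\<forall>i<p. 0 < w i" and "germ_order w K m s" "germ_order w K n t"
  shows "germ_order w K (m + n) (s \<otimes>\<^bsub>stalk M x\<^esub> t)"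
proof -
  obtain W f g where W: "nbd W" "f \<in> carrier (S W)" "g \<in> carrier (S W)" "s = chart_germ W f" "t = chart_germ W g"
    and o: "order_at_least w K m f" "order_at_least w K n g"
    using germ_order_common[OF assms] by blast
  have "order_at_least w K (m + n) (\<lambda>I z. gmult (\<lambda>J. f J z) (\<lambda>J. g J z) I)"
    unfolding order_at_least_def gmult_def
  proof (intro allI impI big_sum_in_bigo)
    fix I J :: "nat set" assume I: "I \<subseteq> {..<q}" and "J \<in> Pow I"
    then have J: "J \<subseteq> {..<q}" "I - J \<subseteq> {..<q}" "J \<subseteq> I" by auto
    have fin: "finite I" using I finite_subset by blast
    have "card I = card J + card (I - J)"
      using card_Un_disjoint[of J "I - J"] J(3) fin finite_subset[OF J(3) fin] by (simp add: Un_absorb1)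
    then have le: "K * (m + n - card I) \<le> K * (m - card J) + K * (n - card (I - J))"
      unfolding add_mult_distrib2[symmetric] by (intro mult_le_mono2) arith
    have "(\<lambda>t. f J (curve w t) * g (I - J) (curve w t)) \<in> O[at 0](\<lambda>t. t ^ (K * (m - card J)) * t ^ (K * (n - card (I - J))))"
      using o J unfolding order_at_least_def by (intro landau_o.big.mult) auto
    then have "(\<lambda>t. f J (curve w t) * g (I - J) (curve w t)) \<in> O[at 0](\<lambda>t. t ^ (K * (m - card J) + K * (n - card (I - J))))"
      by (simp only: power_add)
    from landau_o.big_trans[OF this power_bigo_power[OF le]]
    have *: "(\<lambda>t. f J (curve w t) * g (I - J) (curve w t)) \<in> O[at 0](\<lambda>t. t ^ (K * (m + n - card I)))" .
    have "(\<lambda>t. shuffle_sign J (I - J) * (f J (curve w t) * g (I - J) (curve w t))) \<in> O[at 0](\<lambda>t. t ^ (K * (m + n - card I)))"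
      using * by (simp add: shuffle_sign_def)
    then show "(\<lambda>t. shuffle_sign J (I - J) * f J (curve w t) * g (I - J) (curve w t)) \<in> O[at 0](\<lambda>t. t ^ (K * (m + n - card I)))"
      by (simp only: mult.assoc)
  qed
  from order_at_least_cong[OF w W(1) _ this, of "f \<otimes>\<^bsub>S W\<^esub> g"]
  have "order_at_least w K (m + n) (f \<otimes>\<^bsub>S W\<^esub> g)" using W(1-3) by (simp add: model_mult)
  then show ?thesis
    unfolding germ_order_def W(4,5) superalg_homD(2)[OF chart_germ_hom[OF W(1)] W(2,3), symmetric]
    using model_mult_closed[OF _ W(2,3)] W(1) by blast
qed

lemma germ_order_0:
  assumes w: "\<forall>i<p. 0 < w i" and s: "s \<in> carrier (stalk M x)"
  shows "germ_order w K 0 s"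
proof -
  obtain W f where W: "nbd W" "f \<in> carrier (S W)" "s = chart_germ W f" by (rule chart_germ_surj[OF s])
  have "order_at_least w K 0 f"
    unfolding order_at_least_def using section_bounded_along_curve[OF w W(1) model_coeff[OF W(2)]] by simp
  then show ?thesis unfolding germ_order_def using W by blast
qed

text \<open>
  Only the component without odd variables has to vanish along the curve. By Hadamard's lemma
  it is a combination of the \<open>z\<^sub>i - y\<^sub>i\<close>, which are \<open>t ^ w i\<close> on the curve, with bounded coefficients.
\<close>

lemma germ_order_1:
  assumes w: "\<forall>i<p. 0 < w i" and K: "\<forall>i<p. K \<le> w i" and s: "s \<in> value_ideal"
  shows "germ_order w K 1 s"
proof -
  have sc: "s \<in> carrier (stalk M x)" and sv: "germ_value s = 0" using s unfolding value_ideal_def by blast+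
  obtain W f where W: "nbd W" "f \<in> carrier (S W)" "s = chart_germ W f" by (rule chart_germ_surj[OF sc])
  have fy: "f {} y = 0" using sv germ_value[OF W(1,2)] W(3) by simp
  obtain r where r: "0 < r" "polydisc p y r \<subseteq> W" using polydisc_subset_open[of p W y] W(1) by blast
  have "restrict (f {}) (polydisc p y r) \<in> F p (polydisc p y r)"
    using restrict[OF _ openin_polydisc r(2) model_coeff[OF W(2)]] W(1) by blast
  from hadamard[OF y_topspace r(1) this]
  obtain d g where d: "0 < d" "d \<le> r" and g: "\<And>i. i < p \<Longrightarrow> g i \<in> F p (polydisc p y d)"
    and fz: "\<And>z. z \<in> polydisc p y d \<Longrightarrow> restrict (f {}) (polydisc p y r) z =
       restrict (f {}) (polydisc p y r) y + (\<Sum>i<p. (z i - y i) * g i z)" by blast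
  have yr: "y \<in> polydisc p y r" by (rule polydisc_center[OF y_topspace r(1)])
  have D: "polydisc p y d \<subseteq> polydisc p y r" by (rule polydisc_mono[OF d(2)])
  have nD: "nbd (polydisc p y d)"
    using openin_polydisc polydisc_center[OF y_topspace d(1)] D r(2) W(1) by auto
  have ev: "\<forall>\<^sub>F t in at 0. f {} (curve w t) = (\<Sum>i<p. t ^ w i * g i (curve w t))"
    using eventually_curve[OF w nD]
  proof eventually_elim
    case (elim t)
    then have "curve w t \<in> polydisc p y r" using D by blast
    with fz[OF elim] have "f {} (curve w t) = (\<Sum>i<p. (curve w t i - y i) * g i (curve w t))"
      using yr fy by simp
    then show ?case by (simp add: curve_def)
  qed
  have "(\<lambda>t. \<Sum>i<p. t ^ w i * g i (curve w t)) \<in> O[at 0](\<lambda>t. t ^ K)"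
  proof (rule big_sum_in_bigo)
    fix i assume "i \<in> {..<p}"
    then have i: "i < p" by simp
    have "(\<lambda>t. t ^ w i * g i (curve w t)) \<in> O[at 0](\<lambda>t. t ^ K * 1)"
      using power_bigo_power[of K "w i"] K i section_bounded_along_curve[OF w nD g[OF i]]
      by (intro landau_o.big.mult) simp_all
    then show "(\<lambda>t. t ^ w i * g i (curve w t)) \<in> O[at 0](\<lambda>t. t ^ K)" by simp
  qed
  then have e: "(\<lambda>t. f {} (curve w t)) \<in> O[at 0](\<lambda>t. t ^ K)"
    by (subst landau_o.big.in_cong[OF ev])
  have "(\<lambda>t. f I (curve w t)) \<in> O[at 0](\<lambda>t. t ^ (K * (1 - card I)))" if I: "I \<subseteq> {..<q}" for I
  proof (cases "I = {}")
    case False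
    then have "1 - card I = 0" using I finite_subset[OF I] by (simp add: Suc_leI card_gt_0_iff)
    then show ?thesis using section_bounded_along_curve[OF w W(1) model_coeff[OF W(2) I]] by simp
  qed (use e in simp)
  then show ?thesis unfolding germ_order_def order_at_least_def using W by blast
qed

text \<open>
  Orders of vanishing add up under multiplication, so powers of the ideal have high order.
\<close>

lemma germ_order_ideal_power:
  assumes w: "\<forall>i<p. 0 < w i" and K: "\<forall>i<p. K \<le> w i"
  shows "s \<in> ideal_power (stalk M x) value_ideal n \<Longrightarrow> germ_order w K n s"
proof (induction n arbitrary: s)
  case 0
  then show ?case using germ_order_0[OF w] by simp
next
  case (Suc n)
  from Suc.prems have "s \<in> ideal_power (stalk M x) value_ideal n \<cdot>\<^bsub>stalk M x\<^esub> value_ideal" by simp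
  then show ?case
  proof induction
    case (prod a b)
    have "germ_order w K (n + 1) (a \<otimes>\<^bsub>stalk M x\<^esub> b)"
      by (rule germ_order_mult[OF w Suc.IH[OF prod(1)] germ_order_1[OF w K prod(2)]])
    then show ?case by simp
  next
    case (sum a b)
    then show ?case by (intro germ_order_add[OF w])
  qed
qed

end

section \<open>Germs of polynomials\<close>

lemma poly_eval_gmult: "poly_eval p (gmult P Q I) z = gmult (\<lambda>J. poly_eval p (P J) z) (\<lambda>J. poly_eval p (Q J) z) I"
proof -
  have m1: "poly_eval p (- 1) z = - 1" using poly_eval_single[of p 0 "- 1" z] by (simp add: single_uminus)
  have "poly_eval p ((- 1) ^ n) z = (- 1) ^ n" for n
    by (induction n) (simp_all add: poly_eval_mult m1 del: mult_minus_left mult_minus1)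
  then show ?thesis by (simp add: gmult_def poly_eval_sum poly_eval_mult shuffle_sign_def)
qed

context chart_at
begin

definition "poly_section W P = (\<lambda>I\<in>Pow {..<q}. \<lambda>z\<in>W. poly_eval p (P I) (\<lambda>i. z i - y i))"

definition "poly_germ P = chart_germ V0 (poly_section V0 P)"

lemma poly_section_apply: "I \<subseteq> {..<q} \<Longrightarrow> z \<in> W \<Longrightarrow> poly_section W P I z = poly_eval p (P I) (\<lambda>i. z i - y i)"
  by (simp add: poly_section_def)

lemma poly_section_closed: "openin (coord_space p) W \<Longrightarrow> poly_section W P \<in> carrier (S W)"
  unfolding model_carrier poly_section_def by (simp add: poly_eval_closed)

lemma poly_germ_eq_chart_germ:
  assumes "nbd W" "f \<in> carrier (S W)" "\<And>I z. I \<subseteq> {..<q} \<Longrightarrow> z \<in> W \<Longrightarrow> f I z = poly_eval p (P I) (\<lambda>i. z i - y i)"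
  shows "chart_germ W f = poly_germ P"
  unfolding poly_germ_def
proof (rule chart_germ_eqI[OF assms(1) nbd_V0 assms(2) poly_section_closed[OF V0] assms(1)])
  show "W \<subseteq> W \<inter> V0" using assms(1) by blast
  show "f I z = poly_section V0 P I z" if "I \<subseteq> {..<q}" "z \<in> W" for I z
    using assms that by (subst poly_section_apply) auto
qed

lemma poly_section_hom: "poly_section V0 \<in> superalg_hom (poly_superalg p q) (S V0)"
proof -
  let ?B = "poly_superalg p q :: ('k, _) superalg"
  have mult: "poly_section V0 (P \<otimes>\<^bsub>?B\<^esub> Q) = poly_section V0 P \<otimes>\<^bsub>S V0\<^esub> poly_section V0 Q"
    if PQ: "P \<in> carrier ?B" "Q \<in> carrier ?B" for P Q
  proof (rule model_eqI[OF poly_section_closed[OF V0] model_mult_closed[OF V0 poly_section_closed[OF V0] poly_section_closed[OF V0]]])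
    fix I z assume I: "I \<subseteq> {..<q}" and z: "z \<in> V0"
    have "gmult (\<lambda>J. poly_section V0 P J z) (\<lambda>J. poly_section V0 Q J z) I =
       gmult (\<lambda>J. poly_eval p (P J) (\<lambda>i. z i - y i)) (\<lambda>J. poly_eval p (Q J) (\<lambda>i. z i - y i)) I"
      using I z by (intro gmult_cong poly_section_apply) auto
    then show "poly_section V0 (P \<otimes>\<^bsub>?B\<^esub> Q) I z = (poly_section V0 P \<otimes>\<^bsub>S V0\<^esub> poly_section V0 Q) I z"
      by (simp add: poly_section_apply[OF I z] poly_superalg_mult[OF PQ I] poly_eval_gmult
          model_mult[OF V0 poly_section_closed[OF V0] poly_section_closed[OF V0] I z])
  qed
  have add: "poly_section V0 (P \<oplus>\<^bsub>?B\<^esub> Q) = poly_section V0 P \<oplus>\<^bsub>S V0\<^esub> poly_section V0 Q" for P Q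
    by (rule model_eqI[OF poly_section_closed[OF V0] model_add_closed[OF V0 poly_section_closed[OF V0] poly_section_closed[OF V0]]])
      (simp add: poly_section_apply poly_superalg_add poly_eval_add model_add)
  have one: "poly_section V0 \<one>\<^bsub>?B\<^esub> = \<one>\<^bsub>S V0\<^esub>"
    by (rule model_eqI[OF poly_section_closed[OF V0] model_one_closed[OF V0]])
      (simp add: poly_section_apply poly_superalg_one model_one)
  have smult: "poly_section V0 (c \<odot>\<^bsub>?B\<^esub> P) = c \<odot>\<^bsub>S V0\<^esub> poly_section V0 P" for c P
    by (rule model_eqI[OF poly_section_closed[OF V0] model_smult_closed[OF V0 poly_section_closed[OF V0]]])
      (simp add: poly_section_apply poly_superalg_smult poly_eval_mult model_smult)
  have zero: "poly_section V0 P I = \<zero>\<^bsub>function_algebra V0 (F p V0)\<^esub>" if "P I = 0" "I \<subseteq> {..<q}" for P I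
    using that by (simp add: poly_section_def function_algebra_def)
  have parts: "poly_section V0 ` even_part ?B \<subseteq> even_part (S V0)" "poly_section V0 ` odd_part ?B \<subseteq> odd_part (S V0)"
    using poly_section_closed[OF V0] zero unfolding poly_superalg_even poly_superalg_odd
    by (auto simp: grassmann_def)
  show ?thesis
    unfolding superalg_hom_def ring_hom_def
    using poly_section_closed[OF V0] mult add one smult parts by blast
qed

lemma poly_germ_hom: "poly_germ \<in> superalg_hom (poly_superalg p q) (stalk M x)"
  unfolding poly_germ_def[abs_def] by (rule superalg_hom_compose[OF poly_section_hom chart_germ_hom[OF nbd_V0]])

lemma germ_value_poly_germ: "germ_value (poly_germ P) = poly_eval p (P {}) (\<lambda>_. 0)"
  unfolding poly_germ_def germ_value[OF nbd_V0 poly_section_closed[OF V0]]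
  using nbd_V0 by (simp add: poly_section_apply)

lemma poly_germ_no_const: "poly_germ ` poly_no_const p q \<subseteq> value_ideal"
  using superalg_homD(1)[OF poly_germ_hom] germ_value_poly_germ
  by (auto simp: value_ideal_def poly_no_const_iff)

text \<open>
  Suppose that \<open>P\<close> has a monomial \<open>m0 \<theta>\<^sub>I\<close> of degree less than \<open>n\<close>. On the curve with weights
  \<open>w i = K + B ^ i\<close> a monomial \<open>m\<close> becomes \<open>t\<close> to the power \<open>e m = K * deg m + r m\<close>, where \<open>r m\<close> is the
  number whose base-\<open>B\<close> digits are the exponents of \<open>m\<close>. Here \<open>B\<close> exceeds every exponent that occurs
  and \<open>K\<close> every \<open>r m\<close>. So \<open>e m mod K\<close> determines \<open>m\<close>, no two monomials interfere, and \<open>e m0\<close> is below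
  \<open>K * (n - card I)\<close>, the order to which the coefficient of \<open>\<theta>\<^sub>I\<close> has to vanish.
\<close>

lemma poly_germ_reflects_power:
  assumes P: "P \<in> carrier (poly_superalg p q)" and Pn: "poly_germ P \<in> ideal_power (stalk M x) value_ideal n"
  shows "P \<in> ideal_power (poly_superalg p q) (poly_no_const p q) n"
proof (rule poly_in_power[OF P], rule ccontr)
  fix I m0 assume I: "I \<subseteq> {..<q}" and m0: "m0 \<in> Poly_Mapping.keys (P I)" and "\<not> n \<le> total_degree p m0 + card I"
  then have deg: "total_degree p m0 + 1 \<le> n - card I" by simp
  let ?Ks = "Poly_Mapping.keys (P I)"
  define B where "B = Suc (\<Sum>m\<in>?Ks. \<Sum>i<p. Poly_Mapping.lookup m i)"
  define r where "r m = (\<Sum>i<p. Poly_Mapping.lookup m i * B ^ i)" for m :: "nat \<Rightarrow>\<^sub>0 nat"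
  define K where "K = Suc (\<Sum>m\<in>?Ks. r m)"
  define w where "w i = K + B ^ i" for i
  define e where "e m = (\<Sum>i<p. w i * Poly_Mapping.lookup m i)" for m :: "nat \<Rightarrow>\<^sub>0 nat"
  have rK: "r m < K" if "m \<in> ?Ks" for m
    unfolding K_def using member_le_sum[OF that, of r] by (simp add: less_Suc_eq_le)
  have digit: "Poly_Mapping.lookup m i < B" if m: "m \<in> ?Ks" and i: "i < p" for m i
  proof -
    have "Poly_Mapping.lookup m i \<le> (\<Sum>i<p. Poly_Mapping.lookup m i)" using i by (intro member_le_sum) auto
    also have "\<dots> \<le> (\<Sum>m\<in>?Ks. \<Sum>i<p. Poly_Mapping.lookup m i)"
      using member_le_sum[OF m, of "\<lambda>m. \<Sum>i<p. Poly_Mapping.lookup m i"] by simp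
    finally show ?thesis by (simp add: B_def)
  qed
  have e: "e m = K * total_degree p m + r m" for m
    by (simp add: e_def w_def r_def total_degree_def algebra_simps sum.distrib sum_distrib_left)
  have inj: "m = m0" if m: "m \<in> ?Ks" and em: "e m = e m0" for m
  proof -
    from arg_cong[OF em, of "\<lambda>k. k mod K"] have "r m = r m0"
      unfolding e using rK[OF m] rK[OF m0] by simp
    then have eq: "\<forall>i<p. Poly_Mapping.lookup m i = Poly_Mapping.lookup m0 i"
      unfolding r_def by (intro digits_inject[of p _ B]) (auto intro: digit m m0)
    have k: "Poly_Mapping.keys m \<subseteq> {..<p}" "Poly_Mapping.keys m0 \<subseteq> {..<p}"
      using poly_superalg_coeff[OF P I] m m0 by (auto simp: poly_algebra_def)
    have out: "Poly_Mapping.lookup m i = 0" "Poly_Mapping.lookup m0 i = 0" if "\<not> i < p" for i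
      using k that by (auto simp: in_keys_iff subset_iff)
    show ?thesis
    proof (rule poly_mapping_eqI)
      show "Poly_Mapping.lookup m i = Poly_Mapping.lookup m0 i" for i
        using eq out[of i] by (cases "i < p") simp_all
    qed
  qed
  have w: "\<forall>i<p. 0 < w i" "\<forall>i<p. K \<le> w i" by (simp_all add: w_def K_def)
  obtain W f where W: "nbd W" "f \<in> carrier (S W)" "poly_germ P = chart_germ W f" "order_at_least w K n f"
    using germ_order_ideal_power[OF w Pn] unfolding germ_order_def by blast
  obtain Z where Z: "nbd Z \<and> Z \<subseteq> W \<inter> V0 \<and> (\<forall>I z. I \<subseteq> {..<q} \<longrightarrow> z \<in> Z \<longrightarrow> f I z = poly_section V0 P I z)"
    using chart_germ_eqD[OF W(1) nbd_V0 W(2) poly_section_closed[OF V0] W(3)[unfolded poly_germ_def, symmetric]] by (rule exE)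
  have "order_at_least w K n (poly_section V0 P)"
    by (rule order_at_least_cong[OF w(1) _ _ W(4), of Z]) (use Z in blast)+
  then have O: "(\<lambda>t. poly_section V0 P I (curve w t)) \<in> O[at 0](\<lambda>t. t ^ (K * (n - card I)))"
    using I unfolding order_at_least_def by blast
  define Q where "Q = (\<Sum>m\<in>?Ks. Polynomial.monom (Poly_Mapping.lookup (P I) m) (e m))"
  have monom: "monom_eval p m (\<lambda>i. curve w t i - y i) = t ^ e m" for m t
  proof -
    have "monom_eval p m (\<lambda>i. curve w t i - y i) = (\<Prod>i<p. t ^ (w i * Poly_Mapping.lookup m i))"
      unfolding monom_eval_def by (intro prod.cong) (simp_all add: curve_def power_mult)
    then show ?thesis by (simp add: e_def power_sum)
  qed
  have ev: "\<forall>\<^sub>F t in at 0. poly_section V0 P I (curve w t) = poly Q t"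
    using eventually_curve[OF w(1) nbd_V0]
  proof eventually_elim
    case (elim t)
    then show ?case
      by (simp add: poly_section_apply[OF I] poly_eval_def monom Q_def poly_sum poly_monom)
  qed
  have "(\<lambda>t. poly Q t) \<in> O[at 0](\<lambda>t. t ^ (K * (n - card I)))"
    using O by (subst (asm) landau_o.big.in_cong[OF ev])
  moreover have "e m0 < K * (n - card I)"
  proof -
    have "e m0 < K * total_degree p m0 + K" unfolding e using rK[OF m0] by simp
    also have "\<dots> = K * (total_degree p m0 + 1)" by simp
    also have "\<dots> \<le> K * (n - card I)" using deg by (intro mult_le_mono2)
    finally show ?thesis .
  qed
  ultimately have "Polynomial.coeff Q (e m0) = 0" by (rule poly_bigo_coeff_zero)
  moreover have "Polynomial.coeff Q (e m0) = (\<Sum>m\<in>?Ks. if m = m0 then Poly_Mapping.lookup (P I) m0 else 0)"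
    unfolding Q_def coeff_sum by (intro sum.cong) (use inj in auto)
  ultimately show False using m0 by (simp add: in_keys_iff)
qed

section \<open>Generators of the maximal ideal\<close>

text \<open>
  That the maximal ideal is contained in this set is the surjectivity of \<open>poly_germ\<close> on the
  cotangent space.
\<close>

definition "linear_mod_square = {s \<in> carrier (stalk M x).
   \<exists>b\<in>poly_no_const p q. s \<ominus>\<^bsub>stalk M x\<^esub> poly_germ b \<in> ideal_power (stalk M x) value_ideal 2}"

lemma ideal_poly_no_const: "ideal (poly_no_const p q) (poly_superalg p q :: ('k, _) superalg)"
  using graded_ideal_poly_no_const by (auto simp: graded_ideal_def)

lemma linear_mod_square_add:
  assumes "s \<in> linear_mod_square" "t \<in> linear_mod_square"
  shows "s \<oplus>\<^bsub>stalk M x\<^esub> t \<in> linear_mod_square"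
proof -
  interpret B: ideal "poly_no_const p q" "poly_superalg p q :: ('k, _) superalg" by (rule ideal_poly_no_const)
  obtain b c where s: "s \<in> carrier (stalk M x)" "b \<in> poly_no_const p q" "s \<ominus>\<^bsub>stalk M x\<^esub> poly_germ b \<in> ideal_power (stalk M x) value_ideal 2"
    and t: "t \<in> carrier (stalk M x)" "c \<in> poly_no_const p q" "t \<ominus>\<^bsub>stalk M x\<^esub> poly_germ c \<in> ideal_power (stalk M x) value_ideal 2"
    using assms unfolding linear_mod_square_def by blast
  have bc: "poly_germ b \<in> carrier (stalk M x)" "poly_germ c \<in> carrier (stalk M x)"
    using superalg_homD(1)[OF poly_germ_hom] B.Icarr s(2) t(2) by blast+
  have "(s \<oplus>\<^bsub>stalk M x\<^esub> t) \<ominus>\<^bsub>stalk M x\<^esub> poly_germ (b \<oplus>\<^bsub>poly_superalg p q\<^esub> c) =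
      (s \<ominus>\<^bsub>stalk M x\<^esub> poly_germ b) \<oplus>\<^bsub>stalk M x\<^esub> (t \<ominus>\<^bsub>stalk M x\<^esub> poly_germ c)"
    unfolding superalg_homD(3)[OF poly_germ_hom B.Icarr[OF s(2)] B.Icarr[OF t(2)]]
    using s(1) t(1) bc by algebra
  then have "(s \<oplus>\<^bsub>stalk M x\<^esub> t) \<ominus>\<^bsub>stalk M x\<^esub> poly_germ (b \<oplus>\<^bsub>poly_superalg p q\<^esub> c) \<in> ideal_power (stalk M x) value_ideal 2"
    using additive_subgroup.a_closed[OF ideal.axioms(1)[OF stalk.ideal_ideal_power[OF value_ideal]] s(3) t(3)] by simp
  then show ?thesis
    unfolding linear_mod_square_def using additive_subgroup.a_closed[OF ideal.axioms(1)[OF ideal_poly_no_const] s(2) t(2)] stalk.a_closed[OF s(1) t(1)] by blast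
qed

text \<open>
  Modulo the square of the maximal ideal, the factor \<open>k\<close> can be replaced by its value.
\<close>

lemma mult_linear_mod_square:
  assumes k: "k \<in> carrier (stalk M x)" and b: "b \<in> poly_no_const p q"
  shows "k \<otimes>\<^bsub>stalk M x\<^esub> poly_germ b \<in> linear_mod_square"
proof -
  interpret B: superalg "poly_superalg p q :: ('k, _) superalg" by (rule superalgI[OF superalgebra_poly_superalg])
  let ?c = "germ_value k" and ?e = "poly_germ b"
  have bc: "b \<in> carrier (poly_superalg p q)" using ideal.Icarr[OF ideal_poly_no_const b] .
  have e: "?e \<in> value_ideal" "?e \<in> carrier (stalk M x)"
    using poly_germ_no_const b superalg_homD(1)[OF poly_germ_hom bc] by blast+
  let ?d = "k \<ominus>\<^bsub>stalk M x\<^esub> ?c \<odot>\<^bsub>stalk M x\<^esub> \<one>\<^bsub>stalk M x\<^esub>"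
  have c1: "?c \<odot>\<^bsub>stalk M x\<^esub> \<one>\<^bsub>stalk M x\<^esub> \<in> carrier (stalk M x)" by simp
  have "?d \<otimes>\<^bsub>stalk M x\<^esub> ?e \<in> ideal_power (stalk M x) value_ideal (1 + 1)"
    using value_ideal_codim[OF k] e(1) stalk.ideal_power_1[OF value_ideal]
    by (intro stalk.ideal_power_mult[OF value_ideal]) simp_all
  moreover have "?d \<otimes>\<^bsub>stalk M x\<^esub> ?e = k \<otimes>\<^bsub>stalk M x\<^esub> ?e \<ominus>\<^bsub>stalk M x\<^esub> (?c \<odot>\<^bsub>stalk M x\<^esub> \<one>\<^bsub>stalk M x\<^esub>) \<otimes>\<^bsub>stalk M x\<^esub> ?e"
    using k e(2) c1 by algebra
  moreover have "(?c \<odot>\<^bsub>stalk M x\<^esub> \<one>\<^bsub>stalk M x\<^esub>) \<otimes>\<^bsub>stalk M x\<^esub> ?e = poly_germ (?c \<odot>\<^bsub>poly_superalg p q\<^esub> b)"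
    using e(2) by (simp add: stalk.smult_mult_left superalg_homD(5)[OF poly_germ_hom bc])
  ultimately have "k \<otimes>\<^bsub>stalk M x\<^esub> ?e \<ominus>\<^bsub>stalk M x\<^esub> poly_germ (?c \<odot>\<^bsub>poly_superalg p q\<^esub> b) \<in> ideal_power (stalk M x) value_ideal 2"
    by (simp only: one_add_one)
  then show ?thesis
    unfolding linear_mod_square_def using B.ideal_smult[OF ideal_poly_no_const b] stalk.m_closed[OF k e(2)] by blast
qed

text \<open>The section \<open>u \<theta>\<^sub>I\<close>.\<close>

definition "single_section W I u = (\<lambda>J\<in>Pow {..<q}. if J = I then u else (\<lambda>z\<in>W. 0))"

lemma single_section_closed: "openin (coord_space p) W \<Longrightarrow> u \<in> F p W \<Longrightarrow> single_section W I u \<in> carrier (S W)"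
  unfolding model_carrier single_section_def using const[of W 0] by simp

lemma single_section_apply: "J \<subseteq> {..<q} \<Longrightarrow> z \<in> W \<Longrightarrow> single_section W I u J z = (if J = I then u z else 0)"
  by (simp add: single_section_def)

lemma single_section_mult:
  assumes W: "nbd W" and u: "u \<in> F p W" and v: "v \<in> F p W" and uv: "uv \<in> F p W" "\<And>z. z \<in> W \<Longrightarrow> uv z = u z * v z"
    and IJ: "I \<inter> J = {}" "shuffle_sign I J = (1 :: 'k)"
  shows "single_section W I u \<otimes>\<^bsub>S W\<^esub> single_section W J v = single_section W (I \<union> J) uv"
proof -
  have oW: "openin (coord_space p) W" using W by blast
  note c = single_section_closed[OF oW u] single_section_closed[OF oW v]
  show ?thesis
  proof (rule model_eqI[OF model_mult_closed[OF oW c] single_section_closed[OF oW uv(1)]])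
    fix L z assume L: "L \<subseteq> {..<q}" and z: "z \<in> W"
    have "gmult (\<lambda>K. single_section W I u K z) (\<lambda>K. single_section W J v K z) L =
      gmult (\<lambda>K. if K = I then u z else 0) (\<lambda>K. if K = J then v z else 0) L"
      using L z by (intro gmult_cong single_section_apply) auto
    then show "(single_section W I u \<otimes>\<^bsub>S W\<^esub> single_section W J v) L z = single_section W (I \<union> J) uv L z"
      using IJ uv(2)[OF z] by (simp add: model_mult[OF oW c L z] gmult_single[OF finite_subset[OF L finite_lessThan]] single_section_apply[OF L z])
  qed
qed

text \<open>
  If \<open>I\<close> is nonempty, its largest odd variable can be split off as a linear factor. Otherwise
  \<open>u\<close> vanishes at \<open>y\<close>, and Hadamard's lemma splits off the even variables.
\<close>

lemma chart_germ_single_in: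
  assumes W: "nbd W" and I: "I \<subseteq> {..<q}" and u: "u \<in> F p W" and u0: "I = {} \<Longrightarrow> u y = 0"
  shows "chart_germ W (single_section W I u) \<in> linear_mod_square"
proof (cases "I = {}")
  case False
  have fin: "finite I" using I finite_subset by blast
  \<comment> \<open>The largest index, so that moving \<open>\<theta>\<^sub>j\<close> to the end costs no sign.\<close>
  define j where "j = Max I"
  have j: "j \<in> I" "j < q" using Max_in[OF fin False] I by (auto simp: j_def)
  let ?b = "super_monom q (1 :: 'k) 0 {j}"
  have oW: "openin (coord_space p) W" using W by blast
  have "single_section W (I - {j}) u \<otimes>\<^bsub>S W\<^esub> single_section W {j} (\<lambda>z\<in>W. 1) = single_section W ((I - {j}) \<union> {j}) u"
  proof (rule single_section_mult[OF W u const[OF oW] u])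
    show "shuffle_sign (I - {j}) {j} = (1 :: 'k)"
      using Max_ge[OF fin] by (intro shuffle_sign_below) (auto simp: j_def order.strict_iff_order)
  qed auto
  moreover have "(I - {j}) \<union> {j} = I" using j(1) by blast
  moreover have "chart_germ W (single_section W {j} (\<lambda>z\<in>W. 1)) = poly_germ ?b"
    by (rule poly_germ_eq_chart_germ[OF W single_section_closed[OF oW const[OF oW]]])
      (simp add: single_section_apply super_monom_def)
  ultimately have "chart_germ W (single_section W I u) = chart_germ W (single_section W (I - {j}) u) \<otimes>\<^bsub>stalk M x\<^esub> poly_germ ?b"
    using superalg_homD(2)[OF chart_germ_hom[OF W] single_section_closed[OF oW u, of "I - {j}"] single_section_closed[OF oW const[OF oW, of 1], of "{j}"]]
    by simp
  moreover have "?b \<in> poly_no_const p q"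
    unfolding poly_no_const_def using super_monom_closed[of 0 p q 1 "{j}"] by (simp add: super_monom_def)
  ultimately show ?thesis
    using mult_linear_mod_square superalg_homD(1)[OF chart_germ_hom[OF W] single_section_closed[OF oW u]] by simp
next
  case True
  obtain r where r: "0 < r" "polydisc p y r \<subseteq> W" using polydisc_subset_open[of p W y] W by blast
  have "restrict u (polydisc p y r) \<in> F p (polydisc p y r)"
    using restrict[OF _ openin_polydisc r(2) u] W by blast
  from hadamard[OF y_topspace r(1) this]
  obtain d g where d: "0 < d" "d \<le> r" and g: "\<And>i. i < p \<Longrightarrow> g i \<in> F p (polydisc p y d)"
    and uz: "\<And>z. z \<in> polydisc p y d \<Longrightarrow> restrict u (polydisc p y r) z =
       restrict u (polydisc p y r) y + (\<Sum>i<p. (z i - y i) * g i z)" by blast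
  let ?D = "polydisc p y d"
  have D: "?D \<subseteq> polydisc p y r" by (rule polydisc_mono[OF d(2)])
  have oD: "openin (coord_space p) ?D" by (rule openin_polydisc)
  have nD: "nbd ?D" using oD polydisc_center[OF y_topspace d(1)] D r(2) W by auto
  have sumF: "(\<lambda>z\<in>?D. \<Sum>i<n. g i z * (z i - y i)) \<in> F p ?D" if "n \<le> p" for n
    using that by (intro sum_closed mult' restrict_self[OF g] shifted_coord oD) auto
  have term_in: "chart_germ ?D (single_section ?D {} (\<lambda>z\<in>?D. g i z * (z i - y i))) \<in> linear_mod_square" if i: "i < p" for i
  proof -
    let ?b = "super_monom q (1 :: 'k) (Poly_Mapping.single i 1) {}"
    have lin: "(\<lambda>z\<in>?D. z i - y i) \<in> F p ?D" by (rule shifted_coord[OF oD i])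
    have pr: "(\<lambda>z\<in>?D. g i z * (z i - y i)) \<in> F p ?D" by (rule mult'[OF oD restrict_self[OF g[OF i]] lin])
    have "single_section ?D {} (g i) \<otimes>\<^bsub>S ?D\<^esub> single_section ?D {} (\<lambda>z\<in>?D. z i - y i) =
        single_section ?D ({} \<union> {}) (\<lambda>z\<in>?D. g i z * (z i - y i))"
      by (rule single_section_mult[OF nD g[OF i] lin pr]) (simp_all add: shuffle_sign_def)
    moreover have "chart_germ ?D (single_section ?D {} (\<lambda>z\<in>?D. z i - y i)) = poly_germ ?b"
    proof (rule poly_germ_eq_chart_germ[OF nD single_section_closed[OF oD lin]])
      have "monom_eval p (Poly_Mapping.single i 1) v = v i" for v :: "nat \<Rightarrow> 'k"
      proof -
        have "monom_eval p (Poly_Mapping.single i 1) v = (\<Prod>k<p. if k = i then v k else 1)"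
          unfolding monom_eval_def by (intro prod.cong) (auto simp: lookup_single when_def)
        then show ?thesis using i by simp
      qed
      then show "single_section ?D {} (\<lambda>z\<in>?D. z i - y i) I z = poly_eval p (?b I) (\<lambda>i. z i - y i)"
        if "I \<subseteq> {..<q}" "z \<in> ?D" for I z
        using that by (simp add: single_section_apply super_monom_def)
    qed
    ultimately have "chart_germ ?D (single_section ?D {} (\<lambda>z\<in>?D. g i z * (z i - y i))) =
        chart_germ ?D (single_section ?D {} (g i)) \<otimes>\<^bsub>stalk M x\<^esub> poly_germ ?b"
      using superalg_homD(2)[OF chart_germ_hom[OF nD] single_section_closed[OF oD g[OF i], of "{}"] single_section_closed[OF oD lin, of "{}"]]
      by simp
    moreover have "?b \<in> poly_no_const p q"
    proof -
      have "Poly_Mapping.single i 1 \<noteq> (0 :: nat \<Rightarrow>\<^sub>0 nat)"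
        by (metis lookup_single_eq lookup_zero one_neq_zero)
      then have "Poly_Mapping.lookup (super_monom q (1 :: 'k) (Poly_Mapping.single i 1) {} {}) 0 = 0"
        unfolding super_monom_def by (simp add: lookup_single_not_eq)
      then show ?thesis
        unfolding poly_no_const_def using super_monom_closed[of "Poly_Mapping.single i 1" p q 1 "{}"] i by simp
    qed
    ultimately show ?thesis
      using mult_linear_mod_square superalg_homD(1)[OF chart_germ_hom[OF nD] single_section_closed[OF oD g[OF i]]] by simp
  qed
  have "chart_germ ?D (single_section ?D {} (\<lambda>z\<in>?D. \<Sum>i<n. g i z * (z i - y i))) \<in> linear_mod_square" if "n \<le> p" for n
    using that
  proof (induction n)
    case 0
    have "single_section ?D {} (\<lambda>z\<in>?D. 0) = poly_section ?D \<zero>\<^bsub>poly_superalg p q\<^esub>"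
      by (rule model_eqI[OF single_section_closed[OF oD const[OF oD]] poly_section_closed[OF oD]])
        (simp add: single_section_apply poly_section_apply poly_superalg_zero)
    then have eq: "chart_germ ?D (single_section ?D {} (\<lambda>z\<in>?D. 0)) = poly_germ \<zero>\<^bsub>poly_superalg p q\<^esub>"
      using poly_germ_eq_chart_germ[OF nD poly_section_closed[OF oD]] by (simp add: poly_section_apply)
    have "\<zero>\<^bsub>poly_superalg p q\<^esub> \<in> (poly_no_const p q :: (nat set \<Rightarrow> (nat \<Rightarrow>\<^sub>0 nat) \<Rightarrow>\<^sub>0 'k) set)"
      using additive_subgroup.zero_closed[OF ideal.axioms(1)[OF ideal_poly_no_const]] .
    from mult_linear_mod_square[OF stalk.one_closed this] have "poly_germ \<zero>\<^bsub>poly_superalg p q\<^esub> \<in> linear_mod_square"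
      using superalg_homD(1)[OF poly_germ_hom poly_superalg_closed(1)] by simp
    then show ?case by (simp only: eq lessThan_0 sum.empty)
  next
    case (Suc n)
    have pr: "(\<lambda>z\<in>?D. g n z * (z n - y n)) \<in> F p ?D"
      using Suc.prems by (intro mult' restrict_self[OF g] shifted_coord oD) auto
    have "single_section ?D {} (\<lambda>z\<in>?D. \<Sum>i<Suc n. g i z * (z i - y i)) =
       single_section ?D {} (\<lambda>z\<in>?D. \<Sum>i<n. g i z * (z i - y i)) \<oplus>\<^bsub>S ?D\<^esub> single_section ?D {} (\<lambda>z\<in>?D. g n z * (z n - y n))"
      using Suc.prems
      by (intro model_eqI[OF single_section_closed[OF oD sumF] model_add_closed[OF oD single_section_closed[OF oD sumF] single_section_closed[OF oD pr]]])
        (simp_all add: single_section_apply model_add)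
    then have eq: "chart_germ ?D (single_section ?D {} (\<lambda>z\<in>?D. \<Sum>i<Suc n. g i z * (z i - y i))) =
       chart_germ ?D (single_section ?D {} (\<lambda>z\<in>?D. \<Sum>i<n. g i z * (z i - y i))) \<oplus>\<^bsub>stalk M x\<^esub>
       chart_germ ?D (single_section ?D {} (\<lambda>z\<in>?D. g n z * (z n - y n)))"
      using superalg_homD(3)[OF chart_germ_hom[OF nD] single_section_closed[OF oD sumF] single_section_closed[OF oD pr], of n] Suc.prems
      by simp
    have n: "n \<le> p" "n < p" using Suc.prems by auto
    show ?case unfolding eq by (rule linear_mod_square_add[OF Suc.IH[OF n(1)] term_in[OF n(2)]])
  qed
  from this[OF order_refl] have lin: "chart_germ ?D (single_section ?D {} (\<lambda>z\<in>?D. \<Sum>i<p. g i z * (z i - y i))) \<in> linear_mod_square" .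
  have yr: "y \<in> polydisc p y r" by (rule polydisc_center[OF y_topspace r(1)])
  have uD: "u z = (\<Sum>i<p. g i z * (z i - y i))" if z: "z \<in> ?D" for z
  proof -
    have "z \<in> polydisc p y r" using z D by blast
    then show ?thesis using uz[OF z] yr u0[OF True] by (simp add: mult.commute)
  qed
  have "chart_germ W (single_section W I u) = chart_germ ?D (single_section ?D {} (\<lambda>z\<in>?D. \<Sum>i<p. g i z * (z i - y i)))"
  proof (rule chart_germ_eqI[OF W nD _ _ nD])
    show "single_section W I u \<in> carrier (S W)" using single_section_closed u W by blast
    show "single_section ?D {} (\<lambda>z\<in>?D. \<Sum>i<p. g i z * (z i - y i)) \<in> carrier (S ?D)"
      by (rule single_section_closed[OF oD sumF[OF order_refl]])
    show "?D \<subseteq> W \<inter> ?D" using D r(2) by blast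
    fix J z assume J: "J \<subseteq> {..<q}" and z: "z \<in> ?D"
    then have "z \<in> W" using D r(2) by blast
    then show "single_section W I u J z = single_section ?D {} (\<lambda>z\<in>?D. \<Sum>i<p. g i z * (z i - y i)) J z"
      using J z uD[OF z] True by (simp add: single_section_apply)
  qed
  then show ?thesis using lin by simp
qed

lemma value_ideal_linear_mod_square: "value_ideal \<subseteq> linear_mod_square"
proof
  fix s assume s: "s \<in> value_ideal"
  have sc: "s \<in> carrier (stalk M x)" and sv: "germ_value s = 0" using s unfolding value_ideal_def by blast+
  obtain W f where W: "nbd W" "f \<in> carrier (S W)" "s = chart_germ W f" by (rule chart_germ_surj[OF sc])
  have fy: "f {} y = 0" using sv germ_value[OF W(1,2)] W(3) by simp
  have oW: "openin (coord_space p) W" using W(1) by blast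
  define part_of where "part_of \<C> = (\<lambda>J\<in>Pow {..<q}. if J \<in> \<C> then f J else (\<lambda>z\<in>W. 0))" for \<C>
  have pc: "part_of \<C> \<in> carrier (S W)" for \<C>
    unfolding model_carrier part_of_def using const[OF oW, of 0] model_coeff[OF W(2)] by simp
  have papp: "part_of \<C> J z = (if J \<in> \<C> then f J z else 0)" if "J \<subseteq> {..<q}" "z \<in> W" for \<C> J z
    using that by (simp add: part_of_def)
  have "chart_germ W (part_of \<C>) \<in> linear_mod_square" if "finite \<C>" "\<C> \<subseteq> Pow {..<q}" for \<C>
    using that
  proof (induction rule: finite_induct)
    case empty
    have "part_of {} = single_section W {} (\<lambda>z\<in>W. 0)"
      by (rule model_eqI[OF pc single_section_closed[OF oW const[OF oW]]]) (simp add: papp single_section_apply)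
    then show ?case using chart_germ_single_in[OF W(1) _ const[OF oW, of 0], of "{}"] W(1) by simp
  next
    case (insert I \<C>)
    have I: "I \<subseteq> {..<q}" using insert by blast
    note sI = single_section_closed[OF oW model_coeff[OF W(2) I], of I]
    have "part_of (insert I \<C>) = single_section W I (f I) \<oplus>\<^bsub>S W\<^esub> part_of \<C>"
      by (rule model_eqI[OF pc model_add_closed[OF oW sI pc]])
        (use insert(2) in \<open>auto simp: papp single_section_apply model_add\<close>)
    then have "chart_germ W (part_of (insert I \<C>)) = chart_germ W (single_section W I (f I)) \<oplus>\<^bsub>stalk M x\<^esub> chart_germ W (part_of \<C>)"
      using superalg_homD(3)[OF chart_germ_hom[OF W(1)] sI pc] by simp
    moreover have "chart_germ W (single_section W I (f I)) \<in> linear_mod_square"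
      by (rule chart_germ_single_in[OF W(1) I model_coeff[OF W(2) I]]) (use fy in simp)
    ultimately show ?case using linear_mod_square_add insert by simp
  qed
  from this[of "Pow {..<q}"] have "chart_germ W (part_of (Pow {..<q})) \<in> linear_mod_square" by simp
  moreover have "part_of (Pow {..<q}) = f" by (rule model_eqI[OF pc W(2)]) (simp add: papp)
  ultimately show "s \<in> linear_mod_square" using W(3) by simp
qed

section \<open>Jets\<close>

text \<open>
  Modulo \<open>\<M>\<^sub>x\<^sup>n\<close> every germ is the germ of a polynomial, and the monomials of degree at least \<open>n\<close>
  in the even variables drop out, which leaves finitely many.
\<close>

lemma finite_dimensional_jets:
  "finite_dimensional (quotient_superalg (stalk M x) (ideal_power (stalk M x) value_ideal n))"
proof -
  let ?J = "ideal_power (stalk M x) value_ideal n"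
  let ?B = "poly_superalg p q :: ('k, _) superalg"
  interpret B: superalg ?B by (rule superalgI[OF superalgebra_poly_superalg])
  interpret Q: superalg_quotient "stalk M x" ?J "quotient_superalg (stalk M x) ?J"
    by unfold_locales (rule stalk.graded_ideal_power[OF graded_value_ideal])
  define Q where "Q = quotient_superalg (stalk M x) ?J"
  interpret QA: superalg Q unfolding Q_def by (rule superalgI[OF Q.superalgebra_quotient])
  define \<pi> where "\<pi> P = ?J +>\<^bsub>stalk M x\<^esub> poly_germ P" for P
  have \<pi>: "\<pi> \<in> superalg_hom ?B Q"
    unfolding \<pi>_def[abs_def] Q_def by (rule superalg_hom_compose[OF poly_germ_hom Q.proj_hom])
  define E where "E = {m. Poly_Mapping.keys m \<subseteq> {..<p} \<and> total_degree p m < n}"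
  have finE: "finite E"
  proof (rule inj_on_finite)
    show "inj_on (\<lambda>m. restrict (Poly_Mapping.lookup m) {..<p}) E"
    proof (rule inj_onI)
      fix m m' assume m: "m \<in> E" "m' \<in> E" "restrict (Poly_Mapping.lookup m) {..<p} = restrict (Poly_Mapping.lookup m') {..<p}"
      show "m = m'"
      proof (rule poly_mapping_eqI)
        fix i show "Poly_Mapping.lookup m i = Poly_Mapping.lookup m' i"
        proof (cases "i < p")
          case True
          then show ?thesis using fun_cong[OF m(3), of i] by simp
        next
          case False
          then have "i \<notin> Poly_Mapping.keys m" "i \<notin> Poly_Mapping.keys m'" using m(1,2) by (auto simp: E_def)
          then show ?thesis by (simp add: in_keys_iff)
        qed
      qed
    qed
    show "(\<lambda>m. restrict (Poly_Mapping.lookup m) {..<p}) ` E \<subseteq> {..<p} \<rightarrow>\<^sub>E {..<n}"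
    proof (rule image_subsetI)
      fix m assume m: "m \<in> E"
      have "Poly_Mapping.lookup m i < n" if "i < p" for i
        using member_le_sum[of i "{..<p}" "Poly_Mapping.lookup m"] m that by (simp add: E_def total_degree_def)
      then show "restrict (Poly_Mapping.lookup m) {..<p} \<in> {..<p} \<rightarrow>\<^sub>E {..<n}" by simp
    qed
  qed (simp add: finite_PiE)
  let ?S = "(\<lambda>(I, m). \<pi> (super_monom q 1 m I)) ` (Pow {..<q} \<times> E)"
  have "finite_dimensional Q"
  proof (rule QA.finite_dimensionalI)
    show "finite ?S" using finE by simp
    show "?S \<subseteq> carrier Q"
      by (auto simp: E_def intro!: superalg_homD(1)[OF \<pi>] super_monom_closed)
    fix H assume H0: "\<zero>\<^bsub>Q\<^esub> \<in> H" and Hadd: "\<And>a b. a \<in> H \<Longrightarrow> b \<in> H \<Longrightarrow> a \<oplus>\<^bsub>Q\<^esub> b \<in> H"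
      and HS: "\<And>c s. s \<in> ?S \<Longrightarrow> c \<odot>\<^bsub>Q\<^esub> s \<in> H"
    have PH: "P \<in> {P \<in> carrier ?B. \<pi> P \<in> H}" if P: "P \<in> carrier ?B" for P
    proof (rule poly_superalg_induct[OF P])
      show "\<zero>\<^bsub>?B\<^esub> \<in> {P \<in> carrier ?B. \<pi> P \<in> H}"
        using superalg_hom_zero[OF \<pi> B.superalgebra QA.superalgebra] H0 by simp
      show "P1 \<oplus>\<^bsub>?B\<^esub> P2 \<in> {P \<in> carrier ?B. \<pi> P \<in> H}"
        if "P1 \<in> {P \<in> carrier ?B. \<pi> P \<in> H}" "P2 \<in> {P \<in> carrier ?B. \<pi> P \<in> H}" for P1 P2
        using that superalg_homD(3)[OF \<pi>, of P1 P2] Hadd by simp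
      fix I m assume I: "I \<subseteq> {..<q}" and m: "m \<in> Poly_Mapping.keys (P I)"
      have mp: "Poly_Mapping.keys m \<subseteq> {..<p}" using poly_superalg_coeff[OF P I] m by (auto simp: poly_algebra_def)
      let ?c = "Poly_Mapping.lookup (P I) m"
      have "\<pi> (super_monom q ?c m I) \<in> H"
      proof (cases "total_degree p m < n")
        case True
        have "super_monom q ?c m I = ?c \<odot>\<^bsub>?B\<^esub> super_monom q 1 m I"
          by (rule poly_superalg_eqI[OF super_monom_closed[OF mp] B.smult_closed[OF super_monom_closed[OF mp]]])
            (simp add: poly_superalg_smult super_monom_def mult_single)
        moreover have "\<pi> (super_monom q 1 m I) \<in> ?S" using I mp True by (auto simp: E_def)
        ultimately show ?thesis using superalg_homD(5)[OF \<pi> super_monom_closed[OF mp]] HS by simp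
      next
        case False
        then have "super_monom q ?c m I \<in> ideal_power ?B (poly_no_const p q) n"
          using super_monom_in_power[OF mp I, of ?c] B.ideal_power_antimono[OF ideal_poly_no_const, of n "total_degree p m + card I"]
          by auto
        then have "poly_germ (super_monom q ?c m I) \<in> ?J"
          by (rule superalg_hom_ideal_power[OF poly_germ_hom B.superalgebra ideal_poly_no_const poly_germ_no_const])
        then have "\<pi> (super_monom q ?c m I) = \<zero>\<^bsub>Q\<^esub>"
          unfolding \<pi>_def Q_def using Q.proj_zero_iff superalg_homD(1)[OF poly_germ_hom super_monom_closed[OF mp]] by blast
        then show ?thesis using H0 by simp
      qed
      then show "super_monom q ?c m I \<in> {P \<in> carrier ?B. \<pi> P \<in> H}" using super_monom_closed[OF mp] by simp
    qed
    show "carrier Q \<subseteq> H"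
    proof
      fix a assume "a \<in> carrier Q"
      then obtain s where s: "s \<in> carrier (stalk M x)" "a = ?J +>\<^bsub>stalk M x\<^esub> s"
        unfolding Q_def Q.quotient_carrier by blast
      obtain b where b: "b \<in> carrier ?B" "s \<ominus>\<^bsub>stalk M x\<^esub> poly_germ b \<in> ?J"
        using surj_modulo_ideal_power[OF stalk.superalgebra B.superalgebra poly_germ_hom value_ideal ideal_poly_no_const
            poly_germ_no_const _ _ s(1)] value_ideal_codim value_ideal_linear_mod_square
        unfolding linear_mod_square_def by blast
      have "a = \<pi> b" unfolding s(2) \<pi>_def using Q.proj_eq_iff[OF s(1) superalg_homD(1)[OF poly_germ_hom b(1)]] b(2) by blast
      then show "a \<in> H" using PH[OF b(1)] by simp
    qed
  qed
  then show ?thesis by (simp add: Q_def)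
qed

lemma jets_isomorphic:
  "superalg_isomorphic (quotient_superalg (stalk M x) (ideal_power (stalk M x) value_ideal n))
     (quotient_superalg (poly_superalg p q) (ideal_power (poly_superalg p q) (poly_no_const p q) n))"
proof -
  let ?B = "poly_superalg p q :: ('k, _) superalg"
  interpret B: superalg ?B by (rule superalgI[OF superalgebra_poly_superalg])
  show ?thesis
  proof (rule superalg_isomorphic_quotientsI[OF stalk.superalgebra B.superalgebra poly_germ_hom
        stalk.graded_ideal_power[OF graded_value_ideal] B.graded_ideal_power[OF graded_ideal_poly_no_const]])
    fix b assume b: "b \<in> carrier ?B"
    show "poly_germ b \<in> ideal_power (stalk M x) value_ideal n \<longleftrightarrow> b \<in> ideal_power ?B (poly_no_const p q) n"
      using poly_germ_reflects_power[OF b]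
        superalg_hom_ideal_power[OF poly_germ_hom B.superalgebra ideal_poly_no_const poly_germ_no_const] by blast
  next
    fix s assume "s \<in> carrier (stalk M x)"
    then show "\<exists>b\<in>carrier ?B. s \<ominus>\<^bsub>stalk M x\<^esub> poly_germ b \<in> ideal_power (stalk M x) value_ideal n"
      using surj_modulo_ideal_power[OF stalk.superalgebra B.superalgebra poly_germ_hom value_ideal ideal_poly_no_const
          poly_germ_no_const] value_ideal_codim value_ideal_linear_mod_square
      unfolding linear_mod_square_def by blast
  qed
qed

end

section \<open>Distributions with support at a point\<close>

text \<open>
  Both cases at once. Locality of the stalk identifies \<open>stalk_ideal M x\<close>, the unique maximal ideal,
  with the germs of value zero in the chart.
\<close>

theorem supermanifold_distributions:
  fixes M :: "('m, 'k::real_normed_field, 's) superspace"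
  assumes F: "function_class F p" and M: "supermanifold F p q M" and x: "x \<in> topspace (body M)"
  shows "\<forall>(A :: ('k, 'a) superalg) xA w.
      super_weil_algebra A \<and> xA \<in> points_near A M x \<and> w \<in> dual A \<longrightarrow>
        compose (carrier (stalk M x)) w xA \<in> distributions M x"
    and "\<forall>k. super_weil_algebra (jet_algebra k M x) \<and>
      superalg_isomorphic (jet_algebra k M x) (truncated_poly_superalg k p q) \<and>
      (\<forall>v \<in> distributions_order k M x.
         \<exists>xA \<in> points_near (jet_algebra k M x) M x. \<exists>w \<in> dual (jet_algebra k M x).
           v = compose (carrier (stalk M x)) w xA)"
proof -
  have sheaf: "sheaf_of_superalgebras M" and local: "\<exists>!I. maximalideal I (stalk M x)"
    and "\<exists>U V \<phi> \<Psi>. openin (body M) U \<and> x \<in> U \<and> openin (coord_space p) V \<and>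
        superspace_iso M U (model_superspace F p q) V \<phi> \<Psi>"
    using M x unfolding supermanifold_def by blast+
  then obtain U V \<phi> \<Psi> where chart: "openin (body M) U" "x \<in> U" "openin (coord_space p) V"
    "superspace_iso M U (model_superspace F p q) V \<phi> \<Psi>" by blast
  have presheaf: "presheaf_of_superalgebras M" using sheaf unfolding sheaf_of_superalgebras_def by (rule conjunct1)
  interpret chart_at F p M x q U V \<phi> \<Psi>
    by (intro chart_at.intro chart_at_axioms.intro presheaf_at.intro F presheaf x chart)
  note ideal_eq = stalk_ideal_eq[OF local]
  show "\<forall>(A :: ('k, 'a) superalg) xA w.
      super_weil_algebra A \<and> xA \<in> points_near A M x \<and> w \<in> dual A \<longrightarrow>
        compose (carrier (stalk M x)) w xA \<in> distributions M x"
  proof (intro allI impI, elim conjE)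
    fix A :: "('k, 'a) superalg" and xA w
    assume A: "super_weil_algebra A" and "xA \<in> points_near A M x" and w: "w \<in> dual A"
    then have h: "xA \<in> superalg_hom (stalk M x) A" by (simp only: points_near_def)
    have A': "superalgebra A" using A by (simp only: super_weil_algebra_def)
    obtain k where k: "\<forall>f\<in>ideal_power (stalk M x) (THE I. maximalideal I (stalk M x)) (k + 1). xA f = \<zero>\<^bsub>A\<^esub>"
      using weil_point_kills_ideal_power[OF stalk.superalgebra local A h] by (rule exE)
    have "compose (carrier (stalk M x)) w xA f = 0"
      if f: "f \<in> ideal_power (stalk M x) (stalk_ideal M x) (k + 1)" for f
    proof -
      have "f \<in> carrier (stalk M x)"
        using f ideal.Icarr[OF stalk.ideal_ideal_power[OF value_ideal]] unfolding ideal_eq by blast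
      moreover have "xA f = \<zero>\<^bsub>A\<^esub>" using k f unfolding stalk_ideal_def by blast
      ultimately show ?thesis using dual_zero[OF A' w] by (simp add: compose_def)
    qed
    then have "compose (carrier (stalk M x)) w xA \<in> distributions_order k M x"
      unfolding distributions_order_def using functional_compose_hom[OF h stalk.superalgebra w] by blast
    then show "compose (carrier (stalk M x)) w xA \<in> distributions M x"
      unfolding distributions_def by blast
  qed
  show "\<forall>k. super_weil_algebra (jet_algebra k M x) \<and>
      superalg_isomorphic (jet_algebra k M x) (truncated_poly_superalg k p q) \<and>
      (\<forall>v \<in> distributions_order k M x.
         \<exists>xA \<in> points_near (jet_algebra k M x) M x. \<exists>w \<in> dual (jet_algebra k M x).
           v = compose (carrier (stalk M x)) w xA)"
  proof (intro allI conjI ballI)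
    fix k
    show "super_weil_algebra (jet_algebra k M x)"
      unfolding jet_algebra_def ideal_eq
      by (rule super_weil_algebra_quotient_power[OF stalk.superalgebra graded_value_ideal one_not_value_ideal _ finite_dimensional_jets])
        (use value_ideal_codim in blast)
    show "superalg_isomorphic (jet_algebra k M x) (truncated_poly_superalg k p q)"
      unfolding jet_algebra_def truncated_poly_superalg_def ideal_eq by (rule jets_isomorphic)
    fix v assume "v \<in> distributions_order k M x"
    then have v: "v \<in> dual (stalk M x)" "\<And>f. f \<in> ideal_power (stalk M x) value_ideal (k + 1) \<Longrightarrow> v f = 0"
      unfolding distributions_order_def ideal_eq by blast+
    show "\<exists>xA \<in> points_near (jet_algebra k M x) M x. \<exists>w \<in> dual (jet_algebra k M x).
           v = compose (carrier (stalk M x)) w xA"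
      unfolding points_near_def jet_algebra_def ideal_eq
      by (rule functional_factors_through_quotient[OF stalk.superalgebra stalk.graded_ideal_power[OF graded_value_ideal] v])
  qed
qed

theorem proposition5p3:
  fixes p q :: nat
  shows
    "(\<forall>(M :: ('m, real, 's) superspace) x.
       smooth_supermanifold p q M \<and> x \<in> topspace (body M) \<longrightarrow>
         (\<forall>(A :: (real, 'a) superalg) xA w.
            super_weil_algebra A \<and> xA \<in> points_near A M x \<and> w \<in> dual A \<longrightarrow>
              compose (carrier (stalk M x)) w xA \<in> distributions M x) \<and>
         (\<forall>k. super_weil_algebra (jet_algebra k M x) \<and>
              superalg_isomorphic (jet_algebra k M x) (truncated_poly_superalg k p q) \<and>
              (\<forall>v \<in> distributions_order k M x.
                 \<exists>xA \<in> points_near (jet_algebra k M x) M x. \<exists>w \<in> dual (jet_algebra k M x).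
                   v = compose (carrier (stalk M x)) w xA))) \<and>
     (\<forall>(M :: ('n, complex, 't) superspace) x.
       holomorphic_supermanifold p q M \<and> x \<in> topspace (body M) \<longrightarrow>
         (\<forall>(A :: (complex, 'b) superalg) xA w.
            super_weil_algebra A \<and> xA \<in> points_near A M x \<and> w \<in> dual A \<longrightarrow>
              compose (carrier (stalk M x)) w xA \<in> distributions M x) \<and>
         (\<forall>k. super_weil_algebra (jet_algebra k M x) \<and>
              superalg_isomorphic (jet_algebra k M x) (truncated_poly_superalg k p q) \<and>
              (\<forall>v \<in> distributions_order k M x.
                 \<exists>xA \<in> points_near (jet_algebra k M x) M x. \<exists>w \<in> dual (jet_algebra k M x).
                   v = compose (carrier (stalk M x)) w xA)))"
proof (rule conjI; intro allI impI; elim conjE)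
  fix M :: "('m, real, 's) superspace" and x
  assume M: "smooth_supermanifold p q M" and x: "x \<in> topspace (body M)"
  show "(\<forall>(A :: (real, 'a) superalg) xA w.
            super_weil_algebra A \<and> xA \<in> points_near A M x \<and> w \<in> dual A \<longrightarrow>
              compose (carrier (stalk M x)) w xA \<in> distributions M x) \<and>
         (\<forall>k. super_weil_algebra (jet_algebra k M x) \<and>
              superalg_isomorphic (jet_algebra k M x) (truncated_poly_superalg k p q) \<and>
              (\<forall>v \<in> distributions_order k M x.
                 \<exists>xA \<in> points_near (jet_algebra k M x) M x. \<exists>w \<in> dual (jet_algebra k M x).
                   v = compose (carrier (stalk M x)) w xA))"
    by (rule conjI[OF supermanifold_distributions[OF function_class_smooth M x]])
next
  fix M :: "('n, complex, 't) superspace" and x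
  assume M: "holomorphic_supermanifold p q M" and x: "x \<in> topspace (body M)"
  show "(\<forall>(A :: (complex, 'b) superalg) xA w.
            super_weil_algebra A \<and> xA \<in> points_near A M x \<and> w \<in> dual A \<longrightarrow>
              compose (carrier (stalk M x)) w xA \<in> distributions M x) \<and>
         (\<forall>k. super_weil_algebra (jet_algebra k M x) \<and>
              superalg_isomorphic (jet_algebra k M x) (truncated_poly_superalg k p q) \<and>
              (\<forall>v \<in> distributions_order k M x.
                 \<exists>xA \<in> points_near (jet_algebra k M x) M x. \<exists>w \<in> dual (jet_algebra k M x).
                   v = compose (carrier (stalk M x)) w xA))"
    by (rule conjI[OF supermanifold_distributions[OF function_class_holomorphic M x]])
qed

end
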